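(* Let $S(0)=\{q\in J^+(q_0)\mid d(q)=0\}$ be the sub-Lorentzian sphere of zero radius, and let $\mathcal A=I^+(q_0)\cup\{q_0\}$. (1) $S(0)=J^+(q_0)\setminus I^+(q_0)=\partial J^+(q_0)=\partial I^+(q_0)=\partial\mathcal A$. (2) $S(0)$ is the graph of the continuous function $x=\Phi(y,z):=\sqrt{y^2+4|z|}$, thus a 2-dimensional topological manifold. (3) The function $\Phi(y,z)$ is even in $y$ and $z$, real-analytic for $z\ne0$, Lipschitz near $z=0$, $y\neq0$, and Hölder with exponent $\frac12$, non-Lipschitz near $(y,z)=(0,0)$. (4) $S(0)$ is filled by broken lightlike trajectories with one or two edges (concatenations of an integral curve of $X_1\pm X_2$ starting at $q_0$ with an integral curve of $X_1\mp X_2$), and is parametrized by them as follows: \begin{align*} S(0)=&\left\{e^{\tau_2(X_1-X_2)}e^{\tau_1(X_1+X_2)}=(\tau_1+\tau_2,\ \tau_1-\tau_2,\ -\tau_1\tau_2)\mid\tau_i\ge0\right\}\\ &\cup\left\{e^{\tau_2(X_1+X_2)}e^{\tau_1(X_1-X_2)}=(\tau_1+\tau_2,\ \tau_2-\tau_1,\ \tau_1\tau_2)\mid\tau_i\ge0\right\}. \end{align*} (5) The flows of the vector fields $Y$, $X_0$ preserve $S(0)$. Moreover, the symmetries $Y$, $X_0$ provide a regular parametrization $$S(0)\cap\{\operatorname{sgn}z=\pm1\}=\left\{e^{sY}\circ e^{rX_0}(q_\pm)\mid r,s\in\mathbb R\right\},$$ where $q_\pm=(x_\pm,y_\pm,z_\pm)$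 is any point in $S(0)\cap\{\operatorname{sgn}z=\pm1\}$. (6) The sphere $S(0)=\{16z^2=(x^2-y^2)^2,\ x^2-y^2\ge0,\ x\ge0\}$ is a semi-algebraic set. (7) The zero-radius sphere is a Whitney stratified set with the stratification \begin{align*} S(0)=&\big(S(0)\cap\{z>0\}\big)\cup\big(S(0)\cap\{z<0\}\big)\\ &\cup\big(S(0)\cap\{z=0,\ y>0\}\big)\cup\big(S(0)\cap\{z=0,\ y<0\}\big)\cup\{q_0\}. \end{align*} (8) The intersection of $S(0)$ with a plane $\{z=\mathrm{const}\ne0\}$ is a branch of a hyperbola $\{x^2-y^2=4|z|,\ x>0,\ z=\mathrm{const}\}$; the intersection with the plane $\{z=0\}$ is an angle $\{x=|y|,\ z=0\}$; the intersection with a plane $\{y=kx\}$, $k\in(-1,1)$, is a union of two half-parabolas $\{4z=\pm(1-k^2)x^2,\ x\ge0,\ y=kx\}$; and the intersection with a plane $\{y=\pm x\}$ is a ray $\{y=\pm x,\ x\ge 0,\ z=0\}$.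
   Context: $M=\mathbb R^3_{x,y,z}$ is the Heisenberg group with product $(x_1,y_1,z_1)\cdot(x_2,y_2,z_2)=(x_1+x_2,\,y_1+y_2,\,z_1+z_2+(x_1y_2-x_2y_1)/2)$, $q_0=(0,0,0)$, $X_1=\frac{\partial}{\partial x}-\frac y2\frac{\partial}{\partial z}$, $X_2=\frac{\partial}{\partial y}+\frac x2\frac{\partial}{\partial z}$. Admissible trajectories are Lipschitz curves $q:[0,t_1]\to M$ with $\dot q=u_1X_1(q)+u_2X_2(q)$, $u_1\ge|u_2|$ a.e.; their length is $l(q(\cdot))=\int_0^{t_1}\sqrt{u_1^2-u_2^2}\,dt$. The causal future $J^+(q_0)$ is the set of points reachable from $q_0$ (in nonnegative time) by admissible trajectories, and the chronological future $I^+(q_0)$ is the set of points reachable in positive time by trajectories with $u_1>|u_2|$ a.e. It is known that $J^+(q_0)=\{-x^2+y^2+4|z|\le0,\ x\ge0\}$ and $I^+(q_0)=\{-x^2+y^2+4|z|<0,\ x>0\}$. For $q\in J^+(q_0)$ the sub-Lorentzian distance $d(q)=d(q_0,q)$ is the supremum of $l$ over all admissible trajectories from $q_0$ to $q$ ($d(q_0)=0$). For a vector field $V$, $e^{sV}$ denotes its flow at time $s$; in item (4), $e^{\tau_2V_2}e^{\tau_1V_1}$ denotes the endpoint of the concatenation starting at $q_0$: first follow $V_1$ for time $\tau_1$, then $V_2$ for time $\tau_2$. The vector fields $X_0=y\frac{\partial}{\partial x}+x\frac{\partial}{\partial y}$ and $Y=x\frac{\partial}{\partial x}+y\frac{\partial}{\partial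 y}+2z\frac{\partial}{\partial z}$ have flows $e^{sX_0}(x,y,z)=(x\cosh s+y\sinh s,\ x\sinh s+y\cosh s,\ z)$ and $e^{sY}(x,y,z)=(xe^s,ye^s,ze^{2s})$. *)

theory Defs
  imports "HOL-Analysis.Analysis"
begin

section \<open>The sub-Lorentzian structure on the Heisenberg group\<close>

type_synonym point = "real \<times> real \<times> real"

definition q0 :: point where
  "q0 = (0, 0, 0)"

definition X1 :: "point \<Rightarrow> point" where
  "X1 = (\<lambda>(x, y, z). (1, 0, - y / 2))"

definition X2 :: "point \<Rightarrow> point" where
  "X2 = (\<lambda>(x, y, z). (0, 1, x / 2))"

definition X0 :: "point \<Rightarrow> point" where
  "X0 = (\<lambda>(x, y, z). (y, x, 0))"

definition Y :: "point \<Rightarrow> point" where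
  "Y = (\<lambda>(x, y, z). (x, y, 2 * z))"

text \<open>The controls are determined by the curve almost everywhere (they are the derivatives of its
  first two components), hence they are automatically Lebesgue measurable and essentially bounded
  on the time interval.\<close>

definition horizontal_curve ::
    "real \<Rightarrow> (real \<Rightarrow> point) \<Rightarrow> (real \<Rightarrow> real) \<Rightarrow> (real \<Rightarrow> real) \<Rightarrow> bool" where
  "horizontal_curve T c u1 u2 \<longleftrightarrow>
     0 \<le> T \<and>
     (\<exists>L. L-lipschitz_on {0..T} c) \<and>
     (AE t in lebesgue. t \<in> {0..T} \<longrightarrow>
        (c has_vector_derivative (u1 t *\<^sub>R X1 (c t) + u2 t *\<^sub>R X2 (c t))) (at t within {0..T}))"

definition admissible ::
    "real \<Rightarrow> (real \<Rightarrow> point) \<Rightarrow> (real \<Rightarrow> real) \<Rightarrow> (real \<Rightarrow> real) \<Rightarrow> bool" where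
  "admissible T c u1 u2 \<longleftrightarrow>
     horizontal_curve T c u1 u2 \<and> (AE t in lebesgue. t \<in> {0..T} \<longrightarrow> \<bar>u2 t\<bar> \<le> u1 t)"

definition timelike ::
    "real \<Rightarrow> (real \<Rightarrow> point) \<Rightarrow> (real \<Rightarrow> real) \<Rightarrow> (real \<Rightarrow> real) \<Rightarrow> bool" where
  "timelike T c u1 u2 \<longleftrightarrow>
     horizontal_curve T c u1 u2 \<and> (AE t in lebesgue. t \<in> {0..T} \<longrightarrow> \<bar>u2 t\<bar> < u1 t)"

text \<open>A lightlike velocity is a nonzero one on the boundary of the cone \<open>u1 \<ge> \<bar>u2\<bar>\<close>.\<close>

definition lightlike :: "real \<Rightarrow> (real \<Rightarrow> point) \<Rightarrow> bool" where
  "lightlike T c \<longleftrightarrow>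
     (\<exists>u1 u2. horizontal_curve T c u1 u2 \<and>
        (AE t in lebesgue. t \<in> {0..T} \<longrightarrow> 0 < u1 t \<and> \<bar>u2 t\<bar> = u1 t))"

definition sl_length :: "real \<Rightarrow> (real \<Rightarrow> real) \<Rightarrow> (real \<Rightarrow> real) \<Rightarrow> real" where
  "sl_length T u1 u2 = (LINT t:{0..T}|lebesgue. sqrt ((u1 t)\<^sup>2 - (u2 t)\<^sup>2))"

definition causal_future :: "point \<Rightarrow> point set" where
  "causal_future p = {q. \<exists>T c u1 u2. admissible T c u1 u2 \<and> c 0 = p \<and> c T = q}"

definition chronological_future :: "point \<Rightarrow> point set" where
  "chronological_future p =
     {q. \<exists>T c u1 u2. 0 < T \<and> timelike T c u1 u2 \<and> c 0 = p \<and> c T = q}"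

text \<open>The supremum is taken in \<^typ>\<open>ereal\<close>, so that an unbounded set of lengths would give
  \<open>\<infinity>\<close> and an empty one \<open>-\<infinity>\<close>; in neither case is the distance zero.\<close>

definition sl_dist :: "point \<Rightarrow> point \<Rightarrow> ereal" where
  "sl_dist p q =
     Sup {ereal (sl_length T u1 u2) | T c u1 u2. admissible T c u1 u2 \<and> c 0 = p \<and> c T = q}"

definition zero_sphere :: "point set" where
  "zero_sphere = {q \<in> causal_future q0. sl_dist q0 q = 0}"

definition \<Phi> :: "real \<times> real \<Rightarrow> real" where
  "\<Phi> = (\<lambda>(y, z). sqrt (y\<^sup>2 + 4 * \<bar>z\<bar>))"


section \<open>Flows and broken curves\<close>

text \<open>\<open>flow V s p\<close> is the point \<open>e\<^sup>s\<^sup>V(p)\<close>. The description is meaningful for a complete vector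
  field with uniqueness of integral curves; all fields used below are affine.\<close>

definition flow :: "('a::real_normed_vector \<Rightarrow> 'a) \<Rightarrow> real \<Rightarrow> 'a \<Rightarrow> 'a" where
  "flow V s p =
     (THE q. \<exists>c. c 0 = p \<and> (\<forall>t. (c has_vector_derivative V (c t)) (at t)) \<and> c s = q)"

text \<open>First \<open>V\<close> for time \<open>\<tau>1\<close>, then \<open>W\<close>.\<close>

definition broken_curve ::
    "('a::real_normed_vector \<Rightarrow> 'a) \<Rightarrow> ('a \<Rightarrow> 'a) \<Rightarrow> 'a \<Rightarrow> real \<Rightarrow> real \<Rightarrow> 'a" where
  "broken_curve V W p \<tau>1 t =
     (if t \<le> \<tau>1 then flow V t p else flow W (t - \<tau>1) (flow V \<tau>1 p))"

definition Xplus :: "point \<Rightarrow> point" where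
  "Xplus q = X1 q + X2 q"

definition Xminus :: "point \<Rightarrow> point" where
  "Xminus q = X1 q - X2 q"


section \<open>Regularity of functions\<close>

definition holder_on :: "real \<Rightarrow> ('a::metric_space) set \<Rightarrow> ('a \<Rightarrow> 'b::metric_space) \<Rightarrow> bool" where
  "holder_on \<alpha> U f \<longleftrightarrow> (\<exists>C. \<forall>p\<in>U. \<forall>q\<in>U. dist (f p) (f q) \<le> C * dist p q powr \<alpha>)"

text \<open>Real-analyticity in two variables: near each point of \<open>U\<close> the function is the sum of an
  absolutely convergent double power series.\<close>

definition real_analytic2_on :: "(real \<times> real \<Rightarrow> real) \<Rightarrow> (real \<times> real) set \<Rightarrow> bool" where
  "real_analytic2_on f U \<longleftrightarrow>
     (\<forall>(a, b)\<in>U. \<exists>r>0. \<exists>C :: nat \<Rightarrow> nat \<Rightarrow> real. \<forall>h k. \<bar>h\<bar> < r \<longrightarrow> \<bar>k\<bar> < r \<longrightarrow>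
        ((\<lambda>(i, j). C i j * h ^ i * k ^ j) has_sum f (a + h, b + k)) UNIV)"

text \<open>\<open>C\<^sup>k\<close> maps on an open set \<open>S\<close>: differentiable, with all directional derivatives of
  class \<open>C\<^sup>k\<^sup>-\<^sup>1\<close>.\<close>

primrec Ck_on ::
    "nat \<Rightarrow> ('a::real_normed_vector \<Rightarrow> 'b::real_normed_vector) \<Rightarrow> 'a set \<Rightarrow> bool" where
  "Ck_on 0 f S \<longleftrightarrow> continuous_on S f"
| "Ck_on (Suc k) f S \<longleftrightarrow>
     (\<forall>x\<in>S. f differentiable (at x)) \<and> (\<forall>v. Ck_on k (\<lambda>x. frechet_derivative f (at x) v) S)"

definition smooth_on ::
    "('a::real_normed_vector \<Rightarrow> 'b::real_normed_vector) \<Rightarrow> 'a set \<Rightarrow> bool" where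
  "smooth_on f S \<longleftrightarrow> (\<forall>k. Ck_on k f S)"


section \<open>Manifolds, parametrizations, semi-algebraic sets\<close>

definition topological_manifold :: "nat \<Rightarrow> 'a topology \<Rightarrow> bool" where
  "topological_manifold n X \<longleftrightarrow>
     Hausdorff_space X \<and> second_countable X \<and>
     (\<forall>p\<in>topspace X. \<exists>U V. openin X U \<and> p \<in> U \<and> openin (Euclidean_space n) V \<and>
        subtopology X U homeomorphic_space subtopology (Euclidean_space n) V)"

text \<open>A regular parametrization of \<open>S\<close> by the open set \<open>U\<close>: a smooth immersion that is a
  homeomorphism onto \<open>S\<close>.\<close>

definition regular_parametrization ::
    "('a::real_normed_vector \<Rightarrow> 'b::real_normed_vector) \<Rightarrow> 'a set \<Rightarrow> 'b set \<Rightarrow> bool" where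
  "regular_parametrization f U S \<longleftrightarrow>
     open U \<and> smooth_on f U \<and> (\<forall>p\<in>U. inj (frechet_derivative f (at p))) \<and>
     (\<exists>g. homeomorphism U S f g)"

inductive semialgebraic :: "('a::euclidean_space) set \<Rightarrow> bool" where
  eq: "real_polynomial_function f \<Longrightarrow> semialgebraic {x. f x = 0}"
| pos: "real_polynomial_function f \<Longrightarrow> semialgebraic {x. f x > 0}"
| un: "semialgebraic A \<Longrightarrow> semialgebraic B \<Longrightarrow> semialgebraic (A \<union> B)"
| inter: "semialgebraic A \<Longrightarrow> semialgebraic B \<Longrightarrow> semialgebraic (A \<inter> B)"
| compl: "semialgebraic A \<Longrightarrow> semialgebraic (- A)"


section \<open>Whitney stratifications\<close>

text \<open>Embedded smooth submanifolds of dimension \<open>k\<close>, via charts of the ambient space that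
  straighten \<open>S\<close> to a linear subspace.\<close>

definition smooth_submanifold :: "nat \<Rightarrow> ('a::euclidean_space) set \<Rightarrow> bool" where
  "smooth_submanifold k S \<longleftrightarrow>
     (\<forall>p\<in>S. \<exists>U V \<phi> \<psi> (E :: 'a set).
        open U \<and> p \<in> U \<and> open V \<and> homeomorphism U V \<phi> \<psi> \<and> smooth_on \<phi> U \<and> smooth_on \<psi> V \<and>
        subspace E \<and> dim E = k \<and> \<phi> ` (U \<inter> S) = V \<inter> E)"

definition tangent_space :: "('a::euclidean_space) set \<Rightarrow> 'a \<Rightarrow> 'a set" where
  "tangent_space S p =
     {v. \<exists>\<gamma> \<epsilon>. 0 < \<epsilon> \<and> smooth_on \<gamma> {-\<epsilon><..<\<epsilon>} \<and> \<gamma> ` {-\<epsilon><..<\<epsilon>} \<subseteq> S \<and> \<gamma> 0 = p \<and>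
        (\<gamma> has_vector_derivative v) (at 0)}"

text \<open>Convergence in the Grassmannian, expressed as convergence of the orthogonal projections
  (the closest point in a subspace is the orthogonal projection onto it).\<close>

definition subspace_tendsto :: "(nat \<Rightarrow> ('a::euclidean_space) set) \<Rightarrow> 'a set \<Rightarrow> bool" where
  "subspace_tendsto T \<tau> \<longleftrightarrow>
     (\<forall>n. subspace (T n)) \<and> subspace \<tau> \<and> (\<forall>n. dim (T n) = dim \<tau>) \<and>
     (\<forall>v. (\<lambda>n. closest_point (T n) v) \<longlonglongrightarrow> closest_point \<tau> v)"

definition whitney_a :: "('a::euclidean_space) set \<Rightarrow> 'a set \<Rightarrow> bool" where
  "whitney_a R S \<longleftrightarrow>
     (\<forall>p\<in>R. \<forall>y \<tau>. (\<forall>n. y n \<in> S) \<longrightarrow> y \<longlonglongrightarrow> p \<longrightarrow>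
        subspace_tendsto (\<lambda>n. tangent_space S (y n)) \<tau> \<longrightarrow> tangent_space R p \<subseteq> \<tau>)"

definition whitney_b :: "('a::euclidean_space) set \<Rightarrow> 'a set \<Rightarrow> bool" where
  "whitney_b R S \<longleftrightarrow>
     (\<forall>p\<in>R. \<forall>x y \<tau> l. (\<forall>n. x n \<in> R) \<longrightarrow> (\<forall>n. y n \<in> S) \<longrightarrow> (\<forall>n. x n \<noteq> y n) \<longrightarrow>
        x \<longlonglongrightarrow> p \<longrightarrow> y \<longlonglongrightarrow> p \<longrightarrow>
        subspace_tendsto (\<lambda>n. tangent_space S (y n)) \<tau> \<longrightarrow>
        subspace_tendsto (\<lambda>n. span {y n - x n}) l \<longrightarrow> l \<subseteq> \<tau>)"

text \<open>A closed set with a locally finite partition into smooth submanifolds (strata) satisfying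
  the condition of the frontier and Whitney's conditions (a) and (b).\<close>

definition whitney_stratification :: "('a::euclidean_space) set \<Rightarrow> 'a set set \<Rightarrow> bool" where
  "whitney_stratification Z \<S> \<longleftrightarrow>
     closed Z \<and> partition_on Z \<S> \<and> locally_finite_in euclidean \<S> \<and>
     (\<forall>S\<in>\<S>. \<exists>k. smooth_submanifold k S) \<and>
     (\<forall>R\<in>\<S>. \<forall>S\<in>\<S>. R \<inter> closure S \<noteq> {} \<longrightarrow> R \<subseteq> closure S) \<and>
     (\<forall>R\<in>\<S>. \<forall>S\<in>\<S>. R \<noteq> S \<longrightarrow> whitney_a R S \<and> whitney_b R S)"

end

(* In the null coordinates a = x + y, b = x - y an admissible curve has a', b' >= 0, and a b + 4 z and
   a b - 4 z have derivatives 2 b a' and 2 a b'. All four functions are therefore nondecreasing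
   along curves issuing from the origin, which confines these curves to the cone 4|z| <= a b; a curve ending
   on the boundary of the cone has a' b' = u1^2 - u2^2 = 0 almost everywhere, hence length zero.
   Conversely, concatenations of two straight segments reach every point of the cone, with positive
   length in its interior. So S(0) is the graph x = Phi(y, z), and the other items are statements
   about this explicit surface. Away from z = 0 it consists of the open sectors of the saddles
   z = +-(x^2 - y^2)/4. As these are quadratic graphs, the chord between two points is parallel to the
   tangent plane over the midpoint, which gives Whitney's condition (b). *)

theory Submission
  imports Defs
begin

section \<open>Monotonicity of Lipschitz functions\<close>

text \<open>The two auxiliary functions come from writing the vertical velocity
  \<open>(x * u2 - y * u1) / 2\<close> in null coordinates: \<open>4 * z' = b * a' - a * b'\<close>,
  so adding or subtracting the derivative of \<open>a * b\<close> cancels one term. At a boundary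
  end point one of the two functions returns to its initial value 0 and, being monotone, is
  constant; this is what makes the controls null. The same argument keeps timelike curves off the
  boundary. Several notions force detours. Controls are derivatives of a Lipschitz curve only almost
  everywhere, so monotonicity needs an argument with null sets. \<open>flow\<close> is a definite
  description, so every explicit formula needs uniqueness for a linear equation.
  \<open>Ck_on\<close> recurs through directional derivatives, so every smooth map is placed in a
  family closed under them. Limits of tangent spaces are handled by a formula for the tangent planes
  of a sector that makes sense, and is continuous, on the whole saddle including its edges and
  vertex.\<close>

lemma lipschitz_on_mult:
  fixes f g :: "real \<Rightarrow> real"
  assumes f: "L-lipschitz_on X f" and g: "M-lipschitz_on X g"
    and B: "\<And>x. x \<in> X \<Longrightarrow> \<bar>f x\<bar> \<le> B" and C: "\<And>x. x \<in> X \<Longrightarrow> \<bar>g x\<bar> \<le> C"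
  shows "(\<bar>B\<bar> * M + \<bar>C\<bar> * L)-lipschitz_on X (\<lambda>x. f x * g x)"
proof (rule lipschitz_onI)
  show "0 \<le> \<bar>B\<bar> * M + \<bar>C\<bar> * L"
    using lipschitz_on_nonneg[OF f] lipschitz_on_nonneg[OF g] by simp
next
  fix x y assume xy: "x \<in> X" "y \<in> X"
  have 1: "\<bar>g x - g y\<bar> \<le> M * \<bar>x - y\<bar>" and 2: "\<bar>f x - f y\<bar> \<le> L * \<bar>x - y\<bar>"
    using lipschitz_onD[OF g xy] lipschitz_onD[OF f xy] by (auto simp: dist_real_def)
  have "f x * g x - f y * g y = f x * (g x - g y) + g y * (f x - f y)"
    by (simp add: algebra_simps)
  then have "\<bar>f x * g x - f y * g y\<bar> \<le> \<bar>f x\<bar> * \<bar>g x - g y\<bar> + \<bar>g y\<bar> * \<bar>f x - f y\<bar>"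
    by (metis abs_mult abs_triangle_ineq)
  also have "\<dots> \<le> \<bar>B\<bar> * (M * \<bar>x - y\<bar>) + \<bar>C\<bar> * (L * \<bar>x - y\<bar>)"
    using 1 2 B[OF xy(1)] C[OF xy(2)] by (intro add_mono mult_mono) auto
  finally show "dist (f x * g x) (f y * g y) \<le> (\<bar>B\<bar> * M + \<bar>C\<bar> * L) * dist x y"
    by (simp add: dist_real_def algebra_simps)
qed

lemma lipschitz_on_mult_interval:
  fixes f g :: "real \<Rightarrow> real"
  assumes "\<exists>L. L-lipschitz_on {s..t} f" "\<exists>L. L-lipschitz_on {s..t} g"
  shows "\<exists>L. L-lipschitz_on {s..t} (\<lambda>x. f x * g x)"
proof -
  have bdd: "\<exists>B. \<forall>x\<in>{s..t}. \<bar>h x\<bar> \<le> B" if "\<exists>L. L-lipschitz_on {s..t} h" for h :: "real \<Rightarrow> real"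
  proof -
    from that obtain L where L: "L-lipschitz_on {s..t} h" by blast
    have "bounded (h ` {s..t})"
      by (intro compact_imp_bounded compact_continuous_image lipschitz_on_continuous_on[OF L]) simp
    then show ?thesis by (simp add: bounded_iff)
  qed
  obtain B C where "\<forall>x\<in>{s..t}. \<bar>f x\<bar> \<le> B" "\<forall>x\<in>{s..t}. \<bar>g x\<bar> \<le> C"
    using bdd[OF assms(1)] bdd[OF assms(2)] by blast
  with assms lipschitz_on_mult[of _ "{s..t}" f _ g B C] show ?thesis by meson
qed

text \<open>A Lipschitz image of a null set is null, so if \<open>f t < f s\<close>, some value between them is taken
  only at points of differentiability; at the last such point the derivative cannot be positive.\<close>

lemma AE_deriv_pos_imp_le:
  fixes f f' :: "real \<Rightarrow> real"
  assumes st: "s \<le> t" and lip: "\<exists>L. L-lipschitz_on {s..t} f"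
    and ae: "AE x in lebesgue. x \<in> {s..t} \<longrightarrow>
               (f has_real_derivative f' x) (at x within {s..t}) \<and> 0 < f' x"
  shows "f s \<le> f t"
proof (rule ccontr)
  assume "\<not> f s \<le> f t"
  then have lt: "f t < f s" by simp
  obtain L where L: "L-lipschitz_on {s..t} f" using lip by blast
  have cont: "continuous_on {s..t} f" by (rule lipschitz_on_continuous_on[OF L])
  from ae obtain N where N: "N \<in> null_sets lebesgue"
    and bad: "\<And>x. x \<in> {s..t} \<Longrightarrow> x \<notin> N \<Longrightarrow>
               (f has_real_derivative f' x) (at x within {s..t}) \<and> 0 < f' x"
    by (auto simp: eventually_ae_filter subset_iff)
  have "negligible (f ` (N \<inter> {s..t}))"
  proof (rule negligible_locally_Lipschitz_image)
    show "negligible (N \<inter> {s..t})"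
      using N by (metis negligible_iff_null_sets negligible_Int)
    fix x assume x: "x \<in> N \<inter> {s..t}"
    show "\<exists>T B. open T \<and> x \<in> T \<and> (\<forall>y\<in>N \<inter> {s..t} \<inter> T. norm (f y - f x) \<le> B * norm (y - x))"
      using x lipschitz_onD[OF L] by (intro exI[of _ UNIV] exI[of _ L]) (auto simp: dist_norm)
  qed simp
  moreover have "\<not> negligible {f t<..<f s}"
    using lt by (metis box_real(1) negligible_interval(2) greaterThanLessThan_empty_iff not_le)
  ultimately have "\<not> {f t<..<f s} \<subseteq> f ` (N \<inter> {s..t})"
    using negligible_subset by blast
  then have "\<exists>v. v \<in> {f t<..<f s} \<and> v \<notin> f ` (N \<inter> {s..t})"
    unfolding subset_iff by simp
  then obtain v where v: "f t < v" "v < f s" "v \<notin> f ` (N \<inter> {s..t})"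
    unfolding greaterThanLessThan_iff by (elim exE conjE)
  define A where "A = {x \<in> {s..t}. v \<le> f x}"
  have "closed A"
  proof -
    have "A = {s..t} \<inter> f -` {v..}" by (auto simp: A_def)
    then show ?thesis using continuous_closed_preimage[OF cont, of "{v..}"] by simp
  qed
  have A: "s \<in> A" "A \<subseteq> {s..t}" using v st by (auto simp: A_def)
  have bdd: "bdd_above A" using A(2) by (meson bdd_above_Icc bdd_above_mono)
  \<comment> \<open>The last time at which \<open>f\<close> is still at least \<open>v\<close>:
    later values lie below \<open>v\<close>, which contradicts a positive derivative at
    \<open>m\<close>.\<close>
  define m where "m = Sup A"
  have mA: "m \<in> A" unfolding m_def using \<open>closed A\<close> A bdd by (intro closed_contains_Sup) auto
  have above: "f x < v" if "x \<in> {s..t}" "m < x" for x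
    using that cSup_upper[OF _ bdd, of x] by (auto simp: m_def A_def not_le[symmetric])
  have "m \<noteq> t" using mA v by (auto simp: A_def)
  then have mt: "s \<le> m" "m < t" "v \<le> f m" using mA by (auto simp: A_def)
  have "f m \<le> v"
  proof (rule ccontr)
    assume "\<not> f m \<le> v"
    moreover have "continuous_on {m..t} f" using cont by (rule continuous_on_subset) (use mt in auto)
    ultimately obtain x where "m \<le> x" "x \<le> t" "f x = v"
      using IVT2'[of f t v m] v mt by auto
    with above[of x] \<open>\<not> f m \<le> v\<close> mt show False by (cases "x = m") auto
  qed
  then have fm: "f m = v" using mt by simp
  then have "m \<notin> N" using v(3) mt by auto
  then have "(f has_real_derivative f' m) (at m within {s..t})" "0 < f' m"
    using bad[of m] mt by auto
  from has_real_derivative_pos_inc_right[OF this]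
  obtain d where d: "d > 0" "\<And>h. h > 0 \<Longrightarrow> m + h \<in> {s..t} \<Longrightarrow> h < d \<Longrightarrow> f m < f (m + h)" by blast
  define h where "h = min (d / 2) (t - m)"
  have "h > 0" "m + h \<in> {s..t}" "h < d" using d mt by (auto simp: h_def)
  with d(2)[of h] above[of "m + h"] fm show False by simp
qed

text \<open>Adding \<open>e * x\<close> makes the derivative strictly positive almost everywhere;
  then \<open>e\<close> tends to 0.\<close>

lemma AE_deriv_nonneg_imp_le:
  fixes f f' :: "real \<Rightarrow> real"
  assumes st: "s \<le> t" and lip: "\<exists>L. L-lipschitz_on {s..t} f"
    and ae: "AE x in lebesgue. x \<in> {s..t} \<longrightarrow>
               (f has_real_derivative f' x) (at x within {s..t}) \<and> 0 \<le> f' x"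
  shows "f s \<le> f t"
proof -
  obtain L where L: "L-lipschitz_on {s..t} f" using lip by blast
  have eps: "f s + e * s \<le> f t + e * t" if "e > 0" for e
  proof (rule AE_deriv_pos_imp_le[OF st, of _ "\<lambda>x. f' x + e"])
    have "(L + \<bar>e\<bar> * 1)-lipschitz_on {s..t} (\<lambda>x. f x + e * x)"
      by (intro lipschitz_on_add L lipschitz_on_cmult_real) (simp add: lipschitz_on_def)
    then show "\<exists>L. L-lipschitz_on {s..t} (\<lambda>x. f x + e * x)" by blast
    show "AE x in lebesgue. x \<in> {s..t} \<longrightarrow>
      ((\<lambda>x. f x + e * x) has_real_derivative f' x + e) (at x within {s..t}) \<and> 0 < f' x + e"
      using ae
    proof eventually_elim
      case (elim x)
      show ?case
      proof
        assume x: "x \<in> {s..t}"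
        with elim have "(f has_real_derivative f' x) (at x within {s..t})" "0 \<le> f' x" by auto
        then show "((\<lambda>x. f x + e * x) has_real_derivative f' x + e) (at x within {s..t}) \<and> 0 < f' x + e"
          using that by (auto intro!: derivative_eq_intros)
      qed
    qed
  qed
  show ?thesis
  proof (rule field_le_epsilon)
    fix e :: real assume e: "0 < e"
    \<comment> \<open>The summand 1 keeps the denominator positive when
      \<open>s = t\<close>.\<close>
    define d where "d = e / (t - s + 1)"
    have "d > 0" using e st by (simp add: d_def)
    moreover have "d * (t - s) \<le> e" using e st by (simp add: d_def field_simps)
    ultimately show "f s \<le> f t + e" using eps[of d] by (simp add: algebra_simps)
  qed
qed

lemma AE_deriv_nonneg_imp_mono_on:
  fixes f f' :: "real \<Rightarrow> real"
  assumes lip: "\<exists>L. L-lipschitz_on {s..t} f"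
    and ae: "AE x in lebesgue. x \<in> {s..t} \<longrightarrow>
               (f has_real_derivative f' x) (at x within {s..t}) \<and> 0 \<le> f' x"
  shows "mono_on {s..t} f"
proof (rule mono_onI)
  fix p q assume pq: "p \<in> {s..t}" "q \<in> {s..t}" "p \<le> q"
  then have sub: "{p..q} \<subseteq> {s..t}" by auto
  show "f p \<le> f q"
  proof (rule AE_deriv_nonneg_imp_le[OF pq(3), of _ f'])
    show "\<exists>L. L-lipschitz_on {p..q} f" using lip lipschitz_on_subset[OF _ sub] by blast
    show "AE x in lebesgue. x \<in> {p..q} \<longrightarrow>
        (f has_real_derivative f' x) (at x within {p..q}) \<and> 0 \<le> f' x"
      using ae
    proof eventually_elim
      case (elim x)
      then show ?case using sub DERIV_subset[OF _ sub] by blast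
    qed
  qed
qed

text \<open>A derivative within \<open>S\<close> is also one within the interval to the left of
  \<open>t\<close>, where derivatives are unique because \<open>s < t\<close>. Constancy is thus
  needed only up to time \<open>t\<close>.\<close>

lemma constant_on_left_derivative_zero:
  fixes f :: "real \<Rightarrow> real"
  assumes der: "(f has_real_derivative d) (at t within S)" and sub: "{s..t} \<subseteq> S" and st: "s < t"
    and const: "\<And>x. x \<in> {s..t} \<Longrightarrow> f x = c"
  shows "d = 0"
proof -
  have 1: "(f has_real_derivative d) (at t within {s..t})" using der sub by (rule DERIV_subset)
  have 2: "(f has_real_derivative 0) (at t within {s..t})"
    by (rule has_field_derivative_transform_within[where f="\<lambda>_. c" and d=1])
       (use st const in \<open>auto intro: derivative_eq_intros\<close>)
  have "at t within {s..t} \<noteq> bot" using st by (simp add: at_within_Icc_at_left trivial_limit_at_left_real)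
  then show ?thesis
    using 1 2 unfolding has_field_derivative_iff by (metis tendsto_unique)
qed

section \<open>The causal future lies in the cone\<close>

lemma horizontal_curve_components:
  assumes "horizontal_curve T c u1 u2"
  shows "\<exists>L. L-lipschitz_on {0..T} (\<lambda>t. fst (c t))"
    "\<exists>L. L-lipschitz_on {0..T} (\<lambda>t. fst (snd (c t)))"
    "\<exists>L. L-lipschitz_on {0..T} (\<lambda>t. snd (snd (c t)))"
    "AE t in lebesgue. t \<in> {0..T} \<longrightarrow>
       ((\<lambda>t. fst (c t)) has_real_derivative u1 t) (at t within {0..T}) \<and>
       ((\<lambda>t. fst (snd (c t))) has_real_derivative u2 t) (at t within {0..T}) \<and>
       ((\<lambda>t. snd (snd (c t))) has_real_derivative
         (fst (c t) * u2 t - fst (snd (c t)) * u1 t) / 2) (at t within {0..T})"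
proof -
  obtain L where L: "L-lipschitz_on {0..T} c"
    using assms by (auto simp: horizontal_curve_def)
  have *: "L-lipschitz_on {0..T} (\<lambda>t. h (c t))"
    if "\<And>p q. dist (h p) (h q) \<le> dist p q" for h :: "point \<Rightarrow> real"
    using L that unfolding lipschitz_on_def by (meson order_trans)
  have d: "dist (fst p) (fst q) \<le> dist p q" "dist (fst (snd p)) (fst (snd q)) \<le> dist p q"
    "dist (snd (snd p)) (snd (snd q)) \<le> dist p q" for p q :: point
    by (rule dist_fst_le, rule order_trans[OF dist_fst_le dist_snd_le],
        rule order_trans[OF dist_snd_le dist_snd_le])
  show "\<exists>L. L-lipschitz_on {0..T} (\<lambda>t. fst (c t))"
    "\<exists>L. L-lipschitz_on {0..T} (\<lambda>t. fst (snd (c t)))"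
    "\<exists>L. L-lipschitz_on {0..T} (\<lambda>t. snd (snd (c t)))"
    using *[of fst] *[of "\<lambda>p. fst (snd p)"] *[of "\<lambda>p. snd (snd p)"] d by blast+
  have "AE t in lebesgue. t \<in> {0..T} \<longrightarrow>
        (c has_vector_derivative (u1 t *\<^sub>R X1 (c t) + u2 t *\<^sub>R X2 (c t))) (at t within {0..T})"
    using assms by (simp add: horizontal_curve_def)
  then show "AE t in lebesgue. t \<in> {0..T} \<longrightarrow>
       ((\<lambda>t. fst (c t)) has_real_derivative u1 t) (at t within {0..T}) \<and>
       ((\<lambda>t. fst (snd (c t))) has_real_derivative u2 t) (at t within {0..T}) \<and>
       ((\<lambda>t. snd (snd (c t))) has_real_derivative
         (fst (c t) * u2 t - fst (snd (c t)) * u1 t) / 2) (at t within {0..T})"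
  proof eventually_elim
    case (elim t)
    show ?case
    proof
      assume "t \<in> {0..T}"
      with elim have D: "(c has_vector_derivative (u1 t *\<^sub>R X1 (c t) + u2 t *\<^sub>R X2 (c t)))
          (at t within {0..T})" (is "(c has_vector_derivative ?v) _") by blast
      have bl: "bounded_linear (\<lambda>p :: point. fst p)" "bounded_linear (\<lambda>p :: point. fst (snd p))"
        "bounded_linear (\<lambda>p :: point. snd (snd p))"
        by (auto intro!: bounded_linear_intros)
      have v: "fst ?v = u1 t" "fst (snd ?v) = u2 t"
        "snd (snd ?v) = (fst (c t) * u2 t - fst (snd (c t)) * u1 t) / 2"
        by (auto simp: X1_def X2_def case_prod_beta field_simps)
      show "((\<lambda>t. fst (c t)) has_real_derivative u1 t) (at t within {0..T}) \<and>
       ((\<lambda>t. fst (snd (c t))) has_real_derivative u2 t) (at t within {0..T}) \<and>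
       ((\<lambda>t. snd (snd (c t))) has_real_derivative
         (fst (c t) * u2 t - fst (snd (c t)) * u1 t) / 2) (at t within {0..T})"
        using bounded_linear.has_vector_derivative[OF bl(1) D]
          bounded_linear.has_vector_derivative[OF bl(2) D]
          bounded_linear.has_vector_derivative[OF bl(3) D]
        unfolding v has_real_derivative_iff_has_vector_derivative by blast
    qed
  qed
qed


text \<open>In null coordinates the cone condition on the controls says that \<open>a\<close> and
  \<open>b\<close> have nonnegative derivatives, and \<open>4 * z' = b * a' - a * b'\<close> turns
  the derivatives of \<open>a * b + 4 * z\<close> and \<open>a * b - 4 * z\<close> into single
  products.\<close>

lemma admissible_null_coordinates:
  assumes "admissible T c u1 u2" "c 0 = q0"
  defines "a \<equiv> \<lambda>t. fst (c t) + fst (snd (c t))" and "b \<equiv> \<lambda>t. fst (c t) - fst (snd (c t))"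
    and "z \<equiv> \<lambda>t. snd (snd (c t))"
  defines "D \<equiv> \<lambda>t. (a has_real_derivative u1 t + u2 t) (at t within {0..T}) \<and>
           (b has_real_derivative u1 t - u2 t) (at t within {0..T}) \<and>
           0 \<le> u1 t + u2 t \<and> 0 \<le> u1 t - u2 t \<and>
           ((\<lambda>t. a t * b t + 4 * z t) has_real_derivative 2 * b t * (u1 t + u2 t)) (at t within {0..T}) \<and>
           ((\<lambda>t. a t * b t - 4 * z t) has_real_derivative 2 * a t * (u1 t - u2 t)) (at t within {0..T})"
  shows "AE t in lebesgue. t \<in> {0..T} \<longrightarrow> D t"
    and "mono_on {0..T} a" "mono_on {0..T} b"
    and "mono_on {0..T} (\<lambda>t. a t * b t + 4 * z t)" "mono_on {0..T} (\<lambda>t. a t * b t - 4 * z t)"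
    and "a 0 = 0" "b 0 = 0" "z 0 = 0" "0 \<le> T"
proof -
  have h: "horizontal_curve T c u1 u2" using assms(1) by (simp add: admissible_def)
  show T: "0 \<le> T" using h by (simp add: horizontal_curve_def)
  show init: "a 0 = 0" "b 0 = 0" "z 0 = 0"
    using assms(2) by (simp_all add: a_def b_def z_def q0_def)
  note comp = horizontal_curve_components[OF h]
  have "AE t in lebesgue. t \<in> {0..T} \<longrightarrow> \<bar>u2 t\<bar> \<le> u1 t"
    using assms(1) by (simp add: admissible_def)
  with comp(4) show D: "AE t in lebesgue. t \<in> {0..T} \<longrightarrow> D t"
  proof eventually_elim
    case (elim t)
    show ?case
    proof
      assume "t \<in> {0..T}"
      with elim have d: "((\<lambda>t. fst (c t)) has_real_derivative u1 t) (at t within {0..T})"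
        "((\<lambda>t. fst (snd (c t))) has_real_derivative u2 t) (at t within {0..T})"
        "(z has_real_derivative (fst (c t) * u2 t - fst (snd (c t)) * u1 t) / 2) (at t within {0..T})"
        and u: "\<bar>u2 t\<bar> \<le> u1 t" by (auto simp: z_def)
      have da: "(a has_real_derivative u1 t + u2 t) (at t within {0..T})"
        and db: "(b has_real_derivative u1 t - u2 t) (at t within {0..T})"
        unfolding a_def b_def using d by (auto intro: derivative_intros)
      have "((\<lambda>t. a t * b t + 4 * z t) has_real_derivative 2 * b t * (u1 t + u2 t)) (at t within {0..T})"
        by (rule derivative_eq_intros da db d(3) refl)+ (simp add: a_def b_def field_simps)
      moreover have "((\<lambda>t. a t * b t - 4 * z t) has_real_derivative 2 * a t * (u1 t - u2 t)) (at t within {0..T})"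
        by (rule derivative_eq_intros da db d(3) refl)+ (simp add: a_def b_def field_simps)
      ultimately show "D t" using da db u by (auto simp: D_def)
    qed
  qed
  have add: "\<exists>L. L-lipschitz_on {0..T} (\<lambda>t. f t + g t)"
    and diff: "\<exists>L. L-lipschitz_on {0..T} (\<lambda>t. f t - g t)"
    if fg: "\<exists>L. L-lipschitz_on {0..T} f" "\<exists>L. L-lipschitz_on {0..T} g" for f g :: "real \<Rightarrow> real"
  proof -
    obtain L M where "L-lipschitz_on {0..T} f" "M-lipschitz_on {0..T} g" using fg by (elim exE)
    then have "(L + M)-lipschitz_on {0..T} (\<lambda>t. f t + g t)"
      "(L + M)-lipschitz_on {0..T} (\<lambda>t. f t - g t)"
      by (simp_all add: lipschitz_on_add lipschitz_on_diff)
    then show "\<exists>L. L-lipschitz_on {0..T} (\<lambda>t. f t + g t)"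
      "\<exists>L. L-lipschitz_on {0..T} (\<lambda>t. f t - g t)" by auto
  qed
  have lip: "\<exists>L. L-lipschitz_on {0..T} a" "\<exists>L. L-lipschitz_on {0..T} b"
    unfolding a_def b_def by (rule add[OF comp(1,2)], rule diff[OF comp(1,2)])
  obtain M where "M-lipschitz_on {0..T} z" using comp(3) unfolding z_def by (elim exE)
  then have "(\<bar>4\<bar> * M)-lipschitz_on {0..T} (\<lambda>t. 4 * z t)" by (rule lipschitz_on_cmult_real)
  then have lipz: "\<exists>L. L-lipschitz_on {0..T} (\<lambda>t. 4 * z t)" by (rule exI)
  note lipab = lipschitz_on_mult_interval[OF lip]
  have lip2: "\<exists>L. L-lipschitz_on {0..T} (\<lambda>t. a t * b t + 4 * z t)"
    "\<exists>L. L-lipschitz_on {0..T} (\<lambda>t. a t * b t - 4 * z t)"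
    by (rule add[OF lipab lipz], rule diff[OF lipab lipz])
  show ma: "mono_on {0..T} a"
    by (rule AE_deriv_nonneg_imp_mono_on[OF lip(1), of "\<lambda>t. u1 t + u2 t"])
       (use D in eventually_elim, auto simp: D_def)
  show mb: "mono_on {0..T} b"
    by (rule AE_deriv_nonneg_imp_mono_on[OF lip(2), of "\<lambda>t. u1 t - u2 t"])
       (use D in eventually_elim, auto simp: D_def)
  \<comment> \<open>The signs of \<open>a\<close> and \<open>b\<close>, which follow from their
    monotonicity and the start at the origin, are what makes the other two derivatives
    nonnegative.\<close>
  have a0: "0 \<le> a t" and b0: "0 \<le> b t" if "t \<in> {0..T}" for t
    using mono_onD[OF ma, of 0 t] mono_onD[OF mb, of 0 t] that T init by auto
  show "mono_on {0..T} (\<lambda>t. a t * b t + 4 * z t)"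
    by (rule AE_deriv_nonneg_imp_mono_on[OF lip2(1), of "\<lambda>t. 2 * b t * (u1 t + u2 t)"])
       (use D in eventually_elim, use b0 in \<open>auto simp: D_def\<close>)
  show "mono_on {0..T} (\<lambda>t. a t * b t - 4 * z t)"
    by (rule AE_deriv_nonneg_imp_mono_on[OF lip2(2), of "\<lambda>t. 2 * a t * (u1 t - u2 t)"])
       (use D in eventually_elim, use a0 in \<open>auto simp: D_def\<close>)
qed

lemma causal_future_subset_cone:
  assumes adm: "admissible T c u1 u2" "c 0 = q0" "c T = (x, y, z)"
  shows "4 * \<bar>z\<bar> \<le> x\<^sup>2 - y\<^sup>2 \<and> 0 \<le> x"
proof -
  note n = admissible_null_coordinates[OF adm(1,2)]
  have T: "0 \<in> {0..T}" "T \<in> {0..T}" "0 \<le> T" using n(9) by auto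
  have "0 \<le> x + y" "0 \<le> x - y" "0 \<le> (x + y) * (x - y) + 4 * z" "0 \<le> (x + y) * (x - y) - 4 * z"
    using mono_onD[OF n(2) T] mono_onD[OF n(3) T] mono_onD[OF n(4) T] mono_onD[OF n(5) T] n(6-8) adm(3)
    by auto
  then show ?thesis by (auto simp: power2_eq_square algebra_simps abs_if)
qed

text \<open>The distinguished time \<open>0\<close> is excluded because left difference quotients are used.\<close>

lemma null_product_of_constant:
  fixes a b f a' b' :: "real \<Rightarrow> real"
  assumes T: "0 < t" "t \<le> T" and b: "mono_on {0..T} b" "b 0 = 0"
    and f: "mono_on {0..T} f" "f 0 = f T"
    and db: "(b has_real_derivative db) (at t within {0..T})"
    and df: "(f has_real_derivative 2 * b t * da) (at t within {0..T})"
  shows "da * db = 0"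
proof -
  have sub: "{0..t} \<subseteq> {0..T}" using T by auto
  have fc: "f x = f 0" if "x \<in> {0..t}" for x
    using mono_onD[OF f(1), of 0 x] mono_onD[OF f(1), of x T] that f(2) T by auto
  have "2 * b t * da = 0" by (rule constant_on_left_derivative_zero[OF df sub T(1) fc])
  then have 1: "b t * da = 0" by simp
  show ?thesis
  \<comment> \<open>If \<open>b t\<close> vanishes, \<open>b\<close> vanishes on all of
    \<open>{0..t}\<close>, being nondecreasing from 0, and so does its derivative at
    \<open>t\<close>; otherwise \<open>da\<close> must vanish.\<close>
  proof (cases "b t = 0")
    case True
    have bc: "b x = 0" if "x \<in> {0..t}" for x
      using mono_onD[OF b(1), of 0 x] mono_onD[OF b(1), of x t] that b(2) T True by auto
    have "db = 0" by (rule constant_on_left_derivative_zero[OF db sub T(1) bc])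
    then show ?thesis by simp
  qed (use 1 in auto)
qed

text \<open>On the boundary one of the two monotone functions ends at 0, where it started, so it is
  constant and its derivative is 0. The controls then satisfy
  \<open>(u1 + u2) * (u1 - u2) = 0\<close> almost everywhere.\<close>

lemma boundary_null_controls:
  assumes adm: "admissible T c u1 u2" "c 0 = q0" "c T = (x, y, z)"
    and bd: "x\<^sup>2 - y\<^sup>2 = 4 * \<bar>z\<bar>"
  shows "AE t in lebesgue. t \<in> {0..T} \<longrightarrow> (u1 t)\<^sup>2 - (u2 t)\<^sup>2 = 0"
proof -
  note n = admissible_null_coordinates[OF adm(1,2)]
  let ?a = "\<lambda>t. fst (c t) + fst (snd (c t))" and ?b = "\<lambda>t. fst (c t) - fst (snd (c t))"
  let ?z = "\<lambda>t. snd (snd (c t))"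
  have bd': "(x + y) * (x - y) = 4 * \<bar>z\<bar>" using bd by (simp add: power2_eq_square algebra_simps)
  have "{0 :: real} \<in> null_sets lebesgue" by (simp add: negligible_iff_null_sets[symmetric])
  then have "AE t in lebesgue. t \<noteq> (0 :: real)" by (rule AE_I'[where N="{0}"]) auto
  with n(1) show ?thesis
  proof eventually_elim
    case (elim t)
    show ?case
    proof
      assume t: "t \<in> {0..T}"
      with elim have t': "0 < t" "t \<le> T" by auto
      have "(u1 t + u2 t) * (u1 t - u2 t) = 0"
      \<comment> \<open>The sign of \<open>z\<close> decides which function returns to 0:
        \<open>a * b + 4 * z\<close> for \<open>z \<le> 0\<close>, otherwise
        \<open>a * b - 4 * z\<close>, with the roles of \<open>a\<close> and \<open>b\<close>
        exchanged.\<close>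
      proof (cases "z \<le> 0")
        case True
        have "?a 0 * ?b 0 + 4 * ?z 0 = ?a T * ?b T + 4 * ?z T"
          using n(6-8) adm(3) bd' True by simp
        then show ?thesis
          using elim t by (intro null_product_of_constant[OF t' n(3) n(7) n(4)]) simp_all
      next
        case False
        have "?a 0 * ?b 0 - 4 * ?z 0 = ?a T * ?b T - 4 * ?z T"
          using n(6-8) adm(3) bd' False by simp
        then have "(u1 t - u2 t) * (u1 t + u2 t) = 0"
          using elim t by (intro null_product_of_constant[OF t' n(2) n(6) n(5)]) simp_all
        then show ?thesis by (simp only: mult.commute)
      qed
      then show "(u1 t)\<^sup>2 - (u2 t)\<^sup>2 = 0" by (simp add: power2_eq_square algebra_simps)
    qed
  qed
qed

section \<open>Broken curves\<close>

definition two_piece_curve ::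
    "real \<times> real \<Rightarrow> real \<times> real \<Rightarrow> real \<Rightarrow> real \<Rightarrow> point" where
  "two_piece_curve v w \<tau> t =
     min t \<tau> *\<^sub>R (fst v, snd v, 0) +
     max 0 (t - \<tau>) *\<^sub>R (fst w, snd w, \<tau> * (fst v * snd w - snd v * fst w) / 2)"

lemma two_piece_curve_apply:
  "two_piece_curve v w \<tau> t =
     (if t \<le> \<tau> then (t * fst v, t * snd v, 0)
      else (\<tau> * fst v + (t - \<tau>) * fst w, \<tau> * snd v + (t - \<tau>) * snd w,
            (t - \<tau>) * (\<tau> * (fst v * snd w - snd v * fst w) / 2)))"
  by (auto simp: two_piece_curve_def)

lemma lipschitz_on_scaleR_vector:
  fixes f :: "real \<Rightarrow> real" and e :: "'a::real_normed_vector"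
  assumes "\<And>s t. \<bar>f s - f t\<bar> \<le> \<bar>s - t\<bar>"
  shows "(norm e)-lipschitz_on X (\<lambda>t. f t *\<^sub>R e)"
proof (rule lipschitz_onI)
  fix s t
  have "dist (f s *\<^sub>R e) (f t *\<^sub>R e) = \<bar>f s - f t\<bar> * norm e"
    by (simp add: dist_norm flip: scaleR_diff_left)
  also have "\<dots> \<le> \<bar>s - t\<bar> * norm e" by (rule mult_right_mono[OF assms]) simp
  finally show "dist (f s *\<^sub>R e) (f t *\<^sub>R e) \<le> norm e * dist s t"
    by (simp add: dist_real_def mult.commute)
qed simp

lemma horizontal_two_piece_curve:
  assumes T: "0 \<le> T"
  shows "horizontal_curve T (two_piece_curve v w \<tau>)
           (\<lambda>t. if t \<le> \<tau> then fst v else fst w) (\<lambda>t. if t \<le> \<tau> then snd v else snd w)"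
proof -
  let ?c = "two_piece_curve v w \<tau>"
  have lip: "\<exists>L. L-lipschitz_on {0..T} ?c"
  proof -
    have "(norm (fst v, snd v, 0 :: real) +
        norm (fst w, snd w, \<tau> * (fst v * snd w - snd v * fst w) / 2))-lipschitz_on {0..T} ?c"
      unfolding two_piece_curve_def
      by (intro lipschitz_on_add lipschitz_on_scaleR_vector) auto
    then show ?thesis by (rule exI)
  qed
  \<comment> \<open>The corner at time \<open>\<tau>\<close> is discarded as a null set.\<close>
  have "{\<tau>} \<in> null_sets lebesgue" by (simp add: negligible_iff_null_sets[symmetric])
  then have "AE t in lebesgue. t \<noteq> \<tau>" by (rule AE_I'[where N="{\<tau>}"]) auto
  then have ae: "AE t in lebesgue. t \<in> {0..T} \<longrightarrow>
        (?c has_vector_derivative ((if t \<le> \<tau> then fst v else fst w) *\<^sub>R X1 (?c t)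
            + (if t \<le> \<tau> then snd v else snd w) *\<^sub>R X2 (?c t))) (at t within {0..T})"
  proof eventually_elim
    case (elim t)
    have "(?c has_vector_derivative ((if t \<le> \<tau> then fst v else fst w) *\<^sub>R X1 (?c t)
            + (if t \<le> \<tau> then snd v else snd w) *\<^sub>R X2 (?c t))) (at t)"
    proof (cases "t < \<tau>")
      case True
      have "((\<lambda>t. t *\<^sub>R (fst v, snd v, 0 :: real)) has_vector_derivative (fst v, snd v, 0)) (at t)"
        by (auto intro!: derivative_eq_intros)
      then have "(?c has_vector_derivative (fst v, snd v, 0)) (at t)"
        by (rule has_vector_derivative_transform_within_open[of _ _ _ "{..<\<tau>}"])
           (use True in \<open>auto simp: two_piece_curve_apply\<close>)
      moreover have "(if t \<le> \<tau> then fst v else fst w) *\<^sub>R X1 (?c t)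
            + (if t \<le> \<tau> then snd v else snd w) *\<^sub>R X2 (?c t) = (fst v, snd v, 0)"
        using True by (simp add: X1_def X2_def two_piece_curve_apply)
      ultimately show ?thesis by metis
    next
      case False
      with elim have t: "\<tau> < t" by simp
      let ?w = "(fst w, snd w, \<tau> * (fst v * snd w - snd v * fst w) / 2)"
      have "((\<lambda>t. \<tau> *\<^sub>R (fst v, snd v, 0 :: real) + (t - \<tau>) *\<^sub>R ?w) has_vector_derivative ?w) (at t)"
        by (rule derivative_eq_intros refl)+ simp
      then have "(?c has_vector_derivative ?w) (at t)"
        by (rule has_vector_derivative_transform_within_open[of _ _ _ "{\<tau><..}"])
           (use t in \<open>auto simp: two_piece_curve_apply\<close>)
      moreover have "(if t \<le> \<tau> then fst v else fst w) *\<^sub>R X1 (?c t)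
            + (if t \<le> \<tau> then snd v else snd w) *\<^sub>R X2 (?c t) = ?w"
        using t by (simp add: X1_def X2_def two_piece_curve_apply algebra_simps)
          (simp add: field_simps)
      ultimately show ?thesis by metis
    qed
    then show ?case by (blast intro: has_vector_derivative_at_within)
  qed
  show ?thesis unfolding horizontal_curve_def using T lip ae by (intro conjI)
qed

text \<open>In null coordinates the two velocities are \<open>(\<theta> * a, (1 - \<theta>) * b)\<close> and
  \<open>((1 - \<theta>) * a, \<theta> * b)\<close>, where \<open>(a, b)\<close> are those of the end point; the speed is the
  same on both pieces.\<close>

lemma cone_point_reached:
  assumes cone: "4 * \<bar>z\<bar> \<le> x\<^sup>2 - y\<^sup>2" "0 \<le> x"
  obtains c u1 u2 k where "admissible 2 c u1 u2" "c 0 = q0" "c 2 = (x, y, z)"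
    "\<forall>t. (u1 t)\<^sup>2 - (u2 t)\<^sup>2 = k"
    "4 * \<bar>z\<bar> < x\<^sup>2 - y\<^sup>2 \<longrightarrow> timelike 2 c u1 u2 \<and> 0 < k"
proof -
  \<comment> \<open>The two velocities, each used for unit time, add up to \<open>(a, b)\<close> in
    null coordinates and produce height \<open>(1 - 2 * \<theta>) * (a * b) / 4\<close>;
    \<open>\<theta>\<close> solves this for \<open>z\<close>. If \<open>a * b = 0\<close>, division
    by zero gives \<open>\<theta> = 1 / 2\<close>, which is harmless because the cone condition then
    forces \<open>z = 0\<close>.\<close>
  define a b \<theta> where ab: "a = x + y" "b = x - y" and \<theta>: "\<theta> = (1 - 4 * z / (a * b)) / 2"
  have abz: "a * b = x\<^sup>2 - y\<^sup>2" by (simp add: ab power2_eq_square algebra_simps)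
  have "y\<^sup>2 \<le> x\<^sup>2" using cone by linarith
  then have "\<bar>y\<bar> \<le> x" using cone(2) by (metis abs_le_square_iff abs_of_nonneg)
  then have ab0: "0 \<le> a" "0 \<le> b" by (auto simp: ab)
  have z4: "4 * z = (1 - 2 * \<theta>) * (a * b)"
  proof (cases "a * b = 0")
    case True
    then show ?thesis using cone abz by simp
  next
    case False
    have "1 - 2 * ((1 - e) / 2) = e" for e :: real by (simp add: field_simps)
    then have "1 - 2 * \<theta> = 4 * z / (a * b)" unfolding \<theta> .
    with False show ?thesis by simp
  qed
  have th: "0 \<le> \<theta> \<and> \<theta> \<le> 1 \<and> (4 * \<bar>z\<bar> < x\<^sup>2 - y\<^sup>2 \<longrightarrow> 0 < \<theta> \<and> \<theta> < 1)"
  proof (cases "a * b = 0")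
    case True
    have "\<theta> = 1 / 2" unfolding \<theta> True by simp
    then show ?thesis by simp
  next
    case False
    then have "0 < a * b" using ab0 by (simp add: less_le)
    moreover have "- 1 \<le> 4 * z / P \<and> 4 * z / P \<le> 1 \<and>
        (4 * \<bar>z\<bar> < P \<longrightarrow> - 1 < 4 * z / P \<and> 4 * z / P < 1)"
      if "0 < P" "4 * \<bar>z\<bar> \<le> P" for P
      using that by (auto simp: pos_le_divide_eq pos_divide_le_eq pos_less_divide_eq pos_divide_less_eq)
    ultimately have "- 1 \<le> 4 * z / (a * b) \<and> 4 * z / (a * b) \<le> 1 \<and>
        (4 * \<bar>z\<bar> < a * b \<longrightarrow> - 1 < 4 * z / (a * b) \<and> 4 * z / (a * b) < 1)"
      using cone(1) abz by metis
    then show ?thesis unfolding \<theta> abz by simp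
  qed
  define v w where v: "v = ((\<theta> * a + (1 - \<theta>) * b) / 2, (\<theta> * a - (1 - \<theta>) * b) / 2)"
    and w: "w = (((1 - \<theta>) * a + \<theta> * b) / 2, ((1 - \<theta>) * a - \<theta> * b) / 2)"
  let ?c = "two_piece_curve v w 1"
  let ?u1 = "\<lambda>t :: real. if t \<le> 1 then fst v else fst w"
  let ?u2 = "\<lambda>t :: real. if t \<le> 1 then snd v else snd w"
  have hc: "horizontal_curve 2 ?c ?u1 ?u2" by (rule horizontal_two_piece_curve) simp
  have nn: "0 \<le> \<theta> * a" "0 \<le> \<theta> * b" "0 \<le> (1 - \<theta>) * a" "0 \<le> (1 - \<theta>) * b"
    using th ab0 by auto
  have "\<bar>?u2 t\<bar> \<le> ?u1 t" for t using nn by (auto simp: v w abs_if field_simps)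
  with hc have adm: "admissible 2 ?c ?u1 ?u2" by (simp add: admissible_def)
  have c0: "?c 0 = q0" by (simp add: two_piece_curve_apply q0_def)
  have "fst v * snd w - snd v * fst w = ((1 - \<theta>) * (1 - \<theta>) - \<theta> * \<theta>) * (a * b) / 2"
    by (simp add: v w field_simps)
  also have "\<dots> = (1 - 2 * \<theta>) * (a * b) / 2" by (simp add: algebra_simps)
  finally have cr: "(fst v * snd w - snd v * fst w) / 2 = z" using z4 by simp
  have "fst v + fst w = (a + b) / 2" "snd v + snd w = (a - b) / 2"
    by (simp_all add: v w field_simps)
  then have "fst v + fst w = x" "snd v + snd w = y" by (simp_all add: ab)
  with cr have c2: "?c 2 = (x, y, z)" by (simp add: two_piece_curve_apply)
  \<comment> \<open>The squared speed is the product of the two null velocities, and swapping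
    \<open>\<theta>\<close> with \<open>1 - \<theta>\<close> does not change this product.\<close>
  have speed: "(?u1 t)\<^sup>2 - (?u2 t)\<^sup>2 = \<theta> * a * ((1 - \<theta>) * b)" for t
    by (simp add: v w power2_eq_square field_simps)
  have tl: "timelike 2 ?c ?u1 ?u2 \<and> 0 < \<theta> * a * ((1 - \<theta>) * b)" if "4 * \<bar>z\<bar> < x\<^sup>2 - y\<^sup>2"
  proof -
    have "0 < a * b" using that abz by simp
    then have pos: "0 < a" "0 < b" using ab0 by (auto simp: zero_less_mult_iff)
    then have p: "0 < \<theta> * a" "0 < \<theta> * b" "0 < (1 - \<theta>) * a" "0 < (1 - \<theta>) * b"
      using th that by auto
    have lt: "\<bar>(p - q) / 2\<bar> < (p + q) / 2" if "0 < p" "0 < q" for p q :: real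
      using that by (auto simp: abs_if field_simps)
    have "\<bar>?u2 t\<bar> < ?u1 t" for t
      unfolding v w using lt[OF p(1,4)] lt[OF p(3,2)] by simp
    with hc p show ?thesis by (simp add: timelike_def)
  qed
  show thesis by (rule that[OF adm c0 c2]) (use speed tl in blast)+
qed

section \<open>The futures of the origin and the sphere of zero radius\<close>

lemma timelike_imp_admissible: "timelike T c u1 u2 \<Longrightarrow> admissible T c u1 u2"
  unfolding timelike_def admissible_def by (auto elim!: eventually_mono)

lemma causal_future_q0: "causal_future q0 = {(x, y, z). 4 * \<bar>z\<bar> \<le> x\<^sup>2 - y\<^sup>2 \<and> 0 \<le> x}"
proof -
  have "(x, y, z) \<in> causal_future q0 \<longleftrightarrow> 4 * \<bar>z\<bar> \<le> x\<^sup>2 - y\<^sup>2 \<and> 0 \<le> x" for x y z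
  proof
    assume "(x, y, z) \<in> causal_future q0"
    then obtain T c u1 u2 where "admissible T c u1 u2" "c 0 = q0" "c T = (x, y, z)"
      unfolding causal_future_def by auto
    then show "4 * \<bar>z\<bar> \<le> x\<^sup>2 - y\<^sup>2 \<and> 0 \<le> x" by (rule causal_future_subset_cone)
  next
    assume "4 * \<bar>z\<bar> \<le> x\<^sup>2 - y\<^sup>2 \<and> 0 \<le> x"
    then obtain c u1 u2 where "admissible 2 c u1 u2" "c 0 = q0" "c 2 = (x, y, z)"
      using cone_point_reached by metis
    then show "(x, y, z) \<in> causal_future q0" unfolding causal_future_def by auto
  qed
  then show ?thesis by auto
qed

text \<open>A timelike curve ending on the boundary would have null controls almost everywhere,
  contradicting \<open>\<bar>u2\<bar> < u1\<close> on an interval of positive measure; this is where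
  \<open>0 < T\<close> enters. Together with the strict inequality, \<open>0 \<le> x\<close> amounts
  to \<open>0 < x\<close>.\<close>

lemma chronological_future_q0:
  "chronological_future q0 = {(x, y, z). 4 * \<bar>z\<bar> < x\<^sup>2 - y\<^sup>2 \<and> 0 \<le> x}"
proof -
  have "(x, y, z) \<in> chronological_future q0 \<longleftrightarrow> 4 * \<bar>z\<bar> < x\<^sup>2 - y\<^sup>2 \<and> 0 \<le> x" for x y z
  proof
    assume "(x, y, z) \<in> chronological_future q0"
    then obtain T c u1 u2 where T: "0 < T" and tl: "timelike T c u1 u2"
      and c: "c 0 = q0" "c T = (x, y, z)"
      unfolding chronological_future_def by auto
    note adm = timelike_imp_admissible[OF tl]
    have cone: "4 * \<bar>z\<bar> \<le> x\<^sup>2 - y\<^sup>2 \<and> 0 \<le> x" by (rule causal_future_subset_cone[OF adm c])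
    have "x\<^sup>2 - y\<^sup>2 \<noteq> 4 * \<bar>z\<bar>"
    proof
      assume "x\<^sup>2 - y\<^sup>2 = 4 * \<bar>z\<bar>"
      from boundary_null_controls[OF adm c this]
      have "AE t in lebesgue. t \<in> {0..T} \<longrightarrow> (u1 t)\<^sup>2 - (u2 t)\<^sup>2 = 0" .
      moreover have "AE t in lebesgue. t \<in> {0..T} \<longrightarrow> \<bar>u2 t\<bar> < u1 t"
        using tl by (simp add: timelike_def)
      ultimately have "AE t in lebesgue. t \<notin> {0..T}"
      proof eventually_elim
        case (elim t)
        have False if "\<bar>u2 t\<bar> < u1 t" "(u1 t)\<^sup>2 - (u2 t)\<^sup>2 = 0"
        proof -
          have "\<bar>u1 t\<bar> = \<bar>u2 t\<bar>" using that(2) by (metis eq_iff_diff_eq_0 power2_eq_iff abs_minus_cancel)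
          then show False using that(1) by linarith
        qed
        then show ?case using elim by blast
      qed
      then have "negligible {0..T}"
        by (auto simp: negligible_iff_null_sets AE_iff_null_sets)
      then show False using T negligible_interval(1)[of 0 T] by auto
    qed
    with cone show "4 * \<bar>z\<bar> < x\<^sup>2 - y\<^sup>2 \<and> 0 \<le> x" by linarith
  next
    assume *: "4 * \<bar>z\<bar> < x\<^sup>2 - y\<^sup>2 \<and> 0 \<le> x"
    then obtain c u1 u2 where "timelike 2 c u1 u2" "c 0 = q0" "c 2 = (x, y, z)"
      using cone_point_reached[of z x y] by (metis less_imp_le)
    then show "(x, y, z) \<in> chronological_future q0"
      unfolding chronological_future_def by (auto intro!: exI[of _ "2 :: real"])
  qed
  then show ?thesis by auto
qed

text \<open>In the interior of the cone a single curve of positive length already makes the supremum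
  positive; it need not be a longest one. On the boundary every length is 0.\<close>

lemma zero_sphere_eq: "zero_sphere = {(x, y, z). x\<^sup>2 - y\<^sup>2 = 4 * \<bar>z\<bar> \<and> 0 \<le> x}"
proof -
  have "(x, y, z) \<in> zero_sphere \<longleftrightarrow> x\<^sup>2 - y\<^sup>2 = 4 * \<bar>z\<bar> \<and> 0 \<le> x" for x y z
  proof (cases "(x, y, z) \<in> causal_future q0")
    case False
    then show ?thesis by (auto simp: zero_sphere_def causal_future_q0)
  next
    case J: True
    then have cone: "4 * \<bar>z\<bar> \<le> x\<^sup>2 - y\<^sup>2" "0 \<le> x" by (auto simp: causal_future_q0)
    obtain c u1 u2 k where adm: "admissible 2 c u1 u2" and c: "c 0 = q0" "c 2 = (x, y, z)"
      and k: "\<forall>t. (u1 t)\<^sup>2 - (u2 t)\<^sup>2 = k"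
      and tl: "4 * \<bar>z\<bar> < x\<^sup>2 - y\<^sup>2 \<longrightarrow> timelike 2 c u1 u2 \<and> 0 < k"
      by (rule cone_point_reached[OF cone])
    have len: "sl_length 2 u1 u2 = 2 * sqrt k"
      by (simp add: sl_length_def k set_lebesgue_integral_def)
    let ?L = "{ereal (sl_length T u1 u2) | T c u1 u2.
                 admissible T c u1 u2 \<and> c 0 = q0 \<and> c T = (x, y, z)}"
    have mem: "ereal (sl_length 2 u1 u2) \<in> ?L" using adm c by blast
    have "sl_dist q0 (x, y, z) = 0 \<longleftrightarrow> x\<^sup>2 - y\<^sup>2 = 4 * \<bar>z\<bar>"
    proof
      assume d: "sl_dist q0 (x, y, z) = 0"
      have "ereal (sl_length 2 u1 u2) \<le> 0"
        using Sup_upper[OF mem] d by (simp add: sl_dist_def)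
      then have "k \<le> 0" by (simp add: len)
      with tl cone show "x\<^sup>2 - y\<^sup>2 = 4 * \<bar>z\<bar>" by fastforce
    next
      assume bd: "x\<^sup>2 - y\<^sup>2 = 4 * \<bar>z\<bar>"
      have z: "sl_length T v1 v2 = 0"
        if "admissible T g v1 v2" "g 0 = q0" "g T = (x, y, z)" for T g v1 v2
      proof -
        have "AE t in lebesgue. indicator {0..T} t *\<^sub>R sqrt ((v1 t)\<^sup>2 - (v2 t)\<^sup>2) = 0"
          using boundary_null_controls[OF that bd] by eventually_elim (auto simp: indicator_def)
        then show ?thesis unfolding sl_length_def set_lebesgue_integral_def
          by (rule integral_eq_zero_AE)
      qed
      \<comment> \<open>Nonemptiness matters as well: the supremum of the empty set in
        \<open>ereal\<close> is not 0.\<close>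
      have "?L = {0}"
      proof
        show "?L \<subseteq> {0}" using z by (auto simp: zero_ereal_def)
        show "{0} \<subseteq> ?L" using mem z[OF adm c] by (simp add: zero_ereal_def)
      qed
      then show "sl_dist q0 (x, y, z) = 0" by (simp add: sl_dist_def)
    qed
    with J cone show ?thesis by (simp add: zero_sphere_def)
  qed
  then show ?thesis by auto
qed

text \<open>The null-coordinate form of the sphere, from which edge times and symmetry parameters
  are later read off.\<close>

lemma zero_sphereD:
  assumes "(x, y, z) \<in> zero_sphere"
  shows "0 \<le> x + y" "0 \<le> x - y" "(x + y) * (x - y) = 4 * \<bar>z\<bar>"
proof -
  have xyz: "x\<^sup>2 - y\<^sup>2 = 4 * \<bar>z\<bar>" "0 \<le> x" using assms by (auto simp: zero_sphere_eq)
  then have "y\<^sup>2 \<le> x\<^sup>2" by linarith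
  then have "\<bar>y\<bar> \<le> x" using xyz(2) by (metis abs_le_square_iff abs_of_nonneg)
  then show "0 \<le> x + y" "0 \<le> x - y" by auto
  show "(x + y) * (x - y) = 4 * \<bar>z\<bar>" using xyz(1) by (simp add: power2_eq_square algebra_simps)
qed

lemma zero_sphereI:
  assumes "0 \<le> x + y" "0 \<le> x - y" "(x + y) * (x - y) = 4 * \<bar>z\<bar>"
  shows "(x, y, z) \<in> zero_sphere"
  using assms by (auto simp: zero_sphere_eq power2_eq_square algebra_simps)

section \<open>The graph of \<open>\<Phi>\<close>\<close>

lemma \<Phi>_apply: "\<Phi> (y, z) = sqrt (y\<^sup>2 + 4 * \<bar>z\<bar>)"
  by (simp add: \<Phi>_def)

lemma continuous_on_\<Phi>: "continuous_on S \<Phi>"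
  unfolding \<Phi>_def case_prod_beta by (intro continuous_intros)

lemma \<Phi>_nonneg: "0 \<le> \<Phi> p"
  by (simp add: \<Phi>_def case_prod_beta)

lemma \<Phi>_le_iff: "\<Phi> (y, z) \<le> x \<longleftrightarrow> 4 * \<bar>z\<bar> \<le> x\<^sup>2 - y\<^sup>2 \<and> 0 \<le> x"
proof
  assume *: "\<Phi> (y, z) \<le> x"
  then have "0 \<le> x" using \<Phi>_nonneg order_trans by blast
  with * show "4 * \<bar>z\<bar> \<le> x\<^sup>2 - y\<^sup>2 \<and> 0 \<le> x" unfolding \<Phi>_apply by (auto dest: sqrt_le_D)
next
  assume "4 * \<bar>z\<bar> \<le> x\<^sup>2 - y\<^sup>2 \<and> 0 \<le> x"
  then show "\<Phi> (y, z) \<le> x" unfolding \<Phi>_apply by (auto intro!: real_le_lsqrt)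
qed

lemma eq_\<Phi>_iff: "x = \<Phi> (y, z) \<longleftrightarrow> x\<^sup>2 - y\<^sup>2 = 4 * \<bar>z\<bar> \<and> 0 \<le> x"
proof -
  have "x = sqrt r \<longleftrightarrow> x\<^sup>2 = r \<and> 0 \<le> x" if "0 \<le> r" for r
    using that real_sqrt_unique[of x r] by auto
  then have "x = \<Phi> (y, z) \<longleftrightarrow> x\<^sup>2 = y\<^sup>2 + 4 * \<bar>z\<bar> \<and> 0 \<le> x" unfolding \<Phi>_apply by simp
  then show ?thesis by linarith
qed

lemma less_\<Phi>_iff: "\<Phi> (y, z) < x \<longleftrightarrow> 4 * \<bar>z\<bar> < x\<^sup>2 - y\<^sup>2 \<and> 0 \<le> x"
  using \<Phi>_le_iff[of y z x] eq_\<Phi>_iff[of x y z] by (auto simp: less_le)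

lemma causal_future_eq_epigraph: "causal_future q0 = {(x, p). \<Phi> p \<le> x}"
  by (auto simp: causal_future_q0 \<Phi>_le_iff)

lemma chronological_future_eq_epigraph: "chronological_future q0 = {(x, p). \<Phi> p < x}"
  by (auto simp: chronological_future_q0 less_\<Phi>_iff)

lemma zero_sphere_eq_graph: "zero_sphere = {(x, p). x = \<Phi> p}"
  using eq_\<Phi>_iff unfolding zero_sphere_eq by (simp add: set_eq_iff split_paired_all)

lemma closed_epigraph:
  fixes f :: "'a::topological_space \<Rightarrow> real"
  assumes "continuous_on UNIV f"
  shows "closed {(x, p). f p \<le> x}" "open {(x, p). f p < x}" "closed {(x, p). x = f p}"
proof -
  have c: "continuous_on UNIV (\<lambda>q :: real \<times> 'a. f (snd q))"
    by (intro continuous_on_compose2[OF assms] continuous_intros) auto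
  show "closed {(x, p). f p \<le> x}"
    unfolding case_prod_beta by (intro closed_Collect_le c continuous_intros)
  show "open {(x, p). f p < x}"
    unfolding case_prod_beta by (intro open_Collect_less c continuous_intros)
  show "closed {(x, p). x = f p}"
    unfolding case_prod_beta by (intro closed_Collect_eq c continuous_intros)
qed

text \<open>Graph points are limits of points above them and of points below them, so closure and
  interior do not depend on which graph points \<open>A\<close> contains. This treats both futures
  and the chronological future with \<open>q0\<close> added at one stroke.\<close>

lemma frontier_epigraph:
  fixes f :: "'a::topological_space \<Rightarrow> real"
  assumes f: "continuous_on UNIV f" and A: "{(x, p). f p < x} \<subseteq> A" "A \<subseteq> {(x, p). f p \<le> x}"
  shows "frontier A = {(x, p). x = f p}"
proof -
  have above: "(f p, p) \<in> closure {(x, p). f p < x}" for p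
  proof (rule Lim_in_closed_set[where F=sequentially and f="\<lambda>n. (f p + inverse (real (Suc n)), p)"])
    have "(\<lambda>n. (f p + inverse (real (Suc n)), p)) \<longlonglongrightarrow> (f p + 0, p)"
      by (intro tendsto_intros LIMSEQ_inverse_real_of_nat)
    then show "(\<lambda>n. (f p + inverse (real (Suc n)), p)) \<longlonglongrightarrow> (f p, p)" by simp
    show "\<forall>\<^sub>F n in sequentially. (f p + inverse (real (Suc n)), p) \<in> closure {(x, p). f p < x}"
      by (intro always_eventually allI subsetD[OF closure_subset]) simp
  qed auto
  have below: "(f p, p) \<notin> interior {(x, p). f p \<le> x}" for p
  proof
    assume "(f p, p) \<in> interior {(x, p). f p \<le> x}"
    then have ev: "\<forall>\<^sub>F q in nhds (f p, p). q \<in> {(x, p). f p \<le> x}"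
      using eventually_nhds_in_open[of "interior {(x, p). f p \<le> x}" "(f p, p)"] interior_subset
      by (metis (no_types, lifting) eventually_mono open_interior subsetD)
    have "(\<lambda>n. (f p - inverse (real (Suc n)), p)) \<longlonglongrightarrow> (f p - 0, p)"
      by (intro tendsto_intros LIMSEQ_inverse_real_of_nat)
    then have "\<forall>\<^sub>F n in sequentially. (f p - inverse (real (Suc n)), p) \<in> {(x, p). f p \<le> x}"
      using ev by (auto simp: filterlim_iff simp del: of_nat_Suc)
    then show False by (simp add: eventually_sequentially)
  qed
  have cl: "closure A = {(x, p). f p \<le> x}"
  proof
    show "closure A \<subseteq> {(x, p). f p \<le> x}"
      using A(2) closed_epigraph(1)[OF f] by (rule closure_minimal)
    show "{(x, p). f p \<le> x} \<subseteq> closure A"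
    proof clarify
      fix x p assume "f p \<le> x"
      then consider "f p < x" | "x = f p" by linarith
      then show "(x, p) \<in> closure A"
        using A(1) closure_subset[of A] above[of p] closure_mono[OF A(1)] by cases auto
    qed
  qed
  have int: "interior A = {(x, p). f p < x}"
  proof
    show "{(x, p). f p < x} \<subseteq> interior A"
      using A(1) closed_epigraph(2)[OF f] by (rule interior_maximal)
    show "interior A \<subseteq> {(x, p). f p < x}"
    proof clarify
      fix x p assume *: "(x, p) \<in> interior A"
      then have "f p \<le> x" using interior_subset A(2) by fastforce
      moreover have "x \<noteq> f p" using * interior_mono[OF A(2)] below[of p] by auto
      ultimately show "f p < x" by simp
    qed
  qed
  show ?thesis unfolding frontier_def cl int by auto
qed

lemma q0_on_graph: "q0 = (\<Phi> (0, 0), 0, 0)"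
  by (simp add: q0_def \<Phi>_apply)

lemma frontier_futures:
  "frontier (causal_future q0) = zero_sphere"
  "frontier (chronological_future q0) = zero_sphere"
  "frontier (chronological_future q0 \<union> {q0}) = zero_sphere"
  unfolding causal_future_eq_epigraph chronological_future_eq_epigraph zero_sphere_eq_graph
  by (rule frontier_epigraph[OF continuous_on_\<Phi>]; auto simp: q0_on_graph)+

lemma causal_minus_chronological: "causal_future q0 - chronological_future q0 = zero_sphere"
  by (auto simp: causal_future_eq_epigraph chronological_future_eq_epigraph zero_sphere_eq_graph)

lemma closed_zero_sphere: "closed zero_sphere"
  unfolding zero_sphere_eq_graph by (rule closed_epigraph(3)[OF continuous_on_\<Phi>])

text \<open>\<open>Euclidean_space 2\<close> consists of the sequences that vanish from index 2 on,
  with the product topology. The chart forgets the first coordinate; its inverse recovers it with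
  \<open>f\<close>.\<close>

lemma graph_homeomorphic_Euclidean_space_2:
  fixes f :: "real \<times> real \<Rightarrow> real"
  assumes f: "continuous_on UNIV f"
  shows "top_of_set {(x, p). x = f p} homeomorphic_space Euclidean_space 2"
proof -
  let ?g = "\<lambda>q :: point. \<lambda>i :: nat. if i = 0 then fst (snd q) else if i = 1 then snd (snd q) else 0"
  let ?h = "\<lambda>u :: nat \<Rightarrow> real. (f (u 0, u 1), u 0, u 1)"
  have "homeomorphic_maps (top_of_set {(x, p). x = f p}) (Euclidean_space 2) ?g ?h"
    unfolding homeomorphic_maps_def
  proof (intro conjI)
    show "continuous_map (top_of_set {(x, p). x = f p}) (Euclidean_space 2) ?g"
      unfolding Euclidean_space_def continuous_map_in_subtopology continuous_map_componentwise_UNIV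
    proof (intro conjI allI)
      fix i :: nat
      have "continuous_on {(x, p). x = f p} (\<lambda>q. ?g q i)"
        by (cases "i = 0"; cases "i = 1")
          (simp_all add: continuous_on_fst continuous_on_snd continuous_on_id)
      then show "continuous_map (top_of_set {(x, p). x = f p}) euclidean (\<lambda>q. ?g q i)"
        by (simp only: continuous_map_iff_continuous)
    qed auto
    have "continuous_map (powertop_real UNIV) euclidean (\<lambda>u :: nat \<Rightarrow> real. u i)" for i
      by (rule continuous_map_product_projection) simp
    then have cu: "continuous_on UNIV (\<lambda>u :: nat \<Rightarrow> real. u i)" for i
      by (simp add: euclidean_product_topology)
    have "continuous_on UNIV ?h"
      by (intro continuous_on_Pair continuous_on_compose2[OF f] cu) auto
    then have "continuous_on {u. \<forall>i\<ge>2. u i = 0} ?h" by (rule continuous_on_subset) simp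
    then show "continuous_map (Euclidean_space 2) (top_of_set {(x, p). x = f p}) ?h"
      by (auto simp: Euclidean_space_def euclidean_product_topology continuous_map_in_subtopology)
    show "\<forall>q\<in>topspace (top_of_set {(x, p). x = f p}). ?h (?g q) = q" by auto
    show "\<forall>u\<in>topspace (Euclidean_space 2). ?g (?h u) = u"
      by (auto simp: topspace_Euclidean_space fun_eq_iff)
  qed
  then show ?thesis unfolding homeomorphic_space_def by blast
qed

lemma second_countable_euclidean:
  "second_countable (euclidean :: 'a::second_countable_topology topology)"
proof -
  obtain B :: "'a set set" where B: "countable B" "topological_basis B"
    using ex_countable_basis by blast
  have "\<exists>V\<in>B. x \<in> V \<and> V \<subseteq> U" if "open U" "x \<in> U" for U x
    using topological_basisE[OF B(2) that] by metis
  with B topological_basis_open[OF B(2)] show ?thesis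
    unfolding second_countable_def by (intro exI[of _ B]) auto
qed

text \<open>The graph chart is global, so it serves at every point.\<close>

lemma topological_manifold_zero_sphere: "topological_manifold 2 (top_of_set zero_sphere)"
proof -
  have hs: "top_of_set zero_sphere homeomorphic_space Euclidean_space 2"
    unfolding zero_sphere_eq_graph by (rule graph_homeomorphic_Euclidean_space_2[OF continuous_on_\<Phi>])
  show ?thesis unfolding topological_manifold_def
  proof (intro conjI ballI)
    show "Hausdorff_space (top_of_set zero_sphere)"
      by (simp add: Hausdorff_space_subtopology)
    show "second_countable (top_of_set zero_sphere)"
      by (simp add: second_countable_subtopology second_countable_euclidean)
    fix p assume "p \<in> topspace (top_of_set zero_sphere)"
    then show "\<exists>U V. openin (top_of_set zero_sphere) U \<and> p \<in> U \<and> openin (Euclidean_space 2) V \<and>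
        subtopology (top_of_set zero_sphere) U homeomorphic_space subtopology (Euclidean_space 2) V"
      using hs by (intro exI[of _ "topspace (top_of_set zero_sphere)"]
          exI[of _ "topspace (Euclidean_space 2)"]) (auto simp: subtopology_topspace subtopology_subtopology)
  qed
qed

section \<open>Regularity of \<open>\<Phi>\<close>\<close>

lemma \<Phi>_even: "\<Phi> (- y, z) = \<Phi> (y, z)" "\<Phi> (y, - z) = \<Phi> (y, z)"
  by (simp_all add: \<Phi>_apply)

lemma dist_components_le:
  fixes p q :: "real \<times> real"
  shows "\<bar>fst p - fst q\<bar> \<le> dist p q" "\<bar>snd p - snd q\<bar> \<le> dist p q"
  using dist_fst_le[of p q] dist_snd_le[of p q] by (simp_all add: dist_real_def)

text \<open>The common estimate behind both regularity results: \<open>2 * r\<close> bounds the sum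
  of the first coordinates in the difference of squares, and 4 is the factor of the absolute
  value.\<close>

lemma \<Phi>_radicand_diff:
  fixes p q :: "real \<times> real"
  assumes "\<bar>fst p\<bar> \<le> r" "\<bar>fst q\<bar> \<le> r"
  shows "\<bar>((fst p)\<^sup>2 + 4 * \<bar>snd p\<bar>) - ((fst q)\<^sup>2 + 4 * \<bar>snd q\<bar>)\<bar> \<le> (2 * r + 4) * dist p q"
proof -
  have "(fst p)\<^sup>2 - (fst q)\<^sup>2 = (fst p + fst q) * (fst p - fst q)"
    by (simp add: power2_eq_square algebra_simps)
  then have "\<bar>(fst p)\<^sup>2 - (fst q)\<^sup>2\<bar> = \<bar>fst p + fst q\<bar> * \<bar>fst p - fst q\<bar>" by (simp add: abs_mult)
  also have "\<dots> \<le> (2 * r) * dist p q"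
    using assms dist_components_le(1)[of p q] by (intro mult_mono) auto
  finally have 1: "\<bar>(fst p)\<^sup>2 - (fst q)\<^sup>2\<bar> \<le> (2 * r) * dist p q" .
  have "\<bar>\<bar>snd p\<bar> - \<bar>snd q\<bar>\<bar> \<le> dist p q"
    using dist_components_le(2)[of p q] by linarith
  with 1 show ?thesis by (simp add: algebra_simps)
qed

lemma \<Phi>_locally_lipschitz:
  assumes "y \<noteq> 0"
  shows "\<exists>\<epsilon>>0. \<exists>L. L-lipschitz_on (ball (y, 0) \<epsilon>) \<Phi>"
proof -
  \<comment> \<open>On the ball of this radius first coordinates have size between \<open>m\<close>
    and \<open>3 * m\<close>. Both square roots are therefore at least \<open>m\<close>, and
    dividing the difference of radicands by the sum of the roots costs at most
    \<open>1 / (2 * m)\<close>.\<close>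
  define m where "m = \<bar>y\<bar> / 2"
  have m: "0 < m" using assms by (simp add: m_def)
  have "((2 * (3 * m) + 4) / (2 * m))-lipschitz_on (ball (y, 0) m) \<Phi>"
  proof (rule lipschitz_onI)
    fix p q :: "real \<times> real" assume pq: "p \<in> ball (y, 0) m" "q \<in> ball (y, 0) m"
    let ?P = "(fst p)\<^sup>2 + 4 * \<bar>snd p\<bar>" and ?Q = "(fst q)\<^sup>2 + 4 * \<bar>snd q\<bar>"
    have b: "m \<le> \<bar>fst p\<bar> \<and> \<bar>fst p\<bar> \<le> 3 * m" if "p \<in> ball (y, 0) m" for p :: "real \<times> real"
      using that dist_components_le(1)[of "(y, 0)" p] by (auto simp: m_def)
    have low: "m \<le> sqrt ((fst p)\<^sup>2 + 4 * \<bar>snd p\<bar>)" if "p \<in> ball (y, 0) m" for p :: "real \<times> real"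
      using b[OF that] m power_mono[of m "\<bar>fst p\<bar>" 2] by (intro real_le_rsqrt) auto
    have "(sqrt ?P - sqrt ?Q) * (sqrt ?P + sqrt ?Q) = ?P - ?Q"
      by (simp add: algebra_simps)
    then have "\<bar>sqrt ?P - sqrt ?Q\<bar> * \<bar>sqrt ?P + sqrt ?Q\<bar> = \<bar>?P - ?Q\<bar>"
      by (simp only: abs_mult[symmetric])
    then have "\<bar>sqrt ?P - sqrt ?Q\<bar> * (sqrt ?P + sqrt ?Q) = \<bar>?P - ?Q\<bar>" by simp
    moreover have "\<bar>sqrt ?P - sqrt ?Q\<bar> * (2 * m) \<le> \<bar>sqrt ?P - sqrt ?Q\<bar> * (sqrt ?P + sqrt ?Q)"
      using low[OF pq(1)] low[OF pq(2)] by (intro mult_left_mono) auto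
    ultimately have "\<bar>sqrt ?P - sqrt ?Q\<bar> * (2 * m) \<le> (2 * (3 * m) + 4) * dist p q"
      using \<Phi>_radicand_diff[of p "3 * m" q] b[OF pq(1)] b[OF pq(2)] by linarith
    then have "\<bar>sqrt ?P - sqrt ?Q\<bar> \<le> (2 * (3 * m) + 4) * dist p q / (2 * m)"
      using m by (simp add: pos_le_divide_eq)
    then show "dist (\<Phi> p) (\<Phi> q) \<le> (2 * (3 * m) + 4) / (2 * m) * dist p q"
      by (simp add: \<Phi>_def case_prod_beta dist_real_def)
  qed (use m in auto)
  with m show ?thesis by blast
qed

text \<open>Subadditivity of the square root, in the form that yields the exponent 1/2.\<close>

lemma abs_sqrt_diff_le:
  fixes x y :: real
  assumes "0 \<le> x" "0 \<le> y"
  shows "\<bar>sqrt x - sqrt y\<bar> \<le> sqrt \<bar>x - y\<bar>"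
proof -
  have *: "sqrt x - sqrt y \<le> sqrt (x - y)" if "0 \<le> y" "y \<le> x" for x y :: real
    using sqrt_add_le_add_sqrt[of y "x - y"] that by simp
  show ?thesis
  proof (cases "y \<le> x")
    case True
    then show ?thesis using *[OF assms(2)] by simp
  next
    case False
    then show ?thesis using *[OF assms(1), of y] by (simp add: abs_if)
  qed
qed

lemma \<Phi>_holder: "holder_on (1/2) (ball (0, 0) 1) \<Phi>"
  unfolding holder_on_def
\<comment> \<open>On the unit ball the radicand is Lipschitz with constant
  \<open>2 * 1 + 4 = 6\<close>.\<close>
proof (intro exI[of _ "sqrt 6"] ballI)
  fix p q :: "real \<times> real" assume pq: "p \<in> ball (0, 0) 1" "q \<in> ball (0, 0) 1"
  then have b: "\<bar>fst p\<bar> \<le> 1" "\<bar>fst q\<bar> \<le> 1"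
    using dist_components_le(1)[of "(0, 0)" p] dist_components_le(1)[of "(0, 0)" q] by auto
  have "dist (\<Phi> p) (\<Phi> q) \<le> sqrt \<bar>((fst p)\<^sup>2 + 4 * \<bar>snd p\<bar>) - ((fst q)\<^sup>2 + 4 * \<bar>snd q\<bar>)\<bar>"
    unfolding \<Phi>_def case_prod_beta dist_real_def by (rule abs_sqrt_diff_le) auto
  also have "\<dots> \<le> sqrt (6 * dist p q)" using \<Phi>_radicand_diff[OF b] by simp
  finally show "dist (\<Phi> p) (\<Phi> q) \<le> sqrt 6 * dist p q powr (1 / 2)"
    by (simp add: real_sqrt_mult powr_half_sqrt)
qed

lemma \<Phi>_not_lipschitz:
  assumes "0 < \<epsilon>"
  shows "\<not> (\<exists>L. L-lipschitz_on (ball (0, 0) \<epsilon>) \<Phi>)"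
proof
  assume "\<exists>L. L-lipschitz_on (ball (0, 0) \<epsilon>) \<Phi>"
  then obtain L where L: "L-lipschitz_on (ball (0, 0) \<epsilon>) \<Phi>" by blast
  \<comment> \<open>\<open>M > 1 / sqrt \<epsilon>\<close> puts \<open>(0, z)\<close> into the ball.
    The difference quotient between \<open>(0, z)\<close> and the origin is
    \<open>(2 / M) / (1 / M^2) = 2 * M\<close>, which exceeds \<open>L\<close>.\<close>
  define M where "M = \<bar>L\<bar> + 1 / sqrt \<epsilon> + 1"
  define z where "z = (1 / M)\<^sup>2"
  have "0 < 1 / sqrt \<epsilon>" using assms by simp
  then have M: "0 < M" "1 / sqrt \<epsilon> < M" "\<bar>L\<bar> < M" unfolding M_def by linarith+
  have z: "0 < z" "sqrt z = 1 / M" using M(1) by (simp_all add: z_def)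
  have "1 / M < sqrt \<epsilon>" using M(1,2) assms by (simp add: field_simps)
  then have "z < \<epsilon>" using z by (metis real_sqrt_less_iff)
  then have in_ball: "(0, z) \<in> ball (0, 0) \<epsilon>" "(0, 0) \<in> ball (0, 0) \<epsilon>"
    using z assms by (auto simp: dist_Pair_Pair)
  have "\<Phi> (0, z) = 2 * (1 / M)" using z by (simp add: \<Phi>_apply real_sqrt_mult)
  then have "2 * (1 / M) \<le> L * z"
    using lipschitz_onD[OF L in_ball] z M(1) by (simp add: dist_Pair_Pair dist_real_def \<Phi>_apply[of 0 0])
  then have "2 * M \<le> L" using M(1) by (simp add: z_def power2_eq_square field_simps)
  with M show False by linarith
qed

section \<open>Flows of affine vector fields\<close>

text \<open>Gronwall's argument: Cauchy-Schwarz and the bound \<open>K\<close> of \<open>A\<close>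
  make the squared norm times \<open>exp (- 2 * K * t)\<close> nonincreasing, and it starts at
  0.\<close>

lemma linear_ODE_zero_forward:
  fixes d :: "real \<Rightarrow> 'a::real_inner"
  assumes A: "bounded_linear A" and d: "\<And>t. (d has_vector_derivative A (d t)) (at t)"
    and "d 0 = 0" "0 \<le> s"
  shows "d s = 0"
proof -
  obtain K where K: "\<And>v. norm (A v) \<le> norm v * K" using A bounded_linear.bounded by metis
  define g where "g t = (d t \<bullet> d t) * exp (- 2 * K * t)" for t
  have g': "(g has_real_derivative (2 * (d t \<bullet> A (d t)) - 2 * K * (d t \<bullet> d t)) * exp (- 2 * K * t)) (at t)" for t
  proof -
    have "((\<lambda>t. d t \<bullet> d t) has_derivative (\<lambda>h. d t \<bullet> (h *\<^sub>R A (d t)) + (h *\<^sub>R A (d t)) \<bullet> d t)) (at t)"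
      using d[of t] unfolding has_vector_derivative_def by (intro has_derivative_inner)
    then have "((\<lambda>t. d t \<bullet> d t) has_real_derivative 2 * (d t \<bullet> A (d t))) (at t)"
      unfolding has_field_derivative_def
      by (rule has_derivative_eq_rhs) (auto simp: inner_commute)
    then show ?thesis unfolding g_def
      by (auto intro!: derivative_eq_intros simp: algebra_simps)
  qed
  have "g s \<le> g 0"
  proof (rule DERIV_nonpos_imp_nonincreasing[OF \<open>0 \<le> s\<close>])
    fix t
    have "d t \<bullet> A (d t) \<le> norm (d t) * norm (A (d t))" by (rule norm_cauchy_schwarz)
    also have "\<dots> \<le> norm (d t) * (norm (d t) * K)" by (intro mult_left_mono K) simp
    also have "\<dots> = K * (d t \<bullet> d t)"
      by (simp add: dot_square_norm power2_eq_square algebra_simps)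
    finally show "\<exists>y. (g has_real_derivative y) (at t) \<and> y \<le> 0"
      using g'[of t] by (intro exI conjI) (auto simp: mult_le_0_iff)
  qed
  then have "d s \<bullet> d s \<le> 0" using \<open>d 0 = 0\<close> by (simp add: g_def mult_le_0_iff)
  then show "d s = 0" using inner_ge_zero[of "d s"] by (metis inner_eq_zero_iff order_antisym)
qed

lemma linear_ODE_zero:
  fixes d :: "real \<Rightarrow> 'a::real_inner"
  assumes A: "bounded_linear A" and d: "\<And>t. (d has_vector_derivative A (d t)) (at t)"
    and "d 0 = 0"
  shows "d s = 0"
proof (cases "0 \<le> s")
  case True
  then show ?thesis using linear_ODE_zero_forward[OF A d] assms(3) by blast
next
  case False
  \<comment> \<open>Negative times are reached by reversing time, which replaces \<open>A\<close> by
    its negative.\<close>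
  have d': "((\<lambda>t. d (- t)) has_vector_derivative - A (d (- t))) (at t)" for t
  proof -
    have "((d \<circ> uminus) has_vector_derivative (- 1) *\<^sub>R A (d (- t))) (at t)"
      by (rule vector_diff_chain_at) (auto intro!: derivative_eq_intros d)
    then show ?thesis by (simp add: o_def)
  qed
  have "d (- 0) = 0" "0 \<le> - s" using False assms(3) by simp_all
  from linear_ODE_zero_forward[where d="\<lambda>t. d (- t)", OF bounded_linear_minus[OF A] d' this]
  show ?thesis by simp
qed

text \<open>The definite description requires uniqueness. The difference of two integral curves of a
  field with linear part \<open>A\<close> solves the linear equation with zero initial
  value.\<close>

lemma flow_eqI:
  fixes c :: "real \<Rightarrow> 'a::real_inner"
  assumes A: "bounded_linear A" and V: "\<And>p q. V p - V q = A (p - q)"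
    and c: "c 0 = p" "\<And>t. (c has_vector_derivative V (c t)) (at t)"
  shows "flow V s p = c s"
  unfolding flow_def
proof (rule the_equality)
  show "\<exists>g. g 0 = p \<and> (\<forall>t. (g has_vector_derivative V (g t)) (at t)) \<and> g s = c s" using c by blast
  fix q assume "\<exists>g. g 0 = p \<and> (\<forall>t. (g has_vector_derivative V (g t)) (at t)) \<and> g s = q"
  then obtain g where g: "g 0 = p" "\<And>t. (g has_vector_derivative V (g t)) (at t)" "g s = q"
    by blast
  have "g s - c s = 0"
  proof (rule linear_ODE_zero[OF A, where d="\<lambda>t. g t - c t"])
    show "((\<lambda>t. g t - c t) has_vector_derivative A (g t - c t)) (at t)" for t
      using has_vector_derivative_diff[OF g(2) c(2)] by (simp add: V)
  qed (simp add: g c)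
  then show "q = c s" using g(3) by simp
qed

lemma has_vector_derivative_triple:
  assumes "(f has_real_derivative f') (at t within S)" "(g has_real_derivative g') (at t within S)"
    "(h has_real_derivative h') (at t within S)"
  shows "((\<lambda>t. (f t, g t, h t)) has_vector_derivative (f', g', h')) (at t within S)"
  using assms unfolding has_real_derivative_iff_has_vector_derivative
  by (intro has_vector_derivative_Pair)

text \<open>Along \<open>Xplus\<close> the null coordinate \<open>x - y\<close> is constant, hence
  so is the vertical speed \<open>(x - y) / 2\<close>; for \<open>Xminus\<close> the same holds with
  \<open>x + y\<close> and a minus sign.\<close>

lemma flow_Xplus: "flow Xplus s (x, y, z) = (x + s, y + s, z + s * (x - y) / 2)"
proof -
  let ?c = "\<lambda>s. (x + s, y + s, z + s * (x - y) / 2)"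
  have bl: "bounded_linear (\<lambda>(x :: real, y :: real, z :: real). (0 :: real, 0 :: real, (x - y) * (1 / 2)))"
    unfolding case_prod_beta by (intro bounded_linear_intros)
  show ?thesis
  proof (rule flow_eqI[OF bl, of _ ?c])
    show "Xplus p - Xplus q = (case p - q of (x, y, z) \<Rightarrow> (0, 0, (x - y) * (1 / 2)))" for p q
      by (cases p; cases q) (simp add: Xplus_def X1_def X2_def field_simps)
    show "(?c has_vector_derivative Xplus (?c t)) (at t)" for t
      by (simp add: Xplus_def X1_def X2_def)
        (auto intro!: has_vector_derivative_triple derivative_eq_intros simp: field_simps)
  qed simp
qed

lemma flow_Xminus: "flow Xminus s (x, y, z) = (x + s, y - s, z - s * (x + y) / 2)"
proof -
  let ?c = "\<lambda>s. (x + s, y - s, z - s * (x + y) / 2)"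
  have bl: "bounded_linear (\<lambda>(x :: real, y :: real, z :: real). (0 :: real, 0 :: real, (x + y) * (- 1 / 2)))"
    unfolding case_prod_beta by (intro bounded_linear_intros)
  show ?thesis
  proof (rule flow_eqI[OF bl, of _ ?c])
    show "Xminus p - Xminus q = (case p - q of (x, y, z) \<Rightarrow> (0, 0, (x + y) * (- 1 / 2)))" for p q
      by (cases p; cases q) (simp add: Xminus_def X1_def X2_def field_simps)
    show "(?c has_vector_derivative Xminus (?c t)) (at t)" for t
      by (simp add: Xminus_def X1_def X2_def)
        (auto intro!: has_vector_derivative_triple derivative_eq_intros simp: field_simps)
  qed simp
qed

lemma flow_Y: "flow Y s (x, y, z) = (x * exp s, y * exp s, z * exp (2 * s))"
proof -
  let ?c = "\<lambda>s. (x * exp s, y * exp s, z * exp (2 * s))"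
  have bl: "bounded_linear (\<lambda>(x :: real, y :: real, z :: real). (x, y, z * 2))"
    unfolding case_prod_beta by (intro bounded_linear_intros)
  show ?thesis
  proof (rule flow_eqI[OF bl, of _ ?c])
    show "Y p - Y q = (case p - q of (x, y, z) \<Rightarrow> (x, y, z * 2))" for p q
      by (cases p; cases q) (simp add: Y_def)
    show "(?c has_vector_derivative Y (?c t)) (at t)" for t
      unfolding Y_def prod.case
      by (rule has_vector_derivative_triple) (auto intro!: derivative_eq_intros)
  qed simp
qed

lemma flow_X0: "flow X0 s (x, y, z) = (x * cosh s + y * sinh s, x * sinh s + y * cosh s, z)"
proof -
  let ?c = "\<lambda>s. (x * cosh s + y * sinh s, x * sinh s + y * cosh s, z)"
  have bl: "bounded_linear (\<lambda>(x :: real, y :: real, z :: real). (y, x, 0 :: real))"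
    unfolding case_prod_beta by (intro bounded_linear_intros)
  show ?thesis
  proof (rule flow_eqI[OF bl, of _ ?c])
    show "X0 p - X0 q = (case p - q of (x, y, z) \<Rightarrow> (y, x, 0))" for p q
      by (cases p; cases q) (simp add: X0_def)
    show "(?c has_vector_derivative X0 (?c t)) (at t)" for t
      unfolding X0_def prod.case
      by (rule has_vector_derivative_triple) (auto intro!: derivative_eq_intros)
  qed simp
qed

section \<open>Broken lightlike trajectories\<close>

text \<open>Transfers to the broken trajectories the horizontality already established for the
  explicit curves.\<close>

lemma broken_curve_eq_two_piece_curve:
  "broken_curve Xplus Xminus q0 \<tau> = two_piece_curve (1, 1) (1, -1) \<tau>"
  "broken_curve Xminus Xplus q0 \<tau> = two_piece_curve (1, -1) (1, 1) \<tau>"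
  by (rule ext; simp add: broken_curve_def q0_def flow_Xplus flow_Xminus two_piece_curve_apply)+

lemma lightlike_two_piece_curve:
  assumes "0 \<le> T" "0 < fst v" "\<bar>snd v\<bar> = fst v" "0 < fst w" "\<bar>snd w\<bar> = fst w"
  shows "lightlike T (two_piece_curve v w \<tau>)"
  unfolding lightlike_def
  by (rule exI, rule exI, rule conjI[OF horizontal_two_piece_curve[OF assms(1)]]) (use assms in auto)

lemma flow_edges:
  "flow Xminus \<tau>2 (flow Xplus \<tau>1 q0) = (\<tau>1 + \<tau>2, \<tau>1 - \<tau>2, - \<tau>1 * \<tau>2)"
  "flow Xplus \<tau>2 (flow Xminus \<tau>1 q0) = (\<tau>1 + \<tau>2, \<tau>2 - \<tau>1, \<tau>1 * \<tau>2)"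
  by (simp_all add: q0_def flow_Xplus flow_Xminus)

text \<open>The edge times are half the null coordinates, \<open>(x + y) / 2\<close> along
  \<open>Xplus\<close> and \<open>(x - y) / 2\<close> along \<open>Xminus\<close>. Their product is
  \<open>\<bar>z\<bar>\<close>, and the sign of \<open>z\<close> decides which edge comes
  first.\<close>

lemma zero_sphere_eq_edges:
  "zero_sphere = {flow Xminus \<tau>2 (flow Xplus \<tau>1 q0) | \<tau>1 \<tau>2. \<tau>1 \<ge> 0 \<and> \<tau>2 \<ge> 0} \<union>
     {flow Xplus \<tau>2 (flow Xminus \<tau>1 q0) | \<tau>1 \<tau>2. \<tau>1 \<ge> 0 \<and> \<tau>2 \<ge> 0}" (is "_ = ?E")
proof
  show "?E \<subseteq> zero_sphere"
    unfolding flow_edges zero_sphere_eq by (auto simp: power2_eq_square algebra_simps abs_mult)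
  show "zero_sphere \<subseteq> ?E"
  proof clarify
    fix x y z assume S: "(x, y, z) \<in> zero_sphere"
      and nE: "\<nexists>\<tau>1 \<tau>2. (x, y, z) = flow Xplus \<tau>2 (flow Xminus \<tau>1 q0) \<and> \<tau>1 \<ge> 0 \<and> \<tau>2 \<ge> 0"
    have nn: "0 \<le> (x + y) / 2" "0 \<le> (x - y) / 2" using zero_sphereD(1,2)[OF S] by auto
    have prod: "(x + y) / 2 * ((x - y) / 2) = \<bar>z\<bar>" using zero_sphereD(3)[OF S] by simp
    have s: "(x + y) / 2 + (x - y) / 2 = x" "(x + y) / 2 - (x - y) / 2 = y" by (simp_all add: field_simps)
    show "\<exists>\<tau>1 \<tau>2. (x, y, z) = flow Xminus \<tau>2 (flow Xplus \<tau>1 q0) \<and> \<tau>1 \<ge> 0 \<and> \<tau>2 \<ge> 0"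
    proof (cases "z \<le> 0")
      case True
      then have "- ((x + y) / 2) * ((x - y) / 2) = z" using prod by simp
      then have "(x, y, z) = flow Xminus ((x - y) / 2) (flow Xplus ((x + y) / 2) q0)"
        using s unfolding flow_edges by simp
      then show ?thesis using nn by blast
    next
      case False
      then have "(x - y) / 2 * ((x + y) / 2) = z" using prod by (simp add: mult.commute)
      then have "(x, y, z) = flow Xplus ((x + y) / 2) (flow Xminus ((x - y) / 2) q0)"
        using s unfolding flow_edges by (simp add: add.commute)
      then show ?thesis using nE nn by blast
    qed
  qed
qed

text \<open>An intermediate point of a broken curve is the end point of a shorter one, possibly with
  a second edge of length 0, so the end points already fill the sphere.\<close>

lemma zero_sphere_eq_broken_curves:
  "zero_sphere = (\<Union>\<tau>1\<in>{0..}. \<Union>\<tau>2\<in>{0..}. broken_curve Xplus Xminus q0 \<tau>1 ` {0..\<tau>1 + \<tau>2} \<union>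
                                    broken_curve Xminus Xplus q0 \<tau>1 ` {0..\<tau>1 + \<tau>2})" (is "_ = ?B")
proof
  have zero: "flow Xminus 0 (flow Xplus t q0) = flow Xplus t q0"
    "flow Xplus 0 (flow Xminus t q0) = flow Xminus t q0" for t
    by (simp_all add: q0_def flow_Xplus flow_Xminus)
  have edge: "flow Xminus s (flow Xplus t q0) \<in> zero_sphere"
    "flow Xplus s (flow Xminus t q0) \<in> zero_sphere" if "0 \<le> t" "0 \<le> s" for t s
    using that by (subst zero_sphere_eq_edges, blast)+
  show "?B \<subseteq> zero_sphere"
  proof clarify
    fix \<tau>1 \<tau>2 x y z :: real
    assume t: "0 \<le> \<tau>1" "0 \<le> \<tau>2"
      and mem: "(x, y, z) \<in> broken_curve Xplus Xminus q0 \<tau>1 ` {0..\<tau>1 + \<tau>2} \<union>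
                 broken_curve Xminus Xplus q0 \<tau>1 ` {0..\<tau>1 + \<tau>2}"
    have "broken_curve Xplus Xminus q0 \<tau>1 u \<in> zero_sphere"
      "broken_curve Xminus Xplus q0 \<tau>1 u \<in> zero_sphere" if "0 \<le> u" for u
      using edge[of u 0] edge[of \<tau>1 "u - \<tau>1"] that t by (auto simp: broken_curve_def zero)
    then show "(x, y, z) \<in> zero_sphere" using mem by fastforce
  qed
  \<comment> \<open>For \<open>\<tau>2 = 0\<close> the definition of \<open>broken_curve\<close>
    takes its first branch, so the flow for time 0 has to be removed separately.\<close>
  have end_point: "flow Xminus \<tau>2 (flow Xplus \<tau>1 q0) = broken_curve Xplus Xminus q0 \<tau>1 (\<tau>1 + \<tau>2)"
    "flow Xplus \<tau>2 (flow Xminus \<tau>1 q0) = broken_curve Xminus Xplus q0 \<tau>1 (\<tau>1 + \<tau>2)"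
    if "0 \<le> \<tau>1" "0 \<le> \<tau>2" for \<tau>1 \<tau>2
    using that by (cases "\<tau>2 = 0"; simp add: broken_curve_def zero)+
  show "zero_sphere \<subseteq> ?B"
  proof
    fix q assume "q \<in> zero_sphere"
    then obtain \<tau>1 \<tau>2 where t: "0 \<le> \<tau>1" "0 \<le> \<tau>2"
      and "q = flow Xminus \<tau>2 (flow Xplus \<tau>1 q0) \<or> q = flow Xplus \<tau>2 (flow Xminus \<tau>1 q0)"
      by (subst (asm) zero_sphere_eq_edges) blast
    then have "q = broken_curve Xplus Xminus q0 \<tau>1 (\<tau>1 + \<tau>2) \<or>
        q = broken_curve Xminus Xplus q0 \<tau>1 (\<tau>1 + \<tau>2)"
      using end_point by metis
    moreover have "\<tau>1 + \<tau>2 \<in> {0..\<tau>1 + \<tau>2}" using t by simp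
    ultimately have "q \<in> broken_curve Xplus Xminus q0 \<tau>1 ` {0..\<tau>1 + \<tau>2} \<union>
                 broken_curve Xminus Xplus q0 \<tau>1 ` {0..\<tau>1 + \<tau>2}" by blast
    then show "q \<in> ?B" using t by blast
  qed
qed

section \<open>Algebraic description and plane sections\<close>

text \<open>Squaring \<open>x^2 - y^2 = 4 * \<bar>z\<bar>\<close> loses only the sign of the left
  side, which the added inequality restores.\<close>

lemma zero_sphere_eq_algebraic:
  "zero_sphere = {(x, y, z). 16 * z\<^sup>2 = (x\<^sup>2 - y\<^sup>2)\<^sup>2 \<and> x\<^sup>2 - y\<^sup>2 \<ge> 0 \<and> x \<ge> 0}"
proof -
  have "D = 4 * \<bar>z\<bar> \<longleftrightarrow> 16 * z\<^sup>2 = D\<^sup>2 \<and> 0 \<le> D" for D z :: real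
  proof
    assume "16 * z\<^sup>2 = D\<^sup>2 \<and> 0 \<le> D"
    then have "(4 * \<bar>z\<bar>)\<^sup>2 = D\<^sup>2" "0 \<le> D" by (simp_all add: power_mult_distrib)
    then show "D = 4 * \<bar>z\<bar>" by (metis abs_ge_zero mult_nonneg_nonneg power2_eq_iff_nonneg zero_le_numeral)
  qed (auto simp: power_mult_distrib)
  then show ?thesis unfolding zero_sphere_eq by auto
qed

lemma semialgebraic_zero_sphere: "semialgebraic zero_sphere"
proof -
  have lin: "real_polynomial_function (\<lambda>q :: point. fst q)"
    "real_polynomial_function (\<lambda>q :: point. fst (snd q))"
    "real_polynomial_function (\<lambda>q :: point. snd (snd q))"
    by (auto intro!: real_polynomial_function.intros(1) bounded_linear_intros)
  note poly = real_polynomial_function_diff real_polynomial_function.intros(2,3,4)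
    real_polynomial_function_power real_polynomial_function_minus lin
  \<comment> \<open>The generators are equations and strict inequalities, so each weak inequality is
    written as the complement of the reversed strict one.\<close>
  have eq: "zero_sphere =
      {q. 16 * (snd (snd q))\<^sup>2 - ((fst q)\<^sup>2 - (fst (snd q))\<^sup>2)\<^sup>2 = 0} \<inter>
      (- {q. (fst (snd q))\<^sup>2 - (fst q)\<^sup>2 > 0} \<inter> - {q. - fst q > 0})"
    unfolding zero_sphere_eq_algebraic by auto
  show ?thesis unfolding eq
    by (intro semialgebraic.inter semialgebraic.compl semialgebraic.eq semialgebraic.pos poly)
qed

text \<open>Being a branch is expressed as being a connected component of the full hyperbola. The
  section is connected as a graph over \<open>y\<close>, and a larger connected subset would have to
  cross \<open>x = 0\<close>, where the hyperbola has no points.\<close>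

lemma zero_sphere_section_const:
  assumes "c \<noteq> 0"
  shows "zero_sphere \<inter> {(x, y, z). z = c} = {(x, y, z). x\<^sup>2 - y\<^sup>2 = 4 * \<bar>z\<bar> \<and> x > 0 \<and> z = c}"
    and "zero_sphere \<inter> {(x, y, z). z = c} \<in> components {(x, y, z). x\<^sup>2 - y\<^sup>2 = 4 * \<bar>z\<bar> \<and> z = c}"
proof -
  have x0: "x \<noteq> 0" if "x\<^sup>2 - y\<^sup>2 = 4 * \<bar>c\<bar>" for x y :: real
  proof
    assume "x = 0"
    then have "- (y\<^sup>2) = 4 * \<bar>c\<bar>" using that by simp
    moreover have "0 \<le> y\<^sup>2" "0 < \<bar>c\<bar>" using assms by simp_all
    ultimately show False by linarith
  qed
  show eq: "zero_sphere \<inter> {(x, y, z). z = c} = {(x, y, z). x\<^sup>2 - y\<^sup>2 = 4 * \<bar>z\<bar> \<and> x > 0 \<and> z = c}"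
    unfolding zero_sphere_eq using x0 by (auto simp: less_le)
  let ?S = "zero_sphere \<inter> {(x, y, z). z = c}" and ?H = "{(x, y, z). x\<^sup>2 - y\<^sup>2 = 4 * \<bar>z\<bar> \<and> z = c}"
  have img: "?S = range (\<lambda>y. (\<Phi> (y, c), y, c))"
    unfolding zero_sphere_eq_graph by auto
  show "?S \<in> components ?H"
    unfolding in_components_maximal
  proof (intro conjI allI impI)
    show "?S \<noteq> {}" unfolding img by simp
    show "?S \<subseteq> ?H" unfolding eq by auto
    show "connected ?S" unfolding img
      by (intro connected_continuous_image continuous_intros
          continuous_on_compose2[OF continuous_on_\<Phi>[of UNIV]]) auto
    fix D assume D: "D \<noteq> {} \<and> ?S \<subseteq> D \<and> D \<subseteq> ?H \<and> connected D"
    have "D \<subseteq> ?S"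
    proof
      fix q assume q: "q \<in> D"
      have "connected (fst ` D)"
        using D by (intro connected_continuous_image continuous_on_fst continuous_on_id) auto
      moreover have "\<Phi> (0, c) \<in> fst ` D" using D unfolding img by force
      moreover have "0 \<notin> fst ` D" using D x0 by force
      moreover have "fst q \<in> fst ` D" using q by simp
      ultimately have "\<not> fst q \<le> 0"
        using connectedD_interval[of "fst ` D" "fst q" "\<Phi> (0, c)" 0] \<Phi>_nonneg[of "(0, c)"] by blast
      moreover have "q \<in> ?H" using q D by blast
      ultimately show "q \<in> ?S" unfolding eq by (cases q) simp
    qed
    with D show "D = ?S" by blast
  qed
qed

lemma zero_sphere_section_zero: "zero_sphere \<inter> {(x, y, z). z = 0} = {(x, y, z). x = \<bar>y\<bar> \<and> z = 0}"
  by (auto simp: zero_sphere_eq_graph \<Phi>_apply)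

lemma zero_sphere_section_slope:
  assumes "-1 < k" "k < (1 :: real)"
  shows "zero_sphere \<inter> {(x, y, z). y = k * x} =
           {(x, y, z). 4 * z = (1 - k\<^sup>2) * x\<^sup>2 \<and> x \<ge> 0 \<and> y = k * x} \<union>
           {(x, y, z). 4 * z = - (1 - k\<^sup>2) * x\<^sup>2 \<and> x \<ge> 0 \<and> y = k * x}"
proof -
  have "k\<^sup>2 \<le> 1" using assms by (simp add: abs_square_le_1)
  have "x\<^sup>2 - (k * x)\<^sup>2 = 4 * \<bar>z\<bar> \<longleftrightarrow> 4 * z = (1 - k\<^sup>2) * x\<^sup>2 \<or> 4 * z = - (1 - k\<^sup>2) * x\<^sup>2" for x z
  proof -
    have "x\<^sup>2 - (k * x)\<^sup>2 = (1 - k\<^sup>2) * x\<^sup>2" by (simp add: power_mult_distrib algebra_simps)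
    moreover have "0 \<le> (1 - k\<^sup>2) * x\<^sup>2" using \<open>k\<^sup>2 \<le> 1\<close> by simp
    moreover have "- (1 - k\<^sup>2) * x\<^sup>2 = - ((1 - k\<^sup>2) * x\<^sup>2)" by (simp add: algebra_simps)
    ultimately show ?thesis by linarith
  qed
  then show ?thesis unfolding zero_sphere_eq by auto
qed

lemma zero_sphere_section_diagonal:
  "zero_sphere \<inter> {(x, y, z). y = x} = {(x, y, z). y = x \<and> x \<ge> 0 \<and> z = 0}"
  "zero_sphere \<inter> {(x, y, z). y = - x} = {(x, y, z). y = - x \<and> x \<ge> 0 \<and> z = 0}"
  unfolding zero_sphere_eq by auto

section \<open>Analyticity of \<open>\<Phi>\<close>\<close>

text \<open>Multiplication of a double power series by its first variable, on the level of
  coefficients; \<open>shift_snd\<close> does the same for the second variable.\<close>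

definition shift_fst :: "(nat \<Rightarrow> nat \<Rightarrow> real) \<Rightarrow> nat \<Rightarrow> nat \<Rightarrow> real" where
  "shift_fst A i j = (case i of 0 \<Rightarrow> 0 | Suc i' \<Rightarrow> A i' j)"

definition shift_snd :: "(nat \<Rightarrow> nat \<Rightarrow> real) \<Rightarrow> nat \<Rightarrow> nat \<Rightarrow> real" where
  "shift_snd A i j = (case j of 0 \<Rightarrow> 0 | Suc j' \<Rightarrow> A i j')"

text \<open>Reindex along \<open>(i, j)\<close> to \<open>(Suc i, j)\<close>; the indices that are
  missed carry coefficient 0.\<close>

lemma has_sum_shift_fst:
  assumes "((\<lambda>(i, j). A i j * h ^ i * k ^ j) has_sum S) UNIV"
  shows "((\<lambda>(i, j). shift_fst A i j * h ^ i * k ^ j) has_sum (h * S)) UNIV"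
proof -
  let ?m = "\<lambda>(i, j). (Suc i, j :: nat)" and ?f = "\<lambda>(i, j). shift_fst A i j * h ^ i * k ^ j"
  have "inj ?m" by (auto simp: inj_on_def)
  moreover have "((?f \<circ> ?m) has_sum (h * S)) UNIV"
    using has_sum_cmult_right[OF assms, of h]
    by (simp add: o_def case_prod_beta shift_fst_def mult_ac)
  ultimately have "(?f has_sum (h * S)) (range ?m)" by (simp add: has_sum_reindex)
  moreover have "?f p = 0" if "p \<notin> range ?m" for p
  proof -
    have "fst p = 0"
      using that by (cases p; cases "fst p") (auto simp: image_iff split: prod.splits)
    then show ?thesis by (simp add: case_prod_beta shift_fst_def)
  qed
  ultimately show ?thesis
    by (subst has_sum_cong_neutral[where S="range ?m" and f="?f", symmetric]) auto
qed

lemma has_sum_shift_snd: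
  assumes "((\<lambda>(i, j). A i j * h ^ i * k ^ j) has_sum S) UNIV"
  shows "((\<lambda>(i, j). shift_snd A i j * h ^ i * k ^ j) has_sum (k * S)) UNIV"
proof -
  let ?m = "\<lambda>(i :: nat, j). (i, Suc j)" and ?f = "\<lambda>(i, j). shift_snd A i j * h ^ i * k ^ j"
  have "inj ?m" by (auto simp: inj_on_def)
  moreover have "((?f \<circ> ?m) has_sum (k * S)) UNIV"
    using has_sum_cmult_right[OF assms, of k]
    by (simp add: o_def case_prod_beta shift_snd_def mult_ac)
  ultimately have "(?f has_sum (k * S)) (range ?m)" by (simp add: has_sum_reindex)
  moreover have "?f p = 0" if "p \<notin> range ?m" for p
  proof -
    have "snd p = 0"
      using that by (cases p; cases "snd p") (auto simp: image_iff split: prod.splits)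
    then show ?thesis by (simp add: case_prod_beta shift_snd_def)
  qed
  ultimately show ?thesis
    by (subst has_sum_cong_neutral[where S="range ?m" and f="?f", symmetric]) auto
qed

text \<open>The coefficient of \<open>h ^ i * k ^ j\<close> in \<open>(\<alpha> * h + h\<^sup>2 + \<beta> * k) ^ n\<close>.\<close>

primrec pow_coeff :: "real \<Rightarrow> real \<Rightarrow> nat \<Rightarrow> nat \<Rightarrow> nat \<Rightarrow> real" where
  "pow_coeff \<alpha> \<beta> 0 = (\<lambda>i j. if i = 0 \<and> j = 0 then 1 else 0)"
| "pow_coeff \<alpha> \<beta> (Suc n) = (\<lambda>i j. \<alpha> * shift_fst (pow_coeff \<alpha> \<beta> n) i j +
      shift_fst (shift_fst (pow_coeff \<alpha> \<beta> n)) i j + \<beta> * shift_snd (pow_coeff \<alpha> \<beta> n) i j)"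

lemma has_sum_pow_coeff:
  "((\<lambda>(i, j). pow_coeff \<alpha> \<beta> n i j * h ^ i * k ^ j) has_sum (\<alpha> * h + h\<^sup>2 + \<beta> * k) ^ n) UNIV"
proof (induction n)
  case 0
  let ?f = "\<lambda>(i, j). pow_coeff \<alpha> \<beta> 0 i j * h ^ i * k ^ j"
  have "(?f has_sum 1) {(0, 0)}"
    using has_sum_finite[of "{(0 :: nat, 0 :: nat)}" "?f"] by simp
  moreover have "?f p = 0" if "p \<noteq> (0, 0)" for p using that by (cases p) simp
  ultimately have "(?f has_sum 1) UNIV"
    by (subst has_sum_cong_neutral[where S="{(0, 0)}" and f="?f", symmetric]) auto
  then show ?case by (simp only: power_0)
next
  case (Suc n)
  let ?P = "pow_coeff \<alpha> \<beta> n" and ?w = "\<alpha> * h + h\<^sup>2 + \<beta> * k"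
  note 1 = has_sum_shift_fst[OF Suc.IH]
  note sums = has_sum_add[OF has_sum_add[OF has_sum_cmult_right[OF 1, of \<alpha>] has_sum_shift_fst[OF 1]]
      has_sum_cmult_right[OF has_sum_shift_snd[OF Suc.IH], of \<beta>]]
  then show ?case by (simp add: case_prod_unfold algebra_simps power2_eq_square)
qed

text \<open>Each coefficient is a polynomial in \<open>\<alpha>\<close> and \<open>\<beta>\<close>
  with nonnegative coefficients. This supplies the majorant for the absolute convergence of the
  rearranged series.\<close>

lemma abs_pow_coeff_le: "\<bar>pow_coeff \<alpha> \<beta> n i j\<bar> \<le> pow_coeff \<bar>\<alpha>\<bar> \<bar>\<beta>\<bar> n i j"
proof (induction n arbitrary: i j)
  case (Suc n)
  let ?P = "pow_coeff \<alpha> \<beta> n" and ?Q = "pow_coeff \<bar>\<alpha>\<bar> \<bar>\<beta>\<bar> n"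
  have 1: "\<bar>shift_fst ?P i j\<bar> \<le> shift_fst ?Q i j" for i j
    by (auto simp: shift_fst_def Suc split: nat.split)
  have 2: "\<bar>shift_fst (shift_fst ?P) i j\<bar> \<le> shift_fst (shift_fst ?Q) i j"
    using 1 by (auto simp: shift_fst_def[of "shift_fst _"] split: nat.split)
  have 3: "\<bar>shift_snd ?P i j\<bar> \<le> shift_snd ?Q i j"
    by (auto simp: shift_snd_def Suc split: nat.split)
  have "\<bar>pow_coeff \<alpha> \<beta> (Suc n) i j\<bar> \<le>
      \<bar>\<alpha>\<bar> * \<bar>shift_fst ?P i j\<bar> + \<bar>shift_fst (shift_fst ?P) i j\<bar> + \<bar>\<beta>\<bar> * \<bar>shift_snd ?P i j\<bar>"
    by (simp only: pow_coeff.simps abs_mult[symmetric])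
  also have "\<dots> \<le> \<bar>\<alpha>\<bar> * shift_fst ?Q i j + shift_fst (shift_fst ?Q) i j + \<bar>\<beta>\<bar> * shift_snd ?Q i j"
    using 1 2 3 by (intro add_mono mult_left_mono) auto
  finally show ?case by simp
qed auto

text \<open>Fubini for unconditional sums: the majorant \<open>v\<close> makes the family over all
  pairs \<open>(n, p)\<close> absolutely summable, so it may be summed over \<open>n\<close>
  first.\<close>

lemma has_sum_interchange:
  fixes u v :: "'a \<Rightarrow> 'b \<Rightarrow> real"
  assumes le: "\<And>n p. \<bar>u n p\<bar> \<le> v n p" and v: "\<And>n. (v n has_sum V n) UNIV" "V summable_on UNIV"
    and u: "\<And>n. (u n has_sum U n) UNIV" "(U has_sum S) UNIV"
  shows "(\<lambda>n. u n p) summable_on UNIV"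
    and "((\<lambda>p. infsum (\<lambda>n. u n p) UNIV) has_sum S) UNIV"
proof -
  have v0: "0 \<le> v n p" for n p using le[of n p] by linarith
  have "(\<lambda>(n, p). v n p) summable_on UNIV \<times> UNIV"
    by (rule summable_on_SigmaI[where g=V]) (use v v0 in auto)
  then have "(\<lambda>q. norm ((\<lambda>(n, p). u n p) q)) summable_on UNIV \<times> UNIV"
    by (rule summable_on_comparison_test) (use le in auto)
  then have "(\<lambda>(n, p). u n p) summable_on UNIV \<times> UNIV" by (rule abs_summable_summable)
  then have "((\<lambda>(n, p). u n p) has_sum S) (UNIV \<times> UNIV)"
    by (intro has_sum_SigmaI[where g=U]) (use u in auto)
  then have swapped: "((\<lambda>(p, n). u n p) has_sum S) (UNIV \<times> UNIV)"
    by (subst (asm) has_sum_swap) simp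
  then have "(\<lambda>(p, n). u n p) summable_on UNIV \<times> UNIV" by (rule has_sum_imp_summable)
  then show s: "(\<lambda>n. u n p) summable_on UNIV" for p
    using summable_on_SigmaD1[of "\<lambda>p n. u n p" UNIV "\<lambda>_. UNIV" p] by simp
  show "((\<lambda>p. infsum (\<lambda>n. u n p) UNIV) has_sum S) UNIV"
    by (rule has_sum_SigmaD[OF swapped]) (use s in auto)
qed

text \<open>Substitution of a quadratic polynomial into a power series: expand each power and
  collect equal monomials. Assumption \<open>R\<close> keeps the majorant polynomial, taken at
  \<open>\<bar>h\<bar>\<close> and \<open>\<bar>k\<bar>\<close>, inside the region of absolute
  convergence.\<close>

lemma real_power_series_of_polynomial:
  fixes g :: "nat \<Rightarrow> real"
  assumes g: "summable (\<lambda>n. \<bar>g n\<bar> * R ^ n)" and S: "\<And>w. \<bar>w\<bar> \<le> R \<Longrightarrow> (\<lambda>n. g n * w ^ n) sums f w"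
    and r: "0 < r"
    and R: "\<And>h k. \<bar>h\<bar> < r \<Longrightarrow> \<bar>k\<bar> < r \<Longrightarrow> \<bar>\<alpha>\<bar> * \<bar>h\<bar> + \<bar>h\<bar>\<^sup>2 + \<bar>\<beta>\<bar> * \<bar>k\<bar> \<le> R"
  shows "\<exists>C. \<forall>h k. \<bar>h\<bar> < r \<longrightarrow> \<bar>k\<bar> < r \<longrightarrow>
           ((\<lambda>(i, j). C i j * h ^ i * k ^ j) has_sum f (\<alpha> * h + h\<^sup>2 + \<beta> * k)) UNIV"
proof -
  define C where "C i j = infsum (\<lambda>n. g n * pow_coeff \<alpha> \<beta> n i j) UNIV" for i j
  have main: "(\<lambda>n. g n * (case p of (i, j) \<Rightarrow> pow_coeff \<alpha> \<beta> n i j * h ^ i * k ^ j)) summable_on UNIV"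
      (is "?su")
    "((\<lambda>p. infsum (\<lambda>n. g n * (case p of (i, j) \<Rightarrow> pow_coeff \<alpha> \<beta> n i j * h ^ i * k ^ j)) UNIV)
       has_sum f (\<alpha> * h + h\<^sup>2 + \<beta> * k)) UNIV" (is "?hs")
    if hk: "\<bar>h\<bar> < r" "\<bar>k\<bar> < r" for h k p
  proof -
    let ?w = "\<alpha> * h + h\<^sup>2 + \<beta> * k" and ?W = "\<bar>\<alpha>\<bar> * \<bar>h\<bar> + \<bar>h\<bar>\<^sup>2 + \<bar>\<beta>\<bar> * \<bar>k\<bar>"
    let ?u = "\<lambda>n p. g n * (case p of (i, j) \<Rightarrow> pow_coeff \<alpha> \<beta> n i j * h ^ i * k ^ j)"
    let ?v = "\<lambda>n p. \<bar>g n\<bar> * (case p of (i, j) \<Rightarrow> pow_coeff \<bar>\<alpha>\<bar> \<bar>\<beta>\<bar> n i j * \<bar>h\<bar> ^ i * \<bar>k\<bar> ^ j)"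
    have W: "0 \<le> ?W" "?W \<le> R" using R[OF hk] by auto
    have "\<bar>?w\<bar> \<le> \<bar>\<alpha> * h\<bar> + \<bar>h\<^sup>2\<bar> + \<bar>\<beta> * k\<bar>" by linarith
    then have w: "\<bar>?w\<bar> \<le> ?W" by (simp add: abs_mult)
    have le: "\<bar>?u n p\<bar> \<le> ?v n p" for n p
      unfolding case_prod_beta abs_mult power_abs
      by (intro mult_left_mono mult_right_mono abs_pow_coeff_le) auto
    have sum_le: "summable (\<lambda>n. \<bar>g n\<bar> * x ^ n)" if "0 \<le> x" "x \<le> R" for x
      using that by (intro summable_comparison_test'[OF g, where N=0])
        (auto simp: abs_mult power_abs intro!: mult_left_mono power_mono)
    have V: "(\<lambda>n. \<bar>g n\<bar> * ?W ^ n) summable_on UNIV"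
      using sum_le[OF W] W(1) by (subst summable_on_UNIV_nonneg_real_iff) auto
    have U: "((\<lambda>n. g n * ?w ^ n) has_sum f ?w) UNIV"
    proof (rule norm_summable_imp_has_sum)
      show "summable (\<lambda>n. norm (g n * ?w ^ n))"
        using sum_le[of "\<bar>?w\<bar>"] w W by (simp add: abs_mult power_abs)
      show "(\<lambda>n. g n * ?w ^ n) sums f ?w" using w W by (intro S) auto
    qed
    have v: "(?v n has_sum (\<bar>g n\<bar> * ?W ^ n)) UNIV" for n
      by (rule has_sum_cmult_right[OF has_sum_pow_coeff])
    have u: "(?u n has_sum (g n * ?w ^ n)) UNIV" for n
      by (rule has_sum_cmult_right[OF has_sum_pow_coeff])
    note * = has_sum_interchange[where u="?u" and v="?v", OF le v V u U]
    show ?su by (rule *(1))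
    show ?hs by (rule *(2))
  qed
  have coeff: "(\<lambda>n. g n * pow_coeff \<alpha> \<beta> n i j) summable_on UNIV" for i j
  proof -
    \<comment> \<open>The coefficients must be summable independently of \<open>h\<close> and
      \<open>k\<close>; at \<open>h = k = r / 2\<close> the monomial \<open>d\<close> is nonzero and
      can be divided out.\<close>
    define d where "d = (r / 2) ^ i * (r / 2) ^ j"
    have "d \<noteq> 0" using r by (simp add: d_def)
    have "(\<lambda>n. g n * pow_coeff \<alpha> \<beta> n i j * d) summable_on UNIV"
      using main(1)[of "r / 2" "r / 2" "(i, j)"] r by (simp add: d_def mult_ac)
    then have "(\<lambda>n. g n * pow_coeff \<alpha> \<beta> n i j * d * inverse d) summable_on UNIV"
      by (rule summable_on_cmult_left)
    moreover have "x * d * inverse d = x" for x using \<open>d \<noteq> 0\<close> by simp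
    ultimately show ?thesis by simp
  qed
  show ?thesis
  proof (intro exI[of _ C] allI impI)
    fix h k assume hk: "\<bar>h\<bar> < r" "\<bar>k\<bar> < r"
    have "infsum (\<lambda>n. g n * (pow_coeff \<alpha> \<beta> n i j * h ^ i * k ^ j)) UNIV = C i j * h ^ i * k ^ j" for i j
    proof -
      have "((\<lambda>n. g n * pow_coeff \<alpha> \<beta> n i j * (h ^ i * k ^ j)) has_sum C i j * (h ^ i * k ^ j)) UNIV"
        unfolding C_def by (intro has_sum_cmult_left has_sum_infsum coeff)
      then show ?thesis by (intro infsumI) (simp add: mult_ac)
    qed
    then show "((\<lambda>(i, j). C i j * h ^ i * k ^ j) has_sum f (\<alpha> * h + h\<^sup>2 + \<beta> * k)) UNIV"
      using main(2)[OF hk] by (simp add: case_prod_unfold)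
  qed
qed

text \<open>Near \<open>(a, b)\<close> with \<open>b \<noteq> 0\<close> the absolute value is
  linear, so the radicand is \<open>c\<close> plus a quadratic polynomial in the increments, which
  is substituted into the binomial series of the square root at \<open>c\<close>.\<close>

lemma \<Phi>_real_analytic: "real_analytic2_on \<Phi> {(y, z). z \<noteq> 0}"
  unfolding real_analytic2_on_def
proof clarify
  fix a b :: real assume b: "b \<noteq> 0"
  define c \<alpha> \<beta> where "c = a\<^sup>2 + 4 * \<bar>b\<bar>" and "\<alpha> = 2 * a" and "\<beta> = 4 * sgn b"
  have c: "0 < c" using b unfolding c_def by (simp add: add_nonneg_pos)
  define M where "M = \<bar>\<alpha>\<bar> + 1 + \<bar>\<beta>\<bar>"
  \<comment> \<open>The bound \<open>\<bar>b\<bar>\<close> preserves the sign of the second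
    coordinate, 1 gives \<open>h^2 \<le> r\<close>, and \<open>c / 2 / M\<close> keeps the majorant
    polynomial below \<open>c / 2\<close>.\<close>
  define r where "r = min \<bar>b\<bar> (min 1 (c / 2 / M))"
  have M: "0 < M" by (simp add: M_def)
  have r: "0 < r" "r \<le> \<bar>b\<bar>" "r \<le> 1" "r \<le> c / 2 / M" using b c M by (auto simp: r_def)
  have rM: "M * r \<le> c / 2" using r(4) M unfolding pos_le_divide_eq[OF M] by (simp only: mult.commute)
  define g where "g n = (1/2 gchoose n) * c powr (1/2 - of_nat n)" for n
  have g: "(\<lambda>n. g n * w ^ n) sums sqrt (c + w)" if "\<bar>w\<bar> < c" for w
    using gen_binomial_real''[OF that, of "1/2"] that by (simp add: g_def powr_half_sqrt)
  have "\<exists>C. \<forall>h k. \<bar>h\<bar> < r \<longrightarrow> \<bar>k\<bar> < r \<longrightarrow>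
           ((\<lambda>(i, j). C i j * h ^ i * k ^ j) has_sum sqrt (c + (\<alpha> * h + h\<^sup>2 + \<beta> * k))) UNIV"
  proof (rule real_power_series_of_polynomial[of g "c / 2"])
    \<comment> \<open>Convergence at \<open>3 * c / 4\<close>, still inside the radius
      \<open>c\<close>, yields absolute convergence at the smaller point
      \<open>c / 2\<close>.\<close>
    have "summable (\<lambda>n. norm (g n * (c / 2) ^ n))"
      by (rule powser_insidea[where x="3 * c / 4"]) (use g[of "3 * c / 4"] c in \<open>auto simp: sums_iff\<close>)
    then show "summable (\<lambda>n. \<bar>g n\<bar> * (c / 2) ^ n)" using c by (simp add: abs_mult power_abs)
    show "(\<lambda>n. g n * w ^ n) sums sqrt (c + w)" if "\<bar>w\<bar> \<le> c / 2" for w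
      using that c by (intro g) linarith
    show "0 < r" by fact
    fix h k :: real assume hk: "\<bar>h\<bar> < r" "\<bar>k\<bar> < r"
    have "\<bar>h\<bar>\<^sup>2 \<le> 1 * r" unfolding power2_eq_square using hk r by (intro mult_mono) auto
    moreover have "\<bar>\<alpha>\<bar> * \<bar>h\<bar> \<le> \<bar>\<alpha>\<bar> * r" "\<bar>\<beta>\<bar> * \<bar>k\<bar> \<le> \<bar>\<beta>\<bar> * r"
      using hk by (auto intro!: mult_left_mono)
    moreover have "M * r = \<bar>\<alpha>\<bar> * r + 1 * r + \<bar>\<beta>\<bar> * r" by (simp add: M_def algebra_simps)
    ultimately show "\<bar>\<alpha>\<bar> * \<bar>h\<bar> + \<bar>h\<bar>\<^sup>2 + \<bar>\<beta>\<bar> * \<bar>k\<bar> \<le> c / 2" using rM by linarith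
  qed
  then obtain C where C: "\<And>h k. \<bar>h\<bar> < r \<Longrightarrow> \<bar>k\<bar> < r \<Longrightarrow>
           ((\<lambda>(i, j). C i j * h ^ i * k ^ j) has_sum sqrt (c + (\<alpha> * h + h\<^sup>2 + \<beta> * k))) UNIV"
    by blast
  have eq: "sqrt (c + (\<alpha> * h + h\<^sup>2 + \<beta> * k)) = \<Phi> (a + h, b + k)" if "\<bar>k\<bar> < r" for h k
  proof -
    have "\<bar>b + k\<bar> = \<bar>b\<bar> + sgn b * k" using that r(2) b by (cases "b > 0") auto
    then show ?thesis unfolding \<Phi>_apply c_def \<alpha>_def \<beta>_def
      by (simp add: power2_eq_square algebra_simps)
  qed
  show "\<exists>r>0. \<exists>C. \<forall>h k. \<bar>h\<bar> < r \<longrightarrow> \<bar>k\<bar> < r \<longrightarrow>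
        ((\<lambda>(i, j). C i j * h ^ i * k ^ j) has_sum \<Phi> (a + h, b + k)) UNIV"
    using C r(1) unfolding eq by (intro exI[of _ r] exI[of _ C] conjI allI impI) (simp_all add: eq)
qed

section \<open>Smooth maps\<close>

text \<open>The recursion of \<open>Ck_on\<close> asks the same question about all directional
  derivatives; for a family closed under them, the induction on the order runs simultaneously over
  its members.\<close>

lemma smooth_on_closed_family:
  fixes F :: "('a::real_normed_vector \<Rightarrow> 'b::real_normed_vector) set"
  assumes closed: "\<And>g. g \<in> F \<Longrightarrow>
      \<exists>g'. (\<forall>x. (g has_derivative g' x) (at x)) \<and> (\<forall>v. (\<lambda>x. g' x v) \<in> F)"
    and "f \<in> F"
  shows "smooth_on f S"
proof -
  have "Ck_on k g S" if "g \<in> F" for k g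
    using that
  proof (induction k arbitrary: g)
    case 0
    obtain g' where g': "\<And>x. (g has_derivative g' x) (at x)" using closed[OF 0] by blast
    show ?case
      by (simp add: continuous_at_imp_continuous_on has_derivative_continuous[OF g'])
  next
    case (Suc k)
    obtain g' where g': "\<And>x. (g has_derivative g' x) (at x)" and F: "\<And>v. (\<lambda>x. g' x v) \<in> F"
      using closed[OF Suc.prems] by blast
    have "frechet_derivative g (at x) = g' x" for x
      using frechet_derivative_at[OF g'] by simp
    then show ?case using g' F Suc.IH by (auto simp: differentiable_def)
  qed
  with \<open>f \<in> F\<close> show ?thesis by (simp add: smooth_on_def)
qed

section \<open>The action of the symmetries\<close>

text \<open>The two flows act diagonally in null coordinates, with factors
  \<open>exp (r + s)\<close> and \<open>exp (s - r)\<close>. All five coefficients are left free so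
  that directional derivatives stay of the same form.\<close>

definition symmetry_orbit :: "real \<Rightarrow> real \<Rightarrow> real \<Rightarrow> real \<Rightarrow> real \<Rightarrow> real \<times> real \<Rightarrow> point" where
  "symmetry_orbit a b a' b' c = (\<lambda>(r, s). (a * exp (r + s) + b * exp (s - r),
     a' * exp (r + s) + b' * exp (s - r), c * exp (2 * s)))"

lemma flow_Y_flow_X0:
  "flow Y s (flow X0 r (x, y, z)) =
     symmetry_orbit ((x + y) / 2) ((x - y) / 2) ((x + y) / 2) (- ((x - y) / 2)) z (r, s)"
proof -
  have "(x * cosh r + y * sinh r) * exp s = (x + y) / 2 * exp (r + s) + (x - y) / 2 * exp (s - r)"
    "(x * sinh r + y * cosh r) * exp s = (x + y) / 2 * exp (r + s) - (x - y) / 2 * exp (s - r)"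
    unfolding cosh_def sinh_def exp_add exp_diff exp_minus by (simp_all add: field_simps)
  then show ?thesis by (simp add: flow_X0 flow_Y symmetry_orbit_def)
qed

lemma symmetry_orbit_has_derivative:
  "(symmetry_orbit a b a' b' c has_derivative
     (\<lambda>v. symmetry_orbit (a * (fst v + snd v)) (b * (snd v - fst v)) (a' * (fst v + snd v))
            (b' * (snd v - fst v)) (c * (2 * snd v)) p)) (at p)"
  unfolding symmetry_orbit_def case_prod_beta
  by (auto intro!: derivative_eq_intros simp: algebra_simps)

lemma smooth_on_symmetry_orbit: "smooth_on (symmetry_orbit a b a' b' c) S"
proof (rule smooth_on_closed_family)
  let ?F = "{g. \<exists>a b a' b' c. g = symmetry_orbit a b a' b' c}"
  show "symmetry_orbit a b a' b' c \<in> ?F" by blast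
  fix g assume "g \<in> ?F"
  then obtain a b a' b' c where g: "g = symmetry_orbit a b a' b' c" by blast
  let ?g' = "\<lambda>p v. symmetry_orbit (a * (fst v + snd v)) (b * (snd v - fst v)) (a' * (fst v + snd v))
            (b' * (snd v - fst v)) (c * (2 * snd v)) p"
  show "\<exists>g'. (\<forall>x. (g has_derivative g' x) (at x)) \<and> (\<forall>v. (\<lambda>x. g' x v) \<in> ?F)"
  proof (intro exI[of _ ?g'] conjI allI)
    show "(g has_derivative ?g' x) (at x)" for x
      unfolding g by (rule symmetry_orbit_has_derivative)
    show "(\<lambda>x. ?g' x v) \<in> ?F" for v by blast
  qed
qed

text \<open>The product of the factors of the two null coordinates is \<open>exp (2 * s)\<close>,
  which is exactly the factor of \<open>z\<close>.\<close>

lemma symmetry_orbit_in_zero_sphere: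
  assumes "(x, y, z) \<in> zero_sphere"
  shows "symmetry_orbit ((x + y) / 2) ((x - y) / 2) ((x + y) / 2) (- ((x - y) / 2)) z p \<in> zero_sphere"
proof -
  obtain r s where p: "p = (r, s)" by (cases p)
  note n = zero_sphereD[OF assms]
  have "((x + y) * exp (r + s)) * ((x - y) * exp (s - r)) =
      ((x + y) * (x - y)) * (exp (r + s) * exp (s - r))" by (simp only: mult_ac)
  also have "exp (r + s) * exp (s - r) = exp (2 * s)" by (simp flip: exp_add)
  finally have "((x + y) * exp (r + s)) * ((x - y) * exp (s - r)) = 4 * \<bar>z * exp (2 * s)\<bar>"
    unfolding n(3) by (simp add: abs_mult)
  with n(1,2) show ?thesis unfolding p symmetry_orbit_def prod.case
    by (intro zero_sphereI) (simp_all flip: add_divide_distrib diff_divide_distrib)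
qed

lemma flow_Y_flow_X0_zero_sphere:
  assumes "q \<in> zero_sphere"
  shows "flow Y s (flow X0 r q) \<in> zero_sphere"
  using symmetry_orbit_in_zero_sphere assms by (cases q) (simp add: flow_Y_flow_X0)

lemma flow_Y_zero_sphere: "flow Y s ` zero_sphere = zero_sphere"
proof -
  have "flow X0 0 q = q" for q by (cases q) (simp add: flow_X0)
  then have *: "flow Y s q \<in> zero_sphere" if "q \<in> zero_sphere" for s q
    using flow_Y_flow_X0_zero_sphere[OF that, of s 0] by simp
  have "flow Y s (flow Y (- s) q) = q" for q by (cases q) (simp add: flow_Y flip: exp_add)
  then have "q \<in> flow Y s ` zero_sphere" if "q \<in> zero_sphere" for q
    using *[OF that, of "- s"] by (metis image_eqI)
  with * show ?thesis by blast
qed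

lemma flow_X0_zero_sphere: "flow X0 s ` zero_sphere = zero_sphere"
proof -
  have "flow Y 0 q = q" for q by (cases q) (simp add: flow_Y)
  then have *: "flow X0 s q \<in> zero_sphere" if "q \<in> zero_sphere" for s q
    using flow_Y_flow_X0_zero_sphere[OF that, of 0 s] by simp
  have "flow X0 s (flow X0 (- s) q) = q" for q
  proof (cases q)
    case (fields x y z)
    have "cosh s * cosh s = 1 + sinh s * sinh s"
      using hyperbolic_pythagoras[of s] by (simp add: power2_eq_square)
    then show ?thesis unfolding fields flow_X0 by (simp add: algebra_simps)
  qed
  then have "q \<in> flow X0 s ` zero_sphere" if "q \<in> zero_sphere" for q
    using *[OF that, of "- s"] by (metis image_eqI)
  with * show ?thesis by blast
qed

text \<open>The inverse of the parametrization reads \<open>r + s\<close> and \<open>s - r\<close> off the quotients of the null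
  coordinates of the two points.\<close>

lemma symmetry_orbit_homeomorphism:
  assumes q: "(x, y, z) \<in> zero_sphere" "sgn z = \<sigma>" "z \<noteq> 0"
  shows "homeomorphism UNIV (zero_sphere \<inter> {(x, y, z). sgn z = \<sigma>})
           (symmetry_orbit ((x + y) / 2) ((x - y) / 2) ((x + y) / 2) (- ((x - y) / 2)) z)
           (\<lambda>(x', y', z'). ((ln ((x' + y') / (x + y)) - ln ((x' - y') / (x - y))) / 2,
                            (ln ((x' + y') / (x + y)) + ln ((x' - y') / (x - y))) / 2))"
    (is "homeomorphism _ ?S ?f ?g")
proof -
  have pos: "0 < x + y \<and> 0 < x - y" if "(x, y, z) \<in> zero_sphere" "z \<noteq> 0" for x y z
  proof -
    have "(x + y) * (x - y) \<noteq> 0" using zero_sphereD(3)[OF that(1)] that(2) by simp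
    with zero_sphereD(1,2)[OF that(1)] show ?thesis by (auto simp: less_le)
  qed
  have xy: "0 < x + y" "0 < x - y" using pos[OF q(1,3)] by auto
  have sgn0: "\<sigma> \<noteq> 0" using q by (simp add: sgn_0_0 flip: q(2))
  have f_in: "?f p \<in> ?S" for p
  proof -
    have "?f p \<in> zero_sphere" by (rule symmetry_orbit_in_zero_sphere[OF q(1)])
    moreover have "sgn (snd (snd (?f p))) = \<sigma>"
      using q(2) by (simp add: symmetry_orbit_def case_prod_beta sgn_mult)
    ultimately show ?thesis by (simp add: case_prod_beta)
  qed
  have null: "fst (?f (r, s)) + fst (snd (?f (r, s))) = (x + y) * exp (r + s)"
    "fst (?f (r, s)) - fst (snd (?f (r, s))) = (x - y) * exp (s - r)" for r s
    by (simp_all add: symmetry_orbit_def)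
  have gf: "?g (?f p) = p" for p
  proof (cases p)
    case (Pair r s)
    show ?thesis unfolding Pair case_prod_beta null using xy by simp
  qed
  have fg: "?f (?g q') = q'" if q': "q' \<in> ?S" for q'
  proof -
    obtain x' y' z' where q'_def: "q' = (x', y', z')" by (cases q')
    have S: "(x', y', z') \<in> zero_sphere" "sgn z' = \<sigma>" "z' \<noteq> 0"
      using q' sgn0 by (auto simp: q'_def)
    have xy': "0 < x' + y'" "0 < x' - y'" using pos[OF S(1,3)] by auto
    obtain r s where g: "?g q' = (r, s)" by (cases "?g q'")
    have rs: "r + s = ln ((x' + y') / (x + y))" "s - r = ln ((x' - y') / (x - y))"
      using g by (auto simp: q'_def field_simps)
    have e: "exp (r + s) = (x' + y') / (x + y)" "exp (s - r) = (x' - y') / (x - y)"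
      unfolding rs using xy xy' by simp_all
    \<comment> \<open>The third coordinate needs no parameter of its own: the null coordinates
      determine \<open>\<bar>z'\<bar>\<close>, and its sign is prescribed by
      \<open>\<sigma>\<close>.\<close>
    have "exp (2 * s) = exp (r + s) * exp (s - r)" by (simp flip: exp_add)
    also have "\<dots> = ((x' + y') * (x' - y')) / ((x + y) * (x - y))" unfolding e by simp
    also have "\<dots> = \<bar>z'\<bar> / \<bar>z\<bar>"
      unfolding zero_sphereD(3)[OF S(1)] zero_sphereD(3)[OF q(1)] by simp
    finally have "z * exp (2 * s) = sgn z * \<bar>z'\<bar>" using q(3) by (simp add: sgn_div_norm divide_inverse)
    also have "\<dots> = z'" using S(2) q(2) by (metis mult.commute mult_sgn_abs)
    finally have 3: "z * exp (2 * s) = z'" .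
    have cancel: "u / 2 * (v / u) = v / 2" if "0 < u" for u v :: real using that by simp
    have "(x + y) / 2 * exp (r + s) = (x' + y') / 2" "(x - y) / 2 * exp (s - r) = (x' - y') / 2"
      unfolding e using cancel[of "x + y"] cancel[of "x - y"] xy by blast+
    then have "?f (r, s) = (x', y', z')"
      unfolding symmetry_orbit_def prod.case 3 by (simp add: field_simps)
    then show ?thesis unfolding g by (simp add: q'_def)
  qed
  show ?thesis unfolding homeomorphism_def
  proof (intro conjI ballI)
    show "range ?f = ?S"
    proof (intro equalityI image_subsetI subsetI)
      show "q' \<in> range ?f" if "q' \<in> ?S" for q'
        by (rule image_eqI[where f="?f" and x="?g q'"]) (simp_all only: fg[OF that] UNIV_I)
    qed (rule f_in)
    show "?g ` ?S = UNIV"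
    proof (intro equalityI subsetI)
      show "p \<in> ?g ` ?S" for p
        by (rule image_eqI[where f="?g" and x="?f p"]) (simp_all only: gf, rule f_in)
    qed simp
    show "continuous_on UNIV ?f"
      unfolding symmetry_orbit_def case_prod_beta by (intro continuous_intros)
    have "0 < fst q + fst (snd q)" "0 < fst q - fst (snd q)" if "q \<in> ?S" for q
      using that sgn0 pos[of "fst q" "fst (snd q)" "snd (snd q)"] by (auto simp: case_prod_beta sgn_eq_0_iff)
    then show "continuous_on ?S ?g"
      using xy unfolding case_prod_beta by (intro continuous_intros) (auto simp: less_imp_neq[THEN not_sym])
  qed (use fg gf in auto)
qed

lemma regular_parametrization_symmetry_orbit:
  assumes q: "q \<in> zero_sphere \<inter> {(x, y, z). sgn z = \<sigma>}" and "\<sigma> \<noteq> 0"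
  shows "regular_parametrization (\<lambda>(r, s). flow Y s (flow X0 r q)) UNIV
           (zero_sphere \<inter> {(x, y, z). sgn z = \<sigma>})"
    and "zero_sphere \<inter> {(x, y, z). sgn z = \<sigma>} = {flow Y s (flow X0 r q) | r s. True}"
proof -
  obtain x y z where xyz: "q = (x, y, z)" by (cases q)
  have S: "(x, y, z) \<in> zero_sphere" "sgn z = \<sigma>" "z \<noteq> 0"
    using q \<open>\<sigma> \<noteq> 0\<close> by (auto simp: xyz)
  let ?f = "symmetry_orbit ((x + y) / 2) ((x - y) / 2) ((x + y) / 2) (- ((x - y) / 2)) z"
  have f: "(\<lambda>(r, s). flow Y s (flow X0 r q)) = ?f"
    by (auto simp: xyz flow_Y_flow_X0)
  note hom = symmetry_orbit_homeomorphism[OF S]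
  have "x + y \<noteq> 0" using zero_sphereD(3)[OF S(1)] S(3) by auto
  have "inj (frechet_derivative ?f (at p))" for p
  proof -
    obtain r s where p: "p = (r, s)" by (cases p)
    have d: "frechet_derivative ?f (at p) = (\<lambda>v. symmetry_orbit ((x + y) / 2 * (fst v + snd v))
        ((x - y) / 2 * (snd v - fst v)) ((x + y) / 2 * (fst v + snd v))
        (- ((x - y) / 2) * (snd v - fst v)) (z * (2 * snd v)) p)"
      by (rule frechet_derivative_at[OF symmetry_orbit_has_derivative, symmetric])
    show ?thesis unfolding d
    proof (rule injI)
      fix v w :: "real \<times> real"
      assume "symmetry_orbit ((x + y) / 2 * (fst v + snd v))
        ((x - y) / 2 * (snd v - fst v)) ((x + y) / 2 * (fst v + snd v))
        (- ((x - y) / 2) * (snd v - fst v)) (z * (2 * snd v)) p =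
        symmetry_orbit ((x + y) / 2 * (fst w + snd w))
        ((x - y) / 2 * (snd w - fst w)) ((x + y) / 2 * (fst w + snd w))
        (- ((x - y) / 2) * (snd w - fst w)) (z * (2 * snd w)) p" (is "?l = ?r")
      \<comment> \<open>The sum of the first two components determines \<open>fst v + snd v\<close>,
        since \<open>x + y \<noteq> 0\<close>, and the third determines \<open>snd v\<close>, since
        \<open>z \<noteq> 0\<close>.\<close>
      then have "fst ?l + fst (snd ?l) = fst ?r + fst (snd ?r)" "snd (snd ?l) = snd (snd ?r)"
        by simp_all
      then have "(x + y) * ((fst v + snd v) * exp (r + s)) = (x + y) * ((fst w + snd w) * exp (r + s))"
        "z * (snd v * exp (2 * s)) = z * (snd w * exp (2 * s))"
        by (simp_all add: p symmetry_orbit_def algebra_simps)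
      then have "fst v + snd v = fst w + snd w" "snd v = snd w"
        using \<open>x + y \<noteq> 0\<close> S(3) by simp_all
      then show "v = w" by (simp add: prod_eq_iff)
    qed
  qed
  then show "regular_parametrization (\<lambda>(r, s). flow Y s (flow X0 r q)) UNIV
           (zero_sphere \<inter> {(x, y, z). sgn z = \<sigma>})"
    unfolding f regular_parametrization_def using hom smooth_on_symmetry_orbit by blast
  have range: "range (\<lambda>(r, s). F r s) = {F r s | r s. True}" for F :: "real \<Rightarrow> real \<Rightarrow> point"
  proof (intro equalityI subsetI)
    fix p assume "p \<in> {F r s | r s. True}"
    then obtain r s where p: "p = F r s" by blast
    show "p \<in> range (\<lambda>(r, s). F r s)" unfolding p by (rule image_eqI[of _ _ "(r, s)"]) simp_all
  qed auto
  have "zero_sphere \<inter> {(x, y, z). sgn z = \<sigma>} = range ?f"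
    using hom by (simp add: homeomorphism_def)
  also have "\<dots> = {flow Y s (flow X0 r q) | r s. True}"     unfolding f[symmetric] by (rule range)
  finally show "zero_sphere \<inter> {(x, y, z). sgn z = \<sigma>} = {flow Y s (flow X0 r q) | r s. True}" .
qed

section \<open>Whitney conditions\<close>

text \<open>By the chain rule along a curve in \<open>R\<close>, on which \<open>h\<close> is
  constant. This bounds tangent spaces from above by the kernels of differentials.\<close>

lemma tangent_space_annihilated:
  fixes h :: "'a::euclidean_space \<Rightarrow> real"
  assumes h: "\<And>q. q \<in> R \<Longrightarrow> h q = 0" and h': "(h has_derivative h') (at p)"
    and v: "v \<in> tangent_space R p"
  shows "h' v = 0"
proof -
  obtain \<gamma> \<epsilon> where e: "0 < \<epsilon>" and R: "\<gamma> ` {-\<epsilon><..<\<epsilon>} \<subseteq> R" and \<gamma>: "\<gamma> 0 = p"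
    "(\<gamma> has_vector_derivative v) (at 0)"
    using v unfolding tangent_space_def by blast
  have "(h has_derivative h') (at (\<gamma> 0))" using h' \<gamma>(1) by simp
  from diff_chain_at[OF \<gamma>(2)[unfolded has_vector_derivative_def] this]
  have "((\<lambda>t. h (\<gamma> t)) has_derivative (\<lambda>t. h' (t *\<^sub>R v))) (at 0)" by (simp add: o_def)
  moreover have "h' (t *\<^sub>R v) = h' v * t" for t
    using linear_cmul[OF has_derivative_linear[OF h'], of t v] by simp
  ultimately have d: "((\<lambda>t. h (\<gamma> t)) has_real_derivative h' v) (at 0)"
    by (simp add: has_field_derivative_def)
  have "\<forall>t. \<bar>0 - t\<bar> < \<epsilon> \<longrightarrow> h (\<gamma> 0) = h (\<gamma> t)"
    using R e h by (auto simp: image_subset_iff abs_less_iff)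
  from DERIV_local_const[OF d e this] show ?thesis .
qed

text \<open>Projection onto \<open>T n\<close> is 1-Lipschitz and fixes \<open>w n\<close>, so it
  moves \<open>v\<close> by at most twice the distance from \<open>w n\<close> to \<open>v\<close>.
  In the limit \<open>v\<close> is its own projection onto \<open>\<tau>\<close>.\<close>

lemma subspace_tendsto_contains_limit:
  fixes T :: "nat \<Rightarrow> 'a::euclidean_space set"
  assumes T: "subspace_tendsto T \<tau>" and w: "\<And>n. w n \<in> T n" "w \<longlonglongrightarrow> v"
  shows "v \<in> \<tau>"
proof -
  have sub: "subspace (T n)" "subspace \<tau>" and lim: "(\<lambda>n. closest_point (T n) v) \<longlonglongrightarrow> closest_point \<tau> v"
    for n using T by (auto simp: subspace_tendsto_def)
  have "norm (closest_point (T n) v - v) \<le> 2 * norm (w n - v)" for n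
  proof -
    have "dist (closest_point (T n) v) (closest_point (T n) (w n)) \<le> dist v (w n)"
      using subspace_imp_convex[OF sub(1)] closed_subspace[OF sub(1)] w(1)[of n]
      by (intro closest_point_lipschitz) auto
    then have "dist (closest_point (T n) v) (w n) \<le> dist v (w n)"
      using w(1) by (simp add: closest_point_self)
    then have "dist (closest_point (T n) v) v \<le> 2 * dist (w n) v"
      using dist_triangle[of "closest_point (T n) v" v "w n"] dist_commute[of v "w n"] by linarith
    then show ?thesis by (simp add: dist_norm)
  qed
  then have "\<forall>\<^sub>F n in sequentially. norm (closest_point (T n) v - v) \<le> 2 * norm (w n - v)"
    by (rule always_eventually[OF allI])
  moreover have "(\<lambda>n. 2 * norm (w n - v)) \<longlonglongrightarrow> 0"
    using tendsto_mult_right_zero[OF tendsto_norm_zero[OF LIM_zero[OF w(2)]], of 2] by simp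
  ultimately have "(\<lambda>n. closest_point (T n) v - v) \<longlonglongrightarrow> 0" by (rule Lim_null_comparison)
  then have "(\<lambda>n. closest_point (T n) v) \<longlonglongrightarrow> v" by (rule LIM_zero_cancel)
  then have "closest_point \<tau> v = v" using lim LIMSEQ_unique by blast
  moreover have "\<tau> \<noteq> {}" using subspace_0[OF sub(2)] by blast
  ultimately show ?thesis
    using closest_point_in_set[OF closed_subspace[OF sub(2)], of v] by simp
qed

text \<open>Here \<open>M p\<close> plays the role of the limit of the tangent spaces of \<open>S\<close> at a point \<open>p\<close> of \<open>R\<close>; the
  condition \<open>lsc\<close> is its lower semicontinuity.\<close>

lemma whitney_conditions:
  fixes R S :: "'a::euclidean_space set"
  assumes S: "\<And>q. q \<in> S \<Longrightarrow> M q \<subseteq> tangent_space S q"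
    and R: "\<And>p. p \<in> R \<Longrightarrow> tangent_space R p \<subseteq> M p"
    and lsc: "\<And>p y v. y \<longlonglongrightarrow> p \<Longrightarrow> v \<in> M p \<Longrightarrow> \<exists>w. (\<forall>n. w n \<in> M (y n)) \<and> w \<longlonglongrightarrow> v"
    and chord: "\<And>p x y w v. (\<And>n. x n \<in> R) \<Longrightarrow> (\<And>n. y n \<in> S) \<Longrightarrow> x \<longlonglongrightarrow> p \<Longrightarrow> y \<longlonglongrightarrow> p \<Longrightarrow>
      (\<And>n. w n \<in> span {y n - x n}) \<Longrightarrow> w \<longlonglongrightarrow> v \<Longrightarrow> v \<in> M p"
  shows "whitney_a R S" "whitney_b R S"
proof -
  have M: "M p \<subseteq> \<tau>" if y: "\<forall>n. y n \<in> S" "y \<longlonglongrightarrow> p"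
    and \<tau>: "subspace_tendsto (\<lambda>n. tangent_space S (y n)) \<tau>" for p y \<tau>
  proof
    fix v assume "v \<in> M p"
    then obtain w where w: "\<forall>n. w n \<in> M (y n)" "w \<longlonglongrightarrow> v" using lsc[OF y(2)] by blast
    have "w n \<in> tangent_space S (y n)" for n using S[of "y n"] y(1) w(1) by blast
    then show "v \<in> \<tau>" by (rule subspace_tendsto_contains_limit[OF \<tau> _ w(2)])
  qed
  show "whitney_a R S"
    unfolding whitney_a_def
  proof (intro ballI allI impI)
    fix p y \<tau> assume "p \<in> R" "\<forall>n. y n \<in> S" "y \<longlonglongrightarrow> p"
      "subspace_tendsto (\<lambda>n. tangent_space S (y n)) \<tau>"
    then show "tangent_space R p \<subseteq> \<tau>" using R[of p] M[of y p \<tau>] by blast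
  qed
  show "whitney_b R S"
    unfolding whitney_b_def
  proof (intro ballI allI impI)
    fix p x y \<tau> l
    assume p: "p \<in> R" and x: "\<forall>n. x n \<in> R" "x \<longlonglongrightarrow> p" and y: "\<forall>n. y n \<in> S" "y \<longlonglongrightarrow> p"
      and \<tau>: "subspace_tendsto (\<lambda>n. tangent_space S (y n)) \<tau>"
      and l: "subspace_tendsto (\<lambda>n. span {y n - x n}) l"
    have "l \<subseteq> M p"
    proof
      fix v assume "v \<in> l"
      then have "closest_point l v = v" by (rule closest_point_self)
      \<comment> \<open>Convergence of the projections exhibits a vector of \<open>l\<close> as a
        limit of vectors on the chord lines.\<close>
      then have lim: "(\<lambda>n. closest_point (span {y n - x n}) v) \<longlonglongrightarrow> v"
        using l by (auto simp: subspace_tendsto_def dest: spec[of _ v])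
      have mem: "closest_point (span {y n - x n}) v \<in> span {y n - x n}" for n
        by (rule closest_point_in_set) (auto intro: closed_span span_zero)
      show "v \<in> M p" using x(1) y(1) by (intro chord[OF _ _ x(2) y(2) mem lim]) auto
    qed
    then show "l \<subseteq> \<tau>" using M[of y p \<tau>] y \<tau> by blast
  qed
qed

text \<open>No sequence in \<open>S\<close> converges to a point of \<open>R\<close>, so both
  conditions hold vacuously.\<close>

lemma whitney_conditions_disjoint_closure:
  assumes "R \<inter> closure S = {}"
  shows "whitney_a R S" "whitney_b R S"
proof -
  have "p \<notin> R" if "\<forall>n. y n \<in> S" "y \<longlonglongrightarrow> p" for y p
    using assms that closure_sequential by blast
  then show "whitney_a R S" "whitney_b R S"
    unfolding whitney_a_def whitney_b_def by blast+
qed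

section \<open>The strata\<close>

definition saddle_sector :: "real \<Rightarrow> point set" where
  "saddle_sector s = {(x, y, z). \<bar>y\<bar> < x \<and> z = s * (x\<^sup>2 - y\<^sup>2) / 4}"

definition edge_ray :: "real \<Rightarrow> point set" where
  "edge_ray e = {(x, y, z). 0 < x \<and> y = e * x \<and> z = 0}"

text \<open>The kernel at \<open>p\<close> of the differential of
  \<open>z - s * (x^2 - y^2) / 4\<close>. It is defined for every \<open>p\<close>, so it also
  provides the limiting planes at the edges and the vertex.\<close>

definition saddle_tangent :: "real \<Rightarrow> point \<Rightarrow> point set" where
  "saddle_tangent s p =
     {v. snd (snd v) = s * (fst p * fst v - fst (snd p) * fst (snd v)) / 2}"

definition ray_line :: "real \<Rightarrow> point set" where
  "ray_line e = {(x, y, z). y = e * x \<and> z = 0}"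

lemma zero_sphere_strata:
  "zero_sphere \<inter> {(x, y, z). z > 0} = saddle_sector 1"
  "zero_sphere \<inter> {(x, y, z). z < 0} = saddle_sector (-1)"
  "zero_sphere \<inter> {(x, y, z). z = 0 \<and> y > 0} = edge_ray 1"
  "zero_sphere \<inter> {(x, y, z). z = 0 \<and> y < 0} = edge_ray (-1)"
proof -
  have pos: "0 \<le> x \<and> 0 < x\<^sup>2 - y\<^sup>2 \<longleftrightarrow> \<bar>y\<bar> < x" for x y :: real
  proof
    assume *: "0 \<le> x \<and> 0 < x\<^sup>2 - y\<^sup>2"
    then have "\<bar>y\<bar>\<^sup>2 < x\<^sup>2" by simp
    with * show "\<bar>y\<bar> < x" using power2_less_imp_less by blast
  next
    assume "\<bar>y\<bar> < x"
    then have "0 \<le> x" "\<bar>y\<bar>\<^sup>2 < x\<^sup>2" by (linarith, intro power_strict_mono) auto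
    then show "0 \<le> x \<and> 0 < x\<^sup>2 - y\<^sup>2" by simp
  qed
  have "(x, y, z) \<in> zero_sphere \<and> 0 < z \<longleftrightarrow> (x, y, z) \<in> saddle_sector 1" for x y z
    using pos[of x y] by (auto simp: zero_sphere_eq saddle_sector_def)
  then show "zero_sphere \<inter> {(x, y, z). z > 0} = saddle_sector 1" by auto
  have "(x, y, z) \<in> zero_sphere \<and> z < 0 \<longleftrightarrow> (x, y, z) \<in> saddle_sector (-1)" for x y z
    using pos[of x y] by (auto simp: zero_sphere_eq saddle_sector_def)
  then show "zero_sphere \<inter> {(x, y, z). z < 0} = saddle_sector (-1)" by auto
  show "zero_sphere \<inter> {(x, y, z). z = 0 \<and> y > 0} = edge_ray 1"
    "zero_sphere \<inter> {(x, y, z). z = 0 \<and> y < 0} = edge_ray (-1)"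
    by (auto simp: zero_sphere_eq_graph \<Phi>_apply edge_ray_def)
qed

text \<open>A boundary point is approached by increasing \<open>x\<close> slightly and recomputing
  \<open>z\<close> on the saddle.\<close>

lemma closure_saddle_sector:
  "closure (saddle_sector s) = {(x, y, z). \<bar>y\<bar> \<le> x \<and> z = s * (x\<^sup>2 - y\<^sup>2) / 4}" (is "_ = ?C")
proof
  have "closed ?C" unfolding case_prod_beta
    by (intro closed_Collect_conj closed_Collect_le closed_Collect_eq continuous_intros) auto
  then show "closure (saddle_sector s) \<subseteq> ?C"
    by (intro closure_minimal) (auto simp: saddle_sector_def)
  show "?C \<subseteq> closure (saddle_sector s)"
  proof clarify
    fix x y z :: real assume xy: "\<bar>y\<bar> \<le> x"
    let ?f = "\<lambda>n. (x + inverse (real (Suc n)), y, s * ((x + inverse (real (Suc n)))\<^sup>2 - y\<^sup>2) / 4)"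
    have "?f \<longlonglongrightarrow> (x + 0, y, s * ((x + 0)\<^sup>2 - y\<^sup>2) / 4)"
      by (intro tendsto_intros LIMSEQ_inverse_real_of_nat) auto
    moreover have "?f n \<in> saddle_sector s" for n
    proof -
      have "0 < inverse (real (Suc n))" by simp
      then have "\<bar>y\<bar> < x + inverse (real (Suc n))" using xy by linarith
      then show ?thesis by (simp add: saddle_sector_def)
    qed
    ultimately show "(x, y, s * (x\<^sup>2 - y\<^sup>2) / 4) \<in> closure (saddle_sector s)"
      unfolding closure_sequential by (intro exI[of _ "?f"]) simp
  qed
qed

lemma closure_edge_ray: "closure (edge_ray e) = {(x, y, z). 0 \<le> x \<and> y = e * x \<and> z = 0}" (is "_ = ?C")
proof
  have "closed ?C" unfolding case_prod_beta
    by (intro closed_Collect_conj closed_Collect_le closed_Collect_eq continuous_intros)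
  then show "closure (edge_ray e) \<subseteq> ?C" by (intro closure_minimal) (auto simp: edge_ray_def)
  show "?C \<subseteq> closure (edge_ray e)"
  proof clarify
    fix x :: real assume x: "0 \<le> x"
    let ?f = "\<lambda>n. (x + inverse (real (Suc n)), e * (x + inverse (real (Suc n))), 0 :: real)"
    have "?f \<longlonglongrightarrow> (x + 0, e * (x + 0), 0)"
      by (intro tendsto_intros LIMSEQ_inverse_real_of_nat)
    moreover have "?f n \<in> edge_ray e" for n
      using x by (simp add: edge_ray_def add_nonneg_pos)
    ultimately show "(x, e * x, 0) \<in> closure (edge_ray e)"
      unfolding closure_sequential by (intro exI[of _ "?f"]) simp
  qed
qed

section \<open>Tangent spaces of the strata\<close>

lemma smooth_on_quadratic_curve:
  fixes a b c :: "'a::real_normed_vector"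
  shows "smooth_on (\<lambda>t :: real. a + t *\<^sub>R b + t\<^sup>2 *\<^sub>R c) S"
proof (rule smooth_on_closed_family)
  let ?q = "\<lambda>(a :: 'a) b c t :: real. a + t *\<^sub>R b + t\<^sup>2 *\<^sub>R c"
  let ?F = "{g. \<exists>a b c. g = ?q a b c}"
  show "?q a b c \<in> ?F" by blast
  fix g assume "g \<in> ?F"
  then obtain a b c where g: "g = ?q a b c" by blast
  let ?g' = "\<lambda>t h. ?q (h *\<^sub>R b) ((2 * h) *\<^sub>R c) 0 t"
  show "\<exists>g'. (\<forall>x. (g has_derivative g' x) (at x)) \<and> (\<forall>v. (\<lambda>x. g' x v) \<in> ?F)"
  proof (intro exI[of _ ?g'] conjI allI)
    show "(g has_derivative ?g' x) (at x)" for x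
      unfolding g by (auto intro!: derivative_eq_intros simp: algebra_simps)
    show "(\<lambda>x. ?g' x v) \<in> ?F" for v by blast
  qed
qed

text \<open>Quadratic curves suffice as witnesses: lifting a straight line in the
  \<open>(x, y)\<close> plane to a quadratic graph gives a curve of degree two.\<close>

lemma tangent_spaceI_quadratic:
  fixes p v c :: "'a::euclidean_space"
  assumes "0 < \<epsilon>" "\<And>t. \<bar>t\<bar> < \<epsilon> \<Longrightarrow> p + t *\<^sub>R v + t\<^sup>2 *\<^sub>R c \<in> S"
  shows "v \<in> tangent_space S p"
proof -
  let ?\<gamma> = "\<lambda>t :: real. p + t *\<^sub>R v + t\<^sup>2 *\<^sub>R c"
  have "(?\<gamma> has_vector_derivative v) (at 0)"
    by (auto intro!: derivative_eq_intros)
  then show ?thesis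
    using assms smooth_on_quadratic_curve[of p v c] unfolding tangent_space_def
    by (intro CollectI exI[of _ ?\<gamma>] exI[of _ \<epsilon>] conjI image_subsetI) (auto simp: abs_less_iff)
qed

lemma open_condition_along_line:
  fixes a b c d :: real
  assumes "\<bar>a\<bar> < c"
  obtains \<epsilon> where "0 < \<epsilon>" "\<And>t. \<bar>t\<bar> < \<epsilon> \<Longrightarrow> \<bar>a + t * b\<bar> < c + t * d"
proof -
  have "open {t. \<bar>a + t * b\<bar> < c + t * d}"
    by (intro open_Collect_less continuous_intros)
  moreover have "0 \<in> {t. \<bar>a + t * b\<bar> < c + t * d}" using assms by simp
  ultimately obtain \<epsilon> where "0 < \<epsilon>" "ball 0 \<epsilon> \<subseteq> {t. \<bar>a + t * b\<bar> < c + t * d}"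
    by (meson open_contains_ball)
  then show thesis by (intro that[of \<epsilon>]) (auto simp: subset_iff)
qed

lemma saddle_tangent_subset_tangent_space:
  assumes "p \<in> saddle_sector s"
  shows "saddle_tangent s p \<subseteq> tangent_space (saddle_sector s) p"
proof
  fix v assume v: "v \<in> saddle_tangent s p"
  obtain x y z where p: "p = (x, y, z)" by (cases p)
  obtain v1 v2 v3 where v_def: "v = (v1, v2, v3)" by (cases v)
  have xyz: "\<bar>y\<bar> < x" "z = s * (x\<^sup>2 - y\<^sup>2) / 4" using assms by (auto simp: p saddle_sector_def)
  have v3: "v3 = s * (x * v1 - y * v2) / 2" using v by (simp add: p v_def saddle_tangent_def)
  obtain \<epsilon> where e: "0 < \<epsilon>" "\<And>t. \<bar>t\<bar> < \<epsilon> \<Longrightarrow> \<bar>y + t * v2\<bar> < x + t * v1"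
    using open_condition_along_line[OF xyz(1)] by metis
  show "v \<in> tangent_space (saddle_sector s) p"
  \<comment> \<open>\<open>c\<close> is the second-order term of the saddle function along the line
    with direction \<open>(v1, v2)\<close>.\<close>
  proof (rule tangent_spaceI_quadratic[OF e(1), where c="(0, 0, s * (v1\<^sup>2 - v2\<^sup>2) / 4)"])
    fix t assume "\<bar>t\<bar> < \<epsilon>"
    then show "p + t *\<^sub>R v + t\<^sup>2 *\<^sub>R (0, 0, s * (v1\<^sup>2 - v2\<^sup>2) / 4) \<in> saddle_sector s"
      using e(2)[of t]
      by (simp add: p v_def saddle_sector_def xyz(2) v3 power2_eq_square field_simps)
  qed
qed

lemma ray_line_subset_tangent_space:
  assumes "p \<in> edge_ray e"
  shows "ray_line e \<subseteq> tangent_space (edge_ray e) p"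
proof
  fix v assume v: "v \<in> ray_line e"
  obtain x where p: "p = (x, e * x, 0)" "0 < x" using assms by (auto simp: edge_ray_def)
  obtain v1 where v_def: "v = (v1, e * v1, 0)" using v by (auto simp: ray_line_def)
  obtain \<epsilon> where e: "0 < \<epsilon>" "\<And>t. \<bar>t\<bar> < \<epsilon> \<Longrightarrow> \<bar>0 + t * 0\<bar> < x + t * v1"
    using open_condition_along_line[of 0 x] p(2) by (metis abs_zero)
  show "v \<in> tangent_space (edge_ray e) p"
  proof (rule tangent_spaceI_quadratic[OF e(1), where c=0])
    fix t assume "\<bar>t\<bar> < \<epsilon>"
    then show "p + t *\<^sub>R v + t\<^sup>2 *\<^sub>R 0 \<in> edge_ray e"
      using e(2)[of t] by (simp add: p v_def edge_ray_def algebra_simps)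
  qed
qed

text \<open>The defining function of the saddle vanishes on \<open>R\<close>. Since \<open>R\<close>
  may be any subset of the surface, this covers the edges and the vertex.\<close>

lemma tangent_space_subset_saddle_tangent:
  assumes "\<And>x y z. (x, y, z) \<in> R \<Longrightarrow> z = s * (x\<^sup>2 - y\<^sup>2) / 4"
  shows "tangent_space R p \<subseteq> saddle_tangent s p"
proof
  fix v assume v: "v \<in> tangent_space R p"
  let ?h = "\<lambda>q :: point. snd (snd q) - s * ((fst q)\<^sup>2 - (fst (snd q))\<^sup>2) / 4"
  let ?h' = "\<lambda>v :: point. snd (snd v) - s * (2 * fst p * fst v - 2 * fst (snd p) * fst (snd v)) / 4"
  have "(?h has_derivative ?h') (at p)"
    by (auto intro!: derivative_eq_intros simp: fun_eq_iff field_simps)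
  moreover have "?h q = 0" if "q \<in> R" for q
    using assms[of "fst q" "fst (snd q)" "snd (snd q)"] that by simp
  ultimately have "?h' v = 0" using v by (intro tangent_space_annihilated)
  then show "v \<in> saddle_tangent s p" by (simp add: saddle_tangent_def algebra_simps)
qed

lemma tangent_space_subset_ray_line:
  assumes "R \<subseteq> ray_line e"
  shows "tangent_space R p \<subseteq> ray_line e"
proof
  fix v assume v: "v \<in> tangent_space R p"
  have "((\<lambda>q :: point. fst (snd q) - e * fst q) has_derivative (\<lambda>v. fst (snd v) - e * fst v)) (at p)"
    "((\<lambda>q :: point. snd (snd q)) has_derivative (\<lambda>v. snd (snd v))) (at p)"
    by (auto intro!: derivative_eq_intros)
  moreover have "fst (snd q) - e * fst q = 0" "snd (snd q) = 0" if "q \<in> R" for q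
    using assms that by (auto simp: ray_line_def)
  ultimately have "fst (snd v) - e * fst v = 0" "snd (snd v) = 0"
    using v tangent_space_annihilated[of R "\<lambda>q. fst (snd q) - e * fst q" _ p v]
      tangent_space_annihilated[of R "\<lambda>q. snd (snd q)" _ p v] by blast+
  then show "v \<in> ray_line e" by (simp add: ray_line_def case_prod_beta)
qed

section \<open>Whitney conditions for adjacent strata\<close>

text \<open>A chord of the graph of a quadratic function is parallel to the tangent plane over its
  midpoint.\<close>

lemma whitney_saddle_sector:
  assumes R: "\<And>x y z. (x, y, z) \<in> R \<Longrightarrow> z = s * (x\<^sup>2 - y\<^sup>2) / 4"
  shows "whitney_a R (saddle_sector s)" "whitney_b R (saddle_sector s)"
proof -
  note tan = saddle_tangent_subset_tangent_space tangent_space_subset_saddle_tangent[OF R]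
  have lsc: "\<exists>w. (\<forall>n. w n \<in> saddle_tangent s (y n)) \<and> w \<longlonglongrightarrow> v"
    if y: "y \<longlonglongrightarrow> p" and v: "v \<in> saddle_tangent s p" for p y v
  proof (intro exI conjI allI)
    \<comment> \<open>Keep the first two components of \<open>v\<close> and correct the third so
      that the vector lies in the plane at \<open>y n\<close>.\<close>
    let ?w = "\<lambda>n. (fst v, fst (snd v), s * (fst (y n) * fst v - fst (snd (y n)) * fst (snd v)) / 2)"
    show "?w n \<in> saddle_tangent s (y n)" for n by (simp add: saddle_tangent_def)
    have "?w \<longlonglongrightarrow> (fst v, fst (snd v), s * (fst p * fst v - fst (snd p) * fst (snd v)) / 2)"
      by (intro tendsto_intros y) auto
    also have "(fst v, fst (snd v), s * (fst p * fst v - fst (snd p) * fst (snd v)) / 2) = v"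
      using v by (simp add: saddle_tangent_def prod_eq_iff)
    finally show "?w \<longlonglongrightarrow> v" .
  qed
  have chord: "v \<in> saddle_tangent s p"
    if x: "\<And>n. x n \<in> R" and y: "\<And>n. y n \<in> saddle_sector s" and lim: "x \<longlonglongrightarrow> p" "y \<longlonglongrightarrow> p"
      and w: "\<And>n. w n \<in> span {y n - x n}" "w \<longlonglongrightarrow> v" for p x y w v
  proof -
    have eq: "snd (snd (w n)) = s * ((fst (x n) + fst (y n)) / 2 * fst (w n) -
            (fst (snd (x n)) + fst (snd (y n))) / 2 * fst (snd (w n))) / 2" for n
    proof -
      obtain k where k: "w n = k *\<^sub>R (y n - x n)" using w(1)[of n] by (auto simp: span_singleton)
      obtain x1 x2 x3 where xn: "x n = (x1, x2, x3)" by (cases "x n")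
      obtain y1 y2 y3 where yn: "y n = (y1, y2, y3)" by (cases "y n")
      have 3: "x3 = s * (x1\<^sup>2 - x2\<^sup>2) / 4" using R x[of n] xn by simp
      have 4: "y3 = s * (y1\<^sup>2 - y2\<^sup>2) / 4" using y[of n] yn by (simp add: saddle_sector_def)
      have "k * (s * (y1\<^sup>2 - y2\<^sup>2) / 4 - s * (x1\<^sup>2 - x2\<^sup>2) / 4) =
          s * ((x1 + y1) / 2 * (k * (y1 - x1)) - (x2 + y2) / 2 * (k * (y2 - x2))) / 2"
        by (simp add: power2_eq_square field_simps)
      then show ?thesis by (simp add: k xn yn 3 4)
    qed
    have "(\<lambda>n. s * ((fst (x n) + fst (y n)) / 2 * fst (w n) -
            (fst (snd (x n)) + fst (snd (y n))) / 2 * fst (snd (w n))) / 2) \<longlonglongrightarrow>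
          s * ((fst p + fst p) / 2 * fst v - (fst (snd p) + fst (snd p)) / 2 * fst (snd v)) / 2"
      by (intro tendsto_intros lim w(2)) auto
    then have "(\<lambda>n. snd (snd (w n))) \<longlonglongrightarrow>
        s * ((fst p + fst p) / 2 * fst v - (fst (snd p) + fst (snd p)) / 2 * fst (snd v)) / 2"
      by (simp only: eq)
    moreover have "(\<lambda>n. snd (snd (w n))) \<longlonglongrightarrow> snd (snd v)" by (intro tendsto_intros w(2))
    ultimately have "snd (snd v) =
        s * ((fst p + fst p) / 2 * fst v - (fst (snd p) + fst (snd p)) / 2 * fst (snd v)) / 2"
      by (rule LIMSEQ_unique[symmetric])
    then show ?thesis by (simp add: saddle_tangent_def)
  qed
  show "whitney_a R (saddle_sector s)"
    by (rule whitney_conditions(1)[where M="saddle_tangent s"];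
        (rule tan(1) | rule tan(2) | rule lsc | rule chord); assumption)
  show "whitney_b R (saddle_sector s)"
    by (rule whitney_conditions(2)[where M="saddle_tangent s"];
        (rule tan(1) | rule tan(2) | rule lsc | rule chord); assumption)
qed

lemma subspace_ray_line: "subspace (ray_line e)"
  by (auto simp: subspace_def ray_line_def zero_prod_def algebra_simps)

text \<open>All tangent and chord directions lie in one fixed closed line, so that line itself
  serves as the limit. The case of interest is \<open>R = {q0}\<close>.\<close>

lemma whitney_edge_ray:
  assumes R: "R \<subseteq> ray_line e"
  shows "whitney_a R (edge_ray e)" "whitney_b R (edge_ray e)"
proof -
  have chord: "v \<in> ray_line e"
    if x: "\<And>n. x n \<in> R" and y: "\<And>n. y n \<in> edge_ray e"
      and w: "\<And>n. w n \<in> span {y n - x n}" "w \<longlonglongrightarrow> v" for x y w v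
  proof -
    have "y n - x n \<in> ray_line e" for n
    proof (rule subspace_diff[OF subspace_ray_line])
      show "y n \<in> ray_line e" using y[of n] by (auto simp: edge_ray_def ray_line_def)
      show "x n \<in> ray_line e" using x R by blast
    qed
    then have "span {y n - x n} \<subseteq> ray_line e" for n
      by (intro span_minimal subspace_ray_line) simp
    then have "w n \<in> ray_line e" for n using w(1) by blast
    then show ?thesis
      using closed_sequentially[OF closed_subspace[OF subspace_ray_line]] w(2) by blast
  qed
  have lsc: "\<exists>w. (\<forall>n :: nat. w n \<in> ray_line e) \<and> w \<longlonglongrightarrow> v" if "v \<in> ray_line e" for v
    using that by (intro exI[of _ "\<lambda>_. v"]) simp
  note tan = ray_line_subset_tangent_space tangent_space_subset_ray_line[OF R]
  show "whitney_a R (edge_ray e)"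
    by (rule whitney_conditions(1)[where M="\<lambda>_. ray_line e"];
        (rule tan(1) | rule tan(2) | rule lsc | rule chord); assumption)
  show "whitney_b R (edge_ray e)"
    by (rule whitney_conditions(2)[where M="\<lambda>_. ray_line e"];
        (rule tan(1) | rule tan(2) | rule lsc | rule chord); assumption)
qed

section \<open>Charts that straighten the strata\<close>

definition shear :: "real \<Rightarrow> point \<Rightarrow> point" where
  "shear m p = p + (0, 0, m * ((fst p)\<^sup>2 - (fst (snd p))\<^sup>2))"

lemma shear_apply: "shear m (x, y, z) = (x, y, z + m * (x\<^sup>2 - y\<^sup>2))"
  by (simp add: shear_def)

text \<open>A directional derivative of the quadratic term is linear in the base point, so the maps
  composed of a bounded linear part, a constant and a multiple of this term form a closed family.
  Opposite shears are mutually inverse and flatten the saddle to \<open>z = 0\<close>.\<close>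

lemma smooth_on_shear: "smooth_on (shear m) S"
proof (rule smooth_on_closed_family)
  let ?q = "\<lambda>A (c :: point) m p. A p + c + (0, 0, m * ((fst p)\<^sup>2 - (fst (snd p))\<^sup>2)) :: point"
  let ?F = "{g. \<exists>A c m. bounded_linear A \<and> g = ?q A c m}"
  have "shear m = ?q (\<lambda>p. p) 0 m" by (simp add: shear_def fun_eq_iff)
  then show "shear m \<in> ?F" using bounded_linear_ident by blast
  fix g assume "g \<in> ?F"
  then obtain A c m where A: "bounded_linear A" and g: "g = ?q A c m" by blast
  let ?g' = "\<lambda>p v. A v + (0, 0, m * (2 * fst p * fst v - 2 * fst (snd p) * fst (snd v)))"
  let ?B = "\<lambda>v p. (0, 0, m * (2 * fst p * fst v - 2 * fst (snd p) * fst (snd v))) :: point"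
  show "\<exists>g'. (\<forall>x. (g has_derivative g' x) (at x)) \<and> (\<forall>v. (\<lambda>x. g' x v) \<in> ?F)"
  proof (intro exI[of _ ?g'] conjI allI)
    show "(g has_derivative ?g' x) (at x)" for x
      unfolding g
      by (rule derivative_eq_intros bounded_linear_imp_has_derivative[OF A] refl)+
        (auto simp: algebra_simps fun_eq_iff zero_prod_def)
    have B: "bounded_linear (?B v)" for v
      by (simp only: mult.assoc mult.left_commute[of 2] mult.commute[of _ "fst v"] mult.commute[of _ "fst (snd v)"])
        (intro bounded_linear_intros)
    have "(\<lambda>x. ?g' x v) = ?q (?B v) (A v) 0" for v by (simp add: fun_eq_iff zero_prod_def[symmetric] add.commute)
    then show "(\<lambda>x. ?g' x v) \<in> ?F" for v using B by blast
  qed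
qed

text \<open>Each stratum admits a single chart of an open set \<open>U\<close> onto itself: a shear
  for the sectors, the identity for the rays and the vertex.\<close>

lemma smooth_submanifold_open_in_subspace:
  fixes U E :: "'a::euclidean_space set"
  assumes "open U" "homeomorphism U U \<phi> \<psi>" "smooth_on \<phi> U" "smooth_on \<psi> U" "subspace E"
    "S \<subseteq> U" "\<phi> ` S = U \<inter> E"
  shows "\<exists>k. smooth_submanifold k S"
proof -
  have "U \<inter> S = S" using assms(6) by blast
  then have "smooth_submanifold (dim E) S" unfolding smooth_submanifold_def
    using assms by (intro ballI exI[of _ U] exI[of _ \<phi>] exI[of _ \<psi>] exI[of _ E]) auto
  then show ?thesis by (rule exI)
qed

lemma smooth_on_ident: "smooth_on (\<lambda>p :: point. p) S"
  using smooth_on_shear[of 0 S] by (simp add: shear_def[abs_def] flip: zero_prod_def)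

lemma smooth_submanifold_strata:
  "\<exists>k. smooth_submanifold k (saddle_sector s)" "\<exists>k. smooth_submanifold k (edge_ray e)"
  "\<exists>k. smooth_submanifold k {q0}"
proof -
  let ?U = "{(x, y, z). \<bar>y\<bar> < x} :: point set"
  show "\<exists>k. smooth_submanifold k (saddle_sector s)"
  proof (rule smooth_submanifold_open_in_subspace[of ?U "shear (- s / 4)" "shear (s / 4)"
        "{p. snd (snd p) = 0}"])
    show "open ?U" unfolding case_prod_beta by (intro open_Collect_less continuous_intros)
    have "continuous_on A (shear m)" for A m
      unfolding shear_def by (intro continuous_intros)
    moreover have "shear m (shear (- m) p) = p" for m p by (cases p) (simp add: shear_apply)
    from this[of "s / 4"] this[of "- (s / 4)"]
    have inv: "shear (s / 4) (shear (- s / 4) p) = p" "shear (- s / 4) (shear (s / 4) p) = p" for p by simp_all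
    moreover have "shear m p \<in> ?U \<longleftrightarrow> p \<in> ?U" for m p by (cases p) (simp add: shear_apply)
    ultimately show "homeomorphism ?U ?U (shear (- s / 4)) (shear (s / 4))"
      by (intro homeomorphismI) (simp_all add: image_subset_iff del: mem_Collect_eq)
    show "smooth_on (shear (- s / 4)) ?U" "smooth_on (shear (s / 4)) ?U" by (rule smooth_on_shear)+
    show "subspace {p :: point. snd (snd p) = 0}" by (simp add: subspace_def)
    show "saddle_sector s \<subseteq> ?U" by (auto simp: saddle_sector_def)
    show "shear (- s / 4) ` saddle_sector s = ?U \<inter> {p. snd (snd p) = 0}"
    proof (intro equalityI subsetI)
      fix q assume "q \<in> ?U \<inter> {p. snd (snd p) = 0}"
      then have "shear (s / 4) q \<in> saddle_sector s"
        by (cases q) (simp add: shear_apply saddle_sector_def)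
      then show "q \<in> shear (- s / 4) ` saddle_sector s" by (metis inv(2) image_eqI)
    qed (auto simp: saddle_sector_def shear_apply)
  qed
  have id: "homeomorphism U U (\<lambda>p. p) (\<lambda>p. p)" for U :: "point set"
    by (rule homeomorphism_ident)
  show "\<exists>k. smooth_submanifold k (edge_ray e)"
  proof (rule smooth_submanifold_open_in_subspace[OF _ id smooth_on_ident smooth_on_ident
        subspace_ray_line[of e]])
    show "open {p :: point. 0 < fst p}" by (intro open_Collect_less continuous_intros)
  qed (auto simp: edge_ray_def ray_line_def)
  show "\<exists>k. smooth_submanifold k {q0}"
    by (rule smooth_submanifold_open_in_subspace[OF open_UNIV id smooth_on_ident smooth_on_ident
          subspace_single_0]) (auto simp: q0_def zero_prod_def)
qed

text \<open>For distinct strata, \<open>R\<close> meets the closure of \<open>S\<close> only if it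
  has smaller dimension, and then it lies in it: rays and vertex bound both sectors, the vertex
  bounds both rays. This one case analysis serves the frontier condition and both Whitney
  conditions.\<close>

lemma strata_incidence:
  fixes R S :: "point set"
  assumes R: "R \<in> {saddle_sector 1, saddle_sector (-1), edge_ray 1, edge_ray (-1), {q0}}"
    and S: "S \<in> {saddle_sector 1, saddle_sector (-1), edge_ray 1, edge_ray (-1), {q0}}"
  shows "R = S \<or> R \<inter> closure S = {} \<or> R \<subseteq> closure S \<and> whitney_a R S \<and> whitney_b R S"
proof -
  have edge: "R \<subseteq> closure (saddle_sector s) \<and> whitney_a R (saddle_sector s) \<and> whitney_b R (saddle_sector s)"
    if "R \<in> {edge_ray 1, edge_ray (-1), {q0}}" for s
  proof -
    have R: "(x, y, z) \<in> R \<Longrightarrow> z = 0 \<and> x\<^sup>2 = y\<^sup>2 \<and> \<bar>y\<bar> \<le> x" for x y z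
      using that by (auto simp: edge_ray_def q0_def)
    then have "R \<subseteq> closure (saddle_sector s)" by (auto simp: closure_saddle_sector)
    moreover have "whitney_a R (saddle_sector s)" "whitney_b R (saddle_sector s)"
      by (rule whitney_saddle_sector; use R in force)+
    ultimately show ?thesis by blast
  qed
  have "{q0} \<subseteq> ray_line e" for e by (simp add: q0_def ray_line_def)
  note vertex = whitney_edge_ray[OF this]
  have q0: "q0 \<in> closure (edge_ray e)" for e by (simp add: closure_edge_ray q0_def)
  \<comment> \<open>A common point has two opposite values of \<open>z\<close>, which forces
    \<open>x^2 = y^2\<close>, against \<open>\<bar>y\<bar> < x\<close>.\<close>
  have disj: "saddle_sector s \<inter> closure (saddle_sector (- s)) = {}" if "s \<noteq> 0" for s
  proof -
    have False if "\<bar>y\<bar> < x" "x\<^sup>2 = y\<^sup>2" for x y :: real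
    proof -
      have "\<bar>x\<bar> = \<bar>y\<bar>" using that(2) by (simp add: power2_eq_iff abs_eq_iff)
      with that(1) show False by linarith
    qed
    with \<open>s \<noteq> 0\<close> show ?thesis by (simp only: closure_saddle_sector) (auto simp: saddle_sector_def)
  qed
  have disj': "saddle_sector 1 \<inter> closure (saddle_sector (-1)) = {}"
    "saddle_sector (-1) \<inter> closure (saddle_sector 1) = {}"
    using disj[of 1] disj[of "-1"] by simp_all
  have rays: "saddle_sector s \<inter> closure (edge_ray e) = {}" "saddle_sector s \<inter> closure {q0} = {}"
    "edge_ray e \<inter> closure {q0} = {}" if "e \<in> {1, -1}" for s e
    using that by (simp_all only: closure_edge_ray) (auto simp: saddle_sector_def edge_ray_def q0_def)
  have rays': "edge_ray 1 \<inter> closure (edge_ray (-1)) = {}" "edge_ray (-1) \<inter> closure (edge_ray 1) = {}"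
    by (simp_all only: closure_edge_ray) (auto simp: edge_ray_def)
  consider s where "S = saddle_sector s" "s \<in> {1, -1}" | e where "S = edge_ray e" "e \<in> {1, -1}" | "S = {q0}"
    using S by blast
  then show ?thesis
  proof cases
    case 1
    then show ?thesis using R edge[of s] disj' by auto
  next
    case 2
    then show ?thesis using R rays(1)[of e] rays' vertex[of e] q0[of e] by auto
  next
    case 3
    then show ?thesis using R rays(2,3)[of 1] rays(3)[of "-1"] by auto
  qed
qed

lemma whitney_stratification_zero_sphere:
  "whitney_stratification zero_sphere
     {saddle_sector 1, saddle_sector (-1), edge_ray 1, edge_ray (-1), {q0}}"
    (is "whitney_stratification _ ?\<S>")
  unfolding whitney_stratification_def
proof (intro conjI)
  show "closed zero_sphere" by (rule closed_zero_sphere)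
  have q0: "q0 \<in> zero_sphere" by (simp add: zero_sphere_eq q0_def)
  have 1: "zero_sphere \<subseteq> \<Union>?\<S>"
  proof (rule subsetI, rule ccontr)
    fix q assume "q \<in> zero_sphere" "q \<notin> \<Union>?\<S>"
    moreover obtain x y z where "q = (x, y, z)" by (cases q)
    ultimately have S: "(x, y, z) \<in> zero_sphere" and nin: "(x, y, z) \<notin> \<Union>?\<S>" by simp_all
    have "(x, y, z) \<notin> zero_sphere \<inter> {(x, y, z). z > 0}" "(x, y, z) \<notin> zero_sphere \<inter> {(x, y, z). z < 0}"
      "(x, y, z) \<notin> zero_sphere \<inter> {(x, y, z). z = 0 \<and> y > 0}"
      "(x, y, z) \<notin> zero_sphere \<inter> {(x, y, z). z = 0 \<and> y < 0}" "(x, y, z) \<noteq> q0"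
      using nin unfolding zero_sphere_strata by auto
    then have "z = 0" "y = 0" "x \<noteq> 0" using S by (auto simp: q0_def)
    then show False using S by (simp add: zero_sphere_eq)
  qed
  have 2: "\<Union>?\<S> \<subseteq> zero_sphere"
    using q0 unfolding zero_sphere_strata[symmetric] by auto
  have 3: "disjoint ?\<S>"
    unfolding zero_sphere_strata[symmetric] disjoint_def by (auto simp: q0_def)
  have 4: "{} \<notin> ?\<S>"
  proof -
    have "(2, 0, s) \<in> saddle_sector s" "(1, e, 0) \<in> edge_ray e" for s e
      by (auto simp: saddle_sector_def edge_ray_def)
    then show ?thesis by blast
  qed
  show "partition_on zero_sphere ?\<S>"
    unfolding partition_on_def by (intro conjI equalityI 1 2 3 4)
  show "locally_finite_in euclidean ?\<S>"
    by (simp add: finite_imp_locally_finite_in)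
  show "\<forall>S\<in>?\<S>. \<exists>k. smooth_submanifold k S" using smooth_submanifold_strata by blast
  show "\<forall>R\<in>?\<S>. \<forall>S\<in>?\<S>. R \<inter> closure S \<noteq> {} \<longrightarrow> R \<subseteq> closure S"
  proof (intro ballI impI)
    fix R S assume "R \<in> ?\<S>" "S \<in> ?\<S>" "R \<inter> closure S \<noteq> {}"
    then show "R \<subseteq> closure S" using strata_incidence[of R S] closure_subset[of S] by blast
  qed
  show "\<forall>R\<in>?\<S>. \<forall>S\<in>?\<S>. R \<noteq> S \<longrightarrow> whitney_a R S \<and> whitney_b R S"
  proof (intro ballI impI)
    fix R S assume "R \<in> ?\<S>" "S \<in> ?\<S>" "R \<noteq> S"
    then show "whitney_a R S \<and> whitney_b R S"
      using strata_incidence[of R S] whitney_conditions_disjoint_closure[of R S] by blast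
  qed
qed

theorem theorem14:
  defines "J \<equiv> causal_future q0"
    and "I \<equiv> chronological_future q0"
    and "\<A> \<equiv> chronological_future q0 \<union> {q0}"
    and "S0 \<equiv> zero_sphere"
  shows
    "\<comment> \<open>(1)\<close>
     (S0 = J - I \<and> J - I = frontier J \<and> frontier J = frontier I \<and> frontier I = frontier \<A>)
   \<and> \<comment> \<open>(2)\<close>
     (S0 = {(x, y, z). x = \<Phi> (y, z)} \<and> continuous_on UNIV \<Phi> \<and>
      topological_manifold 2 (top_of_set S0))
   \<and> \<comment> \<open>(3)\<close>
     ((\<forall>y z. \<Phi> (- y, z) = \<Phi> (y, z) \<and> \<Phi> (y, - z) = \<Phi> (y, z)) \<and>
      real_analytic2_on \<Phi> {(y, z). z \<noteq> 0} \<and>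
      (\<forall>y. y \<noteq> 0 \<longrightarrow> (\<exists>\<epsilon>>0. \<exists>L. L-lipschitz_on (ball (y, 0) \<epsilon>) \<Phi>)) \<and>
      (\<exists>\<epsilon>>0. holder_on (1/2) (ball (0, 0) \<epsilon>) \<Phi>) \<and>
      (\<forall>\<epsilon>>0. \<not> (\<exists>L. L-lipschitz_on (ball (0, 0) \<epsilon>) \<Phi>)))
   \<and> \<comment> \<open>(4)\<close>
     ((\<forall>\<tau>1\<ge>0. \<forall>\<tau>2\<ge>0.
         lightlike (\<tau>1 + \<tau>2) (broken_curve Xplus Xminus q0 \<tau>1) \<and>
         lightlike (\<tau>1 + \<tau>2) (broken_curve Xminus Xplus q0 \<tau>1)) \<and>
      S0 = (\<Union>\<tau>1\<in>{0..}. \<Union>\<tau>2\<in>{0..}. broken_curve Xplus Xminus q0 \<tau>1 ` {0..\<tau>1 + \<tau>2} \<union>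
                                    broken_curve Xminus Xplus q0 \<tau>1 ` {0..\<tau>1 + \<tau>2}) \<and>
      (\<forall>\<tau>1\<ge>0. \<forall>\<tau>2\<ge>0.
         flow Xminus \<tau>2 (flow Xplus \<tau>1 q0) = (\<tau>1 + \<tau>2, \<tau>1 - \<tau>2, - \<tau>1 * \<tau>2) \<and>
         flow Xplus \<tau>2 (flow Xminus \<tau>1 q0) = (\<tau>1 + \<tau>2, \<tau>2 - \<tau>1, \<tau>1 * \<tau>2)) \<and>
      S0 = {flow Xminus \<tau>2 (flow Xplus \<tau>1 q0) | \<tau>1 \<tau>2. \<tau>1 \<ge> 0 \<and> \<tau>2 \<ge> 0} \<union>
           {flow Xplus \<tau>2 (flow Xminus \<tau>1 q0) | \<tau>1 \<tau>2. \<tau>1 \<ge> 0 \<and> \<tau>2 \<ge> 0})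
   \<and> \<comment> \<open>(5)\<close>
     ((\<forall>s. flow Y s ` S0 = S0 \<and> flow X0 s ` S0 = S0) \<and>
      (\<forall>\<sigma>\<in>{1, -1}. \<forall>q\<in>S0 \<inter> {(x, y, z). sgn z = \<sigma>}.
         S0 \<inter> {(x, y, z). sgn z = \<sigma>} = {flow Y s (flow X0 r q) | r s. True} \<and>
         regular_parametrization (\<lambda>(r, s). flow Y s (flow X0 r q)) UNIV
           (S0 \<inter> {(x, y, z). sgn z = \<sigma>})))
   \<and> \<comment> \<open>(6)\<close>
     (S0 = {(x, y, z). 16 * z\<^sup>2 = (x\<^sup>2 - y\<^sup>2)\<^sup>2 \<and> x\<^sup>2 - y\<^sup>2 \<ge> 0 \<and> x \<ge> 0} \<and> semialgebraic S0)
   \<and> \<comment> \<open>(7)\<close>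
     whitney_stratification S0
       {S0 \<inter> {(x, y, z). z > 0}, S0 \<inter> {(x, y, z). z < 0},
        S0 \<inter> {(x, y, z). z = 0 \<and> y > 0}, S0 \<inter> {(x, y, z). z = 0 \<and> y < 0}, {q0}}
   \<and> \<comment> \<open>(8)\<close>
     ((\<forall>c. c \<noteq> 0 \<longrightarrow>
         S0 \<inter> {(x, y, z). z = c} = {(x, y, z). x\<^sup>2 - y\<^sup>2 = 4 * \<bar>z\<bar> \<and> x > 0 \<and> z = c} \<and>
         S0 \<inter> {(x, y, z). z = c} \<in> components {(x, y, z). x\<^sup>2 - y\<^sup>2 = 4 * \<bar>z\<bar> \<and> z = c}) \<and>
      S0 \<inter> {(x, y, z). z = 0} = {(x, y, z). x = \<bar>y\<bar> \<and> z = 0} \<and>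
      (\<forall>k. -1 < k \<and> k < 1 \<longrightarrow>
         S0 \<inter> {(x, y, z). y = k * x} =
           {(x, y, z). 4 * z = (1 - k\<^sup>2) * x\<^sup>2 \<and> x \<ge> 0 \<and> y = k * x} \<union>
           {(x, y, z). 4 * z = - (1 - k\<^sup>2) * x\<^sup>2 \<and> x \<ge> 0 \<and> y = k * x}) \<and>
      S0 \<inter> {(x, y, z). y = x} = {(x, y, z). y = x \<and> x \<ge> 0 \<and> z = 0} \<and>
      S0 \<inter> {(x, y, z). y = - x} = {(x, y, z). y = - x \<and> x \<ge> 0 \<and> z = 0})"
  unfolding assms
proof (intro conjI)
  show "zero_sphere = causal_future q0 - chronological_future q0"
    by (simp add: causal_minus_chronological)
  show "causal_future q0 - chronological_future q0 = frontier (causal_future q0)"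
    "frontier (causal_future q0) = frontier (chronological_future q0)"
    "frontier (chronological_future q0) = frontier (chronological_future q0 \<union> {q0})"
    by (simp_all only: causal_minus_chronological frontier_futures)
  show "zero_sphere = {(x, y, z). x = \<Phi> (y, z)}"
    by (auto simp: zero_sphere_eq_graph)
  show "continuous_on UNIV \<Phi>" by (rule continuous_on_\<Phi>)
  show "topological_manifold 2 (top_of_set zero_sphere)" by (rule topological_manifold_zero_sphere)
  show "\<forall>y z. \<Phi> (- y, z) = \<Phi> (y, z) \<and> \<Phi> (y, - z) = \<Phi> (y, z)" by (simp add: \<Phi>_even)
  show "real_analytic2_on \<Phi> {(y, z). z \<noteq> 0}" by (rule \<Phi>_real_analytic)
  show "\<forall>y. y \<noteq> 0 \<longrightarrow> (\<exists>\<epsilon>>0. \<exists>L. L-lipschitz_on (ball (y, 0) \<epsilon>) \<Phi>)"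
    using \<Phi>_locally_lipschitz by simp
  show "\<exists>\<epsilon>>0. holder_on (1/2) (ball (0, 0) \<epsilon>) \<Phi>"
    using \<Phi>_holder by (intro exI[of _ 1] conjI) simp_all
  show "\<forall>\<epsilon>>0. \<not> (\<exists>L. L-lipschitz_on (ball (0, 0) \<epsilon>) \<Phi>)" using \<Phi>_not_lipschitz by simp
  show "\<forall>\<tau>1\<ge>0. \<forall>\<tau>2\<ge>0.
         lightlike (\<tau>1 + \<tau>2) (broken_curve Xplus Xminus q0 \<tau>1) \<and>
         lightlike (\<tau>1 + \<tau>2) (broken_curve Xminus Xplus q0 \<tau>1)"
    unfolding broken_curve_eq_two_piece_curve
    by (intro allI impI conjI lightlike_two_piece_curve) simp_all
  show "zero_sphere = (\<Union>\<tau>1\<in>{0..}. \<Union>\<tau>2\<in>{0..}. broken_curve Xplus Xminus q0 \<tau>1 ` {0..\<tau>1 + \<tau>2} \<union>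
                                    broken_curve Xminus Xplus q0 \<tau>1 ` {0..\<tau>1 + \<tau>2})"
    by (rule zero_sphere_eq_broken_curves)
  show "\<forall>\<tau>1\<ge>0. \<forall>\<tau>2\<ge>0.
         flow Xminus \<tau>2 (flow Xplus \<tau>1 q0) = (\<tau>1 + \<tau>2, \<tau>1 - \<tau>2, - \<tau>1 * \<tau>2) \<and>
         flow Xplus \<tau>2 (flow Xminus \<tau>1 q0) = (\<tau>1 + \<tau>2, \<tau>2 - \<tau>1, \<tau>1 * \<tau>2)"
    by (simp add: flow_edges)
  show "zero_sphere = {flow Xminus \<tau>2 (flow Xplus \<tau>1 q0) | \<tau>1 \<tau>2. \<tau>1 \<ge> 0 \<and> \<tau>2 \<ge> 0} \<union>
           {flow Xplus \<tau>2 (flow Xminus \<tau>1 q0) | \<tau>1 \<tau>2. \<tau>1 \<ge> 0 \<and> \<tau>2 \<ge> 0}"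
    by (rule zero_sphere_eq_edges)
  show "\<forall>s. flow Y s ` zero_sphere = zero_sphere \<and> flow X0 s ` zero_sphere = zero_sphere"
    by (simp add: flow_Y_zero_sphere flow_X0_zero_sphere)
  show "\<forall>\<sigma>\<in>{1, -1}. \<forall>q\<in>zero_sphere \<inter> {(x, y, z). sgn z = \<sigma>}.
         zero_sphere \<inter> {(x, y, z). sgn z = \<sigma>} = {flow Y s (flow X0 r q) | r s. True} \<and>
         regular_parametrization (\<lambda>(r, s). flow Y s (flow X0 r q)) UNIV
           (zero_sphere \<inter> {(x, y, z). sgn z = \<sigma>})"
  proof (intro ballI)
    fix \<sigma> :: real and q assume "\<sigma> \<in> {1, -1}" and q: "q \<in> zero_sphere \<inter> {(x, y, z). sgn z = \<sigma>}"
    then have "\<sigma> \<noteq> 0" by auto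
    from regular_parametrization_symmetry_orbit[OF q this]
    show "zero_sphere \<inter> {(x, y, z). sgn z = \<sigma>} = {flow Y s (flow X0 r q) | r s. True} \<and>
         regular_parametrization (\<lambda>(r, s). flow Y s (flow X0 r q)) UNIV
           (zero_sphere \<inter> {(x, y, z). sgn z = \<sigma>})" by (intro conjI)
  qed
  show "zero_sphere = {(x, y, z). 16 * z\<^sup>2 = (x\<^sup>2 - y\<^sup>2)\<^sup>2 \<and> x\<^sup>2 - y\<^sup>2 \<ge> 0 \<and> x \<ge> 0}"
    by (rule zero_sphere_eq_algebraic)
  show "semialgebraic zero_sphere" by (rule semialgebraic_zero_sphere)
  show "whitney_stratification zero_sphere
       {zero_sphere \<inter> {(x, y, z). z > 0}, zero_sphere \<inter> {(x, y, z). z < 0},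
        zero_sphere \<inter> {(x, y, z). z = 0 \<and> y > 0}, zero_sphere \<inter> {(x, y, z). z = 0 \<and> y < 0}, {q0}}"
    unfolding zero_sphere_strata by (rule whitney_stratification_zero_sphere)
  show "\<forall>c. c \<noteq> 0 \<longrightarrow>
         zero_sphere \<inter> {(x, y, z). z = c} = {(x, y, z). x\<^sup>2 - y\<^sup>2 = 4 * \<bar>z\<bar> \<and> x > 0 \<and> z = c} \<and>
         zero_sphere \<inter> {(x, y, z). z = c} \<in> components {(x, y, z). x\<^sup>2 - y\<^sup>2 = 4 * \<bar>z\<bar> \<and> z = c}"
    by (intro allI impI conjI zero_sphere_section_const)
  show "zero_sphere \<inter> {(x, y, z). z = 0} = {(x, y, z). x = \<bar>y\<bar> \<and> z = 0}"
    by (rule zero_sphere_section_zero)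
  show "\<forall>k. -1 < k \<and> k < 1 \<longrightarrow>
         zero_sphere \<inter> {(x, y, z). y = k * x} =
           {(x, y, z). 4 * z = (1 - k\<^sup>2) * x\<^sup>2 \<and> x \<ge> 0 \<and> y = k * x} \<union>
           {(x, y, z). 4 * z = - (1 - k\<^sup>2) * x\<^sup>2 \<and> x \<ge> 0 \<and> y = k * x}"
    by (intro allI impI zero_sphere_section_slope; elim conjE; assumption)
  show "zero_sphere \<inter> {(x, y, z). y = x} = {(x, y, z). y = x \<and> x \<ge> 0 \<and> z = 0}"
    "zero_sphere \<inter> {(x, y, z). y = - x} = {(x, y, z). y = - x \<and> x \<ge> 0 \<and> z = 0}"
    by (rule zero_sphere_section_diagonal)+
qed

end
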